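(* Let $n\geq 1$, $\alpha\in(0,1)$ and $q\in[1,\infty]$. Let $r_0,r_1,r_2\in[1,q]$ satisfy $$\frac n2\left(\frac1{r_j}-\frac1q\right)<1,\qquad j=0,1,2,$$ and let $\eta\in\mathbb{R}$. Then there exists a constant $C>0$, not depending on the data $u_0,u_1,f$ (nor on $K$ or $t$ below), such that the following holds. Assume that $u_0\in L^{r_0}$, $u_1\in L^{r_1}$, that $f(t,\cdot)\in L^{r_2}$ for all $t\ge 0$, and that for some $K>0$ $$\|f(t,\cdot)\|_{L^{r_2}}\leq K(1+t)^{-\eta}\qquad\text{for all } t\geq 0.$$ Then the solution $u$ to the linear Cauchy problem $$\partial_t^{1+\alpha}u-\Delta u=f(t,x)\ \ (t>0,\ x\in\mathbb{R}^n),\qquad u(0,x)=u_0(x),\qquad u_t(0,x)=u_1(x),$$ satisfies, for any $t>0$, $$\|u(t,\cdot)\|_{L^q}\leq C\,t^{-\frac{n(1+\alpha)}2\left(\frac1{r_0}-\frac1q\right)}\|u_0\|_{L^{r_0}}+C\,t^{1-\frac{n(1+\alpha)}2\left(\frac1{r_1}-\frac1q\right)}\|u_1\|_{L^{r_1}}+R(t),$$ where $$R(t)=\begin{cases} CK\,(1+t)^{\alpha-\frac{n(1+\alpha)}2\left(\frac1{r_2}-\frac1q\right)} & \text{if }\eta>1,\\ CK\,(1+t)^{\alpha-\frac{n(1+\alpha)}2\left(\frac1{r_2}-\frac1q\right)}\log(e+t) & \text{if }\eta=1,\\ CK\,(1+t)^{1-\eta+\alpha-\frac{n(1+\alpha)}2\left(\frac1{r_2}-\frac1q\right)}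 & \text{if }\eta<1.\end{cases}$$
   Context: $L^q=L^q(\mathbb{R}^n)$. For $\alpha\in(0,1)$, $\partial_t^{1+\alpha}u=J^{1-\alpha}(\partial_t^2u)$ is the Caputo fractional derivative in time, where $J^{\beta}g(t)=\frac1{\Gamma(\beta)}\int_0^t(t-s)^{\beta-1}g(s)\,ds$ is the Riemann-Liouville fractional integral. The Mittag-Leffler functions are $E_{1+\alpha,\beta}(z)=\sum_{k=0}^\infty\frac{z^k}{\Gamma(k+\alpha k+\beta)}$. Let $\mathfrak F^{-1}$ be the inverse Fourier transform in $x$, $\mathfrak F^{-1}g(x)=(2\pi)^{-n}\int_{\mathbb{R}^n}e^{ix\cdot\xi}g(\xi)\,d\xi$ (extended to tempered distributions), and for $t>0$ let $G_{1+\alpha,\beta}(t,\cdot)=\mathfrak F^{-1}\bigl(E_{1+\alpha,\beta}(-t^{1+\alpha}|\xi|^2)\bigr)$. The solution to the linear Cauchy problem is the function $$u(t,\cdot)=G_{1+\alpha,1}(t,\cdot)*u_0+t\,G_{1+\alpha,2}(t,\cdot)*u_1+\int_0^t(t-s)^{\alpha}\,G_{1+\alpha,1+\alpha}(t-s,\cdot)*f(s,\cdot)\,ds,$$ where $*$ denotes convolution in $x$. The function $f$ is understood to be measurable on $[0,\infty)\times\mathbb{R}^n$. *)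

theory Defs
  imports "HOL-Analysis.Analysis" "HOL-Probability.Essential_Supremum"
begin

section \<open>Lebesgue spaces\<close>

text \<open>Functions are not identified up to null sets. Exponents range over \<^typ>\<open>ereal\<close>, so that
  \<^term>\<open>real_of_ereal (1 / q)\<close> is \<^term>\<open>0 :: real\<close> for \<^term>\<open>q = (\<infinity> :: ereal)\<close>.\<close>

definition Lq :: "ereal \<Rightarrow> ('a::euclidean_space \<Rightarrow> complex) set" where
  "Lq q = {f \<in> borel_measurable lebesgue.
     if q = \<infinity> then \<exists>c. AE x in lebesgue. norm (f x) \<le> c
     else integrable lebesgue (\<lambda>x. norm (f x) powr real_of_ereal q)}"

text \<open>Only meaningful on \<^const>\<open>Lq\<close>: outside of it, totality of the integral produces junk values.\<close>

definition Lq_norm :: "ereal \<Rightarrow> ('a::euclidean_space \<Rightarrow> complex) \<Rightarrow> real" where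
  "Lq_norm q f =
     (if q = \<infinity> then real_of_ereal (esssup lebesgue (\<lambda>x. ereal (norm (f x))))
      else (LINT x|lebesgue. norm (f x) powr real_of_ereal q) powr real_of_ereal (1 / q))"

section \<open>Inverse Fourier transform of tempered distributions\<close>

primrec iter_deriv ::
  "'a::euclidean_space list \<Rightarrow> ('a \<Rightarrow> complex) \<Rightarrow> 'a \<Rightarrow> complex" where
  "iter_deriv [] f = f"
| "iter_deriv (b # bs) f = (\<lambda>x. frechet_derivative (iter_deriv bs f) (at x) b)"

definition schwartz :: "('a::euclidean_space \<Rightarrow> complex) \<Rightarrow> bool" where
  "schwartz f \<longleftrightarrow> (\<forall>bs. set bs \<subseteq> Basis \<longrightarrow>
     iter_deriv bs f differentiable_on UNIV \<and>
     (\<forall>k::nat. \<exists>C. \<forall>x. norm x ^ k * norm (iter_deriv bs f x) \<le> C))"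

definition inv_fourier ::
  "('a::euclidean_space \<Rightarrow> complex) \<Rightarrow> 'a \<Rightarrow> complex" where
  "inv_fourier g x =
     (LINT \<xi>|lebesgue. exp (\<i> * complex_of_real (x \<bullet> \<xi>)) * g \<xi>) / (2 * pi) ^ DIM('a)"

text \<open>Tempered distributions are functionals, of which only the values on Schwartz functions
  matter.\<close>

definition regular_dist ::
  "('a::euclidean_space \<Rightarrow> complex) \<Rightarrow> ('a \<Rightarrow> complex) \<Rightarrow> complex" where
  "regular_dist g \<phi> = (LINT x|lebesgue. g x * \<phi> x)"

definition inv_fourier_dist ::
  "(('a::euclidean_space \<Rightarrow> complex) \<Rightarrow> complex) \<Rightarrow> ('a \<Rightarrow> complex) \<Rightarrow> complex" where
  "inv_fourier_dist T \<phi> = T (inv_fourier \<phi>)"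

definition represents ::
  "('a::euclidean_space \<Rightarrow> complex) \<Rightarrow> (('a \<Rightarrow> complex) \<Rightarrow> complex) \<Rightarrow> bool" where
  "represents g T \<longleftrightarrow> g \<in> borel_measurable lebesgue \<and>
     (\<forall>\<phi>. schwartz \<phi> \<longrightarrow> integrable lebesgue (\<lambda>x. g x * \<phi> x) \<and> regular_dist g \<phi> = T \<phi>)"

section \<open>Fundamental solutions and the linear Cauchy problem\<close>

definition mittag_leffler :: "real \<Rightarrow> real \<Rightarrow> real \<Rightarrow> real" where
  "mittag_leffler a b z = (\<Sum>k. z ^ k / Gamma (a * real k + b))"

text \<open>The inverse Fourier transform of the symbol, taken in the sense of tempered distributions,
  is a function (for \<open>0 < \<alpha> < 1\<close>, \<open>\<beta> \<ge> 1\<close> and \<open>t > 0\<close>, it is integrable), unique up to null sets;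
  \<open>SOME\<close> picks a representative. Convolutions with it do not depend on the choice, at any point.\<close>

definition G_kernel :: "real \<Rightarrow> real \<Rightarrow> real \<Rightarrow> 'a::euclidean_space \<Rightarrow> complex" where
  "G_kernel \<alpha> \<beta> t = (SOME g. represents g (inv_fourier_dist (regular_dist
     (\<lambda>\<xi>. complex_of_real
        (mittag_leffler (1 + \<alpha>) \<beta> (- (t powr (1 + \<alpha>) * (norm \<xi>)\<^sup>2)))))))"

definition conv ::
  "('a::euclidean_space \<Rightarrow> complex) \<Rightarrow> ('a \<Rightarrow> complex) \<Rightarrow> 'a \<Rightarrow> complex" where
  "conv g h x = (LINT y|lebesgue. g (x - y) * h y)"

text \<open>The solution to
  \<open>\<partial>\<^sub>t\<^bsup>1+\<alpha>\<^esup> u - \<Delta> u = f\<close>, \<open>u(0,x) = u0 x\<close>, \<open>u\<^sub>t(0,x) = u1 x\<close> (Caputo derivative in time)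
  is by definition the function given by the representation formula.\<close>

definition cauchy_solution ::
  "real \<Rightarrow> ('a::euclidean_space \<Rightarrow> complex) \<Rightarrow> ('a \<Rightarrow> complex) \<Rightarrow> (real \<Rightarrow> 'a \<Rightarrow> complex) \<Rightarrow>
   real \<Rightarrow> 'a \<Rightarrow> complex" where
  "cauchy_solution \<alpha> u0 u1 f t x =
     conv (G_kernel \<alpha> 1 t) u0 x
   + complex_of_real t * conv (G_kernel \<alpha> 2 t) u1 x
   + (LINT s:{0..t}|lebesgue.
        complex_of_real ((t - s) powr \<alpha>) * conv (G_kernel \<alpha> (1 + \<alpha>) (t - s)) (f s) x)"

end

theory Submission
  imports Defs "HOL-Complex_Analysis.Complex_Analysis" "HOL-Probability.Probability"
begin

text \<open>The fundamental solutions are mixtures of heat kernels at complex times. With \<open>a = 1 + \<alpha>\<close>, so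
that \<open>1 < a < 2\<close>, Hankel's contour integral gives
\<open>E (-l) = 1 / (2 pi i) * (integral of exp z * z powr (a - \<beta>) / (z powr a + l) dz)\<close> for the
Mittag-Leffler function with parameters \<open>a\<close> and \<open>\<beta>\<close>. On a contour that opens with an angle between
\<open>pi / 2\<close> and \<open>pi / a\<close>, the exponential decays while \<open>z powr (a / 2)\<close> stays in a sector strictly
inside the right half-plane. There the resolvent can be written as
\<open>1 / (z powr a + l) = z powr (- a / 2) * (integral over r > 0 of exp (- r * (z powr (a / 2) + l * z powr (- a / 2))) dr)\<close>.
Hence \<open>E (-l)\<close> is an integral of exponentials \<open>exp (- s * l)\<close> over complex times \<open>s\<close> in a sector around
the positive real axis, against a weight \<open>W\<close> for which \<open>norm W * norm s powr - \<theta>\<close> is integrable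
whenever \<open>0 \<le> \<theta> < 1\<close> (\<open>mittag_leffler_gaussian_mixture\<close>). The inverse Fourier transform turns
\<open>exp (- s * norm \<xi> ^ 2)\<close> into the heat kernel at time \<open>s\<close>, which in such a sector is dominated by
the heat kernel at a real time comparable to \<open>norm s\<close>. So the kernels
\<^const>\<open>G_kernel\<close> are dominated by a mixture of real heat kernels at times proportional to
\<open>t powr (1 + \<alpha>)\<close> (\<open>G_kernel_gaussian_majorant\<close>). Because a distribution determines the function that
represents it almost everywhere (\<open>represents_unique\<close>), it does not matter which representative
\<^const>\<open>G_kernel\<close> is.

The heat semigroup at time \<open>\<tau>\<close> maps \<open>L\<^sup>r\<close> to \<open>L\<^sup>q\<close> with norm at most a constant times
\<open>\<tau> powr - \<Theta>\<close>, where \<open>\<Theta> = n / 2 * (1 / r - 1 / q)\<close> (\<open>heat_smoothing\<close>, by Jensen's inequality).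
By Minkowski's integral inequality (\<open>Lq_le_integral\<close>) the mixture then maps \<open>L\<^sup>r\<close> to \<open>L\<^sup>q\<close> with norm
at most a constant times \<open>t powr - ((1 + \<alpha>) * \<Theta>)\<close>. The constant is the integral of
\<open>norm W * norm s powr - \<Theta>\<close>, and this is where \<open>\<Theta> < 1\<close> enters. This estimates the two terms with the
initial data. For the third term, Minkowski's inequality in \<open>s\<close> reduces the claim to a bound of the
integral of \<open>(t - s) powr \<kappa> * (1 + s) powr - \<eta>\<close> over \<open>{0..t}\<close> with
\<open>\<kappa> = \<alpha> - (1 + \<alpha>) * \<Theta> > - 1\<close>, and the three cases of the theorem are the three growth rates of the
integral of \<open>(1 + s) powr - \<eta>\<close> (\<open>duhamel_time_integral\<close>).

The contour is parametrised by \<open>z = v powr c\<close> with \<open>v\<close> on a vertical line and \<open>1 < c < 2 / a\<close>. All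
integrands are then holomorphic on the right half-plane, where principal powers cause no trouble, and
contours are deformed by shifting the line.\<close>

section \<open>Integrals depending on a complex parameter, Gamma and Gaussian integrals\<close>

text \<open>Difference quotients are dominated by the bound of the derivative on a small ball, by the mean value
inequality, so dominated convergence differentiates under the integral.\<close>

lemma holomorphic_parameter_integral:
  fixes F F' :: "complex \<Rightarrow> 'm \<Rightarrow> complex"
  assumes "open S"
    and int: "\<And>z. z \<in> S \<Longrightarrow> integrable M (F z)"
    and der: "\<And>z m. z \<in> S \<Longrightarrow> m \<in> space M \<Longrightarrow> ((\<lambda>z. F z m) has_field_derivative F' z m) (at z)"
    and dom: "\<And>z. z \<in> S \<Longrightarrow> \<exists>r>0. \<exists>w. ball z r \<subseteq> S \<and> integrable M w \<and>
                 (\<forall>\<zeta>\<in>ball z r. \<forall>m\<in>space M. norm (F' \<zeta> m) \<le> w m)"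
  shows "(\<lambda>z. LINT m|M. F z m) holomorphic_on S"
proof -
  have "((\<lambda>z. LINT m|M. F z m) has_field_derivative (LINT m|M. F' z m)) (at z)" if z: "z \<in> S" for z
  proof -
    from dom[OF z] obtain r w where r: "r > 0" "ball z r \<subseteq> S" and w: "integrable M w"
      and bd: "\<And>\<zeta> m. \<zeta> \<in> ball z r \<Longrightarrow> m \<in> space M \<Longrightarrow> norm (F' \<zeta> m) \<le> w m" by blast
    have at: "at z within ball z r = at z" using r by (intro at_within_open) auto
    have Fm[measurable]: "F y \<in> borel_measurable M" if "y \<in> S" for y using int[OF that] by auto
    have "((\<lambda>y. ((LINT m|M. F y m) - (LINT m|M. F z m)) / (y - z)) \<longlongrightarrow> (LINT m|M. F' z m))
            (at z within ball z r)"
      unfolding tendsto_at_iff_sequentially o_def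
    proof (intro allI impI)
      fix X :: "nat \<Rightarrow> complex" assume X: "\<forall>i. X i \<in> ball z r - {z}" and lim: "X \<longlonglongrightarrow> z"
      have XS: "X i \<in> S" for i using X r by auto
      have q: "((LINT m|M. F (X i) m) - (LINT m|M. F z m)) / (X i - z)
             = (LINT m|M. (F (X i) m - F z m) / (X i - z))" for i
        using int[OF XS] int[OF z] by simp
      have conv: "(\<lambda>i. (F (X i) m - F z m) / (X i - z)) \<longlonglongrightarrow> F' z m" if "m \<in> space M" for m
      proof -
        have "((\<lambda>y. (F y m - F z m) / (y - z)) \<longlongrightarrow> F' z m) (at z)"
          using der[OF z that] unfolding has_field_derivative_iff .
        moreover have "filterlim X (at z) sequentially"
          using lim X by (auto simp: filterlim_at)
        ultimately show ?thesis by (rule filterlim_compose)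
      qed
      have mF': "F' z \<in> borel_measurable M"
        by (rule borel_measurable_LIMSEQ_metric[where f="\<lambda>i m. (F (X i) m - F z m) / (X i - z)"])
           (use XS z conv in auto)
      have bnd: "norm ((F (X i) m - F z m) / (X i - z)) \<le> w m" if "m \<in> space M" for i m
      proof -
        have "norm (F (X i) m - F z m) \<le> w m * norm (X i - z)"
        proof (rule field_differentiable_bound[of "ball z r" "\<lambda>y. F y m" "\<lambda>y. F' y m"])
          show "((\<lambda>y. F y m) has_field_derivative F' y m) (at y within ball z r)" if "y \<in> ball z r" for y
            using der[OF subsetD[OF r(2) that] \<open>m \<in> space M\<close>] by (rule has_field_derivative_at_within)
        qed (use bd that X r in auto)
        moreover have "norm (X i - z) > 0" using X by auto
        ultimately show ?thesis by (simp add: norm_divide field_simps)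
      qed
      show "(\<lambda>i. ((LINT m|M. F (X i) m) - (LINT m|M. F z m)) / (X i - z)) \<longlonglongrightarrow> (LINT m|M. F' z m)"
        unfolding q
        by (rule integral_dominated_convergence[where w=w])
           (use w mF' conv bnd XS z in auto)
    qed
    thus ?thesis unfolding at has_field_derivative_iff .
  qed
  thus ?thesis using \<open>open S\<close> by (auto simp: holomorphic_on_open)
qed

text \<open>Tonelli's criterion for a majorant whose inner integrals are known.\<close>

lemma integrable_pair_dominated:
  fixes P :: "'a::euclidean_space \<Rightarrow> 'b::euclidean_space \<Rightarrow> 'c::{banach, second_countable_topology}"
  assumes meas: "(\<lambda>(m, x). P m x) \<in> borel_measurable (lborel \<Otimes>\<^sub>M lborel)"
    and P: "\<And>m x. norm (P m x) \<le> k m x"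
    and k: "\<And>m. integrable lborel (k m)" "\<And>m. (LINT x|lborel. k m x) \<le> B m" and B: "integrable lborel B"
  shows "integrable (lborel \<Otimes>\<^sub>M lborel) (\<lambda>(m, x). P m x)"
proof (rule lborel_pair.Fubini_integrable[OF meas])
  have Pm: "P m \<in> borel_measurable lborel" for m
    using measurable_compose_Pair1[OF _ meas, of m] by simp
  have Pi: "integrable lborel (P m)" for m
    by (rule Bochner_Integration.integrable_bound[OF k(1) Pm]) (use P in \<open>auto intro: order_trans[OF _ abs_ge_self]\<close>)
  thus "AE m in lborel. integrable lborel (\<lambda>x. case (m, x) of (m, x) \<Rightarrow> P m x)" by simp
  have "(LINT x|lborel. norm (P m x)) \<le> B m" for m
    by (rule order_trans[OF integral_mono[OF integrable_norm[OF Pi] k(1) P] k(2)])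
  hence "norm (LINT x|lborel. norm (P m x)) \<le> norm (B m)" for m
    by (auto intro: order_trans[OF _ abs_ge_self])
  moreover have "(\<lambda>m. LINT x|lborel. norm (P m x)) \<in> borel_measurable lborel"
    using meas by measurable
  ultimately show "integrable lborel (\<lambda>m. LINT x|lborel. norm (case (m, x) of (m, x) \<Rightarrow> P m x))"
    by (intro Bochner_Integration.integrable_bound[OF B]) auto
qed

text \<open>Euler's integral after the substitution of \<open>s * u powr c\<close> for the variable.\<close>

lemma power_exp_integral_real:
  fixes p c s :: real
  assumes "p > 0" "c > 0" "s > 0"
  shows "set_integrable lborel {0<..} (\<lambda>u. u powr (p - 1) * exp (- s * u powr c))" (is ?A)
    and "(LINT u:{0<..}|lborel. u powr (p - 1) * exp (- s * u powr c)) = Gamma (p/c) / c * s powr (-p/c)" (is ?B)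
proof -
  define g where "g = (\<lambda>u. s * u powr c)"
  define f where "f = (\<lambda>t::real. t powr (p/c - 1) / exp t)"
  have "(\<lambda>t. complex_of_real t powr (of_real (p/c) - 1) / of_real (exp t)) absolutely_integrable_on {0<..}"
    by (rule absolutely_integrable_Gamma_integral') (use assms in simp)
  hence "(\<lambda>t. norm (complex_of_real t powr (of_real (p/c) - 1) / of_real (exp t))) absolutely_integrable_on {0<..}"
    by (rule absolutely_integrable_norm[unfolded o_def])
  hence f1: "f absolutely_integrable_on {0<..}"
    by (rule set_integrable_cong[THEN iffD1, rotated -1])
       (auto simp: f_def norm_divide norm_powr_real_powr)
  have "(f has_integral Gamma (p/c)) {0..}" unfolding f_def
    by (rule Gamma_integral_real) (use assms in simp)
  hence "(f has_integral Gamma (p/c)) {0<..}"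
    by (rule iffD1[OF has_integral_spike_set_eq, rotated 2])
       (rule negligible_subset[of "{0}"]; force)+
  hence f2: "integral {0<..} f = Gamma (p/c)" by (rule integral_unique)
  have img: "g ` {0<..} = {0<..}"
  proof -
    have "y \<in> g ` {0<..}" if "y > 0" for y
    proof (rule image_eqI[where x="(y/s) powr (1/c)"])
      show "y = g ((y / s) powr (1 / c))" using that assms by (simp add: g_def powr_powr)
    qed (use that assms in simp)
    thus ?thesis using assms by (auto simp: g_def)
  qed
  have "(\<lambda>x. \<bar>s * c * x powr (c - 1)\<bar> *\<^sub>R f (g x)) absolutely_integrable_on {0<..} \<and>
        integral {0<..} (\<lambda>x. \<bar>s * c * x powr (c - 1)\<bar> *\<^sub>R f (g x)) = Gamma (p/c)
     \<longleftrightarrow> f absolutely_integrable_on (g ` {0<..}) \<and> integral (g ` {0<..}) f = Gamma (p/c)"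
  proof (rule has_absolute_integral_change_of_variables_real)
    show "(g has_field_derivative s * c * x powr (c - 1)) (at x within {0<..})" if "x \<in> {0<..}" for x
    proof -
      have "((\<lambda>u. s * u powr c) has_field_derivative s * (c * x powr (c - 1))) (at x within {0<..})"
        using that by (intro DERIV_cmult[OF has_field_derivative_at_within[OF has_real_derivative_powr]]) auto
      thus ?thesis by (simp add: g_def mult.assoc)
    qed
    show "inj_on g {0<..}"
    proof (rule inj_onI)
      fix x y assume "x \<in> {0<..}" "y \<in> {0<..}" "g x = g y"
      hence *: "x powr c = y powr c" "x > 0" "y > 0" using assms by (auto simp: g_def)
      have "x = (x powr c) powr (1/c)" using *(2) assms(2) by (simp add: powr_powr)
      also have "\<dots> = y" unfolding *(1) using *(3) assms(2) by (simp add: powr_powr)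
      finally show "x = y" .
    qed
  qed auto
  with f1 f2 img have 1: "(\<lambda>x. \<bar>s * c * x powr (c - 1)\<bar> *\<^sub>R f (g x)) absolutely_integrable_on {0<..}"
     and 2: "integral {0<..} (\<lambda>x. \<bar>s * c * x powr (c - 1)\<bar> *\<^sub>R f (g x)) = Gamma (p/c)" by auto
  define h where "h = (\<lambda>u. u powr (p - 1) * exp (- s * u powr c))"
  have eq: "\<bar>s * c * x powr (c - 1)\<bar> *\<^sub>R f (g x) = (c * s powr (p/c)) * h x" if "x \<in> {0<..}" for x
  proof -
    have "f (g x) = s powr (p/c - 1) * x powr (p - c) * exp (- s * x powr c)"
    proof -
      have "c * (p / c - 1) = p - c" using assms by (simp add: right_diff_distrib)
      thus ?thesis using that assms by (simp add: f_def g_def powr_mult powr_powr exp_minus divide_inverse)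
    qed
    moreover have "s powr (p/c) = s * s powr (p/c - 1)"
      using assms powr_add[of s 1 "p/c - 1"] by simp
    moreover have "x powr (p - 1) = x powr (c - 1) * x powr (p - c)"
      using that powr_add[of x "c - 1" "p - c"] by simp
    ultimately show ?thesis using that assms by (simp add: h_def)
  qed
  have "(\<lambda>x. (c * s powr (p/c)) * h x) absolutely_integrable_on {0<..}"
    by (rule set_integrable_cong[THEN iffD1, OF _ _ _ 1]) (use eq in auto)
  hence "(\<lambda>x. inverse (c * s powr (p/c)) * ((c * s powr (p/c)) * h x)) absolutely_integrable_on {0<..}"
    by (rule set_integrable_mult_right)
  moreover have "(\<lambda>x. inverse (c * s powr (p/c)) * ((c * s powr (p/c)) * h x)) = h"
  proof
    fix x
    have "c * s powr (p/c) \<noteq> 0" using assms by simp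
    thus "inverse (c * s powr (p/c)) * ((c * s powr (p/c)) * h x) = h x"
      by (metis mult.assoc left_inverse mult_1)
  qed
  ultimately have 3: "h absolutely_integrable_on {0<..}" by simp
  have m: "h \<in> borel_measurable borel" unfolding h_def by measurable
  from 3 show ?A unfolding set_integrable_def h_def[symmetric]
    by (subst (asm) integrable_completion) (use m in auto)
  have "integral {0<..} (\<lambda>x. \<bar>s * c * x powr (c - 1)\<bar> *\<^sub>R f (g x)) = integral {0<..} (\<lambda>x. (c * s powr (p/c)) * h x)"
    by (rule Henstock_Kurzweil_Integration.integral_cong) (rule eq)
  with 2 have "integral {0<..} (\<lambda>x. (c * s powr (p/c)) * h x) = Gamma (p/c)" by simp
  hence 4: "c * s powr (p/c) * integral {0<..} h = Gamma (p/c)" by simp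
  have 5: "I = G / c * inverse X" if "c * X * I = G" "X \<noteq> 0" for I G X :: real
    using that assms(2) by (auto simp: field_simps)
  have "integral {0<..} h = Gamma (p/c) / c * s powr (-p/c)"
    using 5[OF 4] assms powr_minus[of s "p/c"] by simp
  moreover have "(LINT u:{0<..}|lborel. h u) = integral {0<..} h"
    using set_borel_integral_eq_integral(2)[OF \<open>?A\<close>] by (simp add: h_def)
  ultimately show ?B by (simp add: h_def)
qed

text \<open>The identity theorem in the form in which formulas for real parameters extend to complex ones.\<close>

lemma right_half_plane_identity:
  assumes f: "f holomorphic_on {z. 0 < Re z}" and g: "g holomorphic_on {z. 0 < Re z}"
    and eq: "\<And>x. 0 < x \<Longrightarrow> f (complex_of_real x) = g (complex_of_real x)"
    and z: "0 < Re z"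
  shows "f z = g z"
proof -
  have "f z - g z = 0"
  proof (rule analytic_continuation[where f="\<lambda>z. f z - g z" and S="{z. 0 < Re z}"
        and U="complex_of_real ` {0<..}" and \<xi>=1])
    show "(\<lambda>z. f z - g z) holomorphic_on {z. 0 < Re z}" using f g by (intro holomorphic_intros)
    show "open {z. 0 < Re z}" by (rule open_halfspace_Re_gt)
    show "connected {z. 0 < Re z}" by (intro convex_connected convex_halfspace_Re_gt)
    show "(1::complex) islimpt complex_of_real ` {0<..}"
      unfolding islimpt_sequential
    proof (intro exI conjI allI)
      show "complex_of_real (1 + inverse (real (Suc n))) \<in> complex_of_real ` {0<..} - {1}" for n
        by (auto simp: complex_eq_iff add_pos_pos)
      have "(\<lambda>n. complex_of_real (1 + inverse (real (Suc n)))) \<longlonglongrightarrow> complex_of_real (1 + 0)"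
        by (intro tendsto_intros LIMSEQ_inverse_real_of_nat)
      thus "(\<lambda>n. complex_of_real (1 + inverse (real (Suc n)))) \<longlonglongrightarrow> 1" by simp
    qed
  qed (use eq z in auto)
  thus ?thesis by simp
qed

text \<open>Both sides are holomorphic in \<open>s\<close> and agree for real \<open>s\<close>.\<close>

lemma power_exp_integral_complex:
  fixes p c :: real and s :: complex
  assumes "p > 0" "c > 0" "Re s > 0"
  shows "set_integrable lborel {0<..} (\<lambda>u. complex_of_real (u powr (p - 1)) * exp (- s * of_real (u powr c)))"
    and "(LINT u:{0<..}|lborel. complex_of_real (u powr (p - 1)) * exp (- s * of_real (u powr c)))
           = of_real (Gamma (p/c) / c) * s powr (of_real (-p/c))"
proof -
  define F where "F = (\<lambda>s u. indicator {0<..} u *\<^sub>R (complex_of_real (u powr (p - 1)) * exp (- s * of_real (u powr c))))"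
  have F_int: "integrable lborel (F s)" if "Re s > 0" for s
  proof (rule Bochner_Integration.integrable_bound)
    show "integrable lborel (\<lambda>u. indicator {0<..} u *\<^sub>R (u powr (p - 1) * exp (- Re s * u powr c)))"
      using power_exp_integral_real(1)[OF assms(1,2) that] unfolding set_integrable_def .
    show "F s \<in> borel_measurable lborel" unfolding F_def by measurable
    show "AE x in lborel. norm (F s x) \<le> norm (indicator {0<..} x *\<^sub>R (x powr (p - 1) * exp (- Re s * x powr c)))"
      by (intro AE_I2) (simp add: F_def norm_mult norm_exp_eq_Re)
  qed
  show "set_integrable lborel {0<..} (\<lambda>u. complex_of_real (u powr (p - 1)) * exp (- s * of_real (u powr c)))"
    using F_int[OF assms(3)] unfolding set_integrable_def F_def .
  have holF: "(\<lambda>s. LINT u|lborel. F s u) holomorphic_on {z. 0 < Re z}"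
  proof (rule holomorphic_parameter_integral[where F'="\<lambda>s u. - of_real (u powr c) * F s u"])
    show "open {z. 0 < Re z}" by (rule open_halfspace_Re_gt)
    show "integrable lborel (F z)" if "z \<in> {z. 0 < Re z}" for z using F_int that by simp
    show "((\<lambda>z. F z m) has_field_derivative - of_real (m powr c) * F z m) (at z)" for z m
      unfolding F_def by (auto intro!: derivative_eq_intros simp: indicator_def)
    fix z :: complex assume "z \<in> {z. 0 < Re z}"
    hence z: "Re z > 0" by simp
    define w where "w = (\<lambda>u. indicator {0<..} u *\<^sub>R (u powr (p + c - 1) * exp (- (Re z / 2) * u powr c)))"
    show "\<exists>r>0. \<exists>w. ball z r \<subseteq> {z. 0 < Re z} \<and> integrable lborel w \<and>
         (\<forall>\<zeta>\<in>ball z r. \<forall>m\<in>space lborel. cmod (- complex_of_real (m powr c) * F \<zeta> m) \<le> w m)"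
    proof (intro exI[of _ "Re z / 2"] exI[of _ w] conjI ballI)
      have *: "Re \<zeta> > Re z / 2" if "\<zeta> \<in> ball z (Re z / 2)" for \<zeta>
        using that abs_Re_le_cmod[of "z - \<zeta>"] by (simp add: dist_norm)
      show "ball z (Re z / 2) \<subseteq> {z. 0 < Re z}" using * z by force
      show "integrable lborel w"
        using power_exp_integral_real(1)[of "p + c" c "Re z / 2"] assms z
        unfolding w_def set_integrable_def by simp
      fix \<zeta> m assume "\<zeta> \<in> ball z (Re z / 2)"
      show "cmod (- complex_of_real (m powr c) * F \<zeta> m) \<le> w m"
      proof (cases "m > 0")
        case True
        have "cmod (- complex_of_real (m powr c) * F \<zeta> m) = m powr (p + c - 1) * exp (- Re \<zeta> * m powr c)"
          using True by (simp add: F_def norm_mult norm_exp_eq_Re flip: powr_add) (simp add: algebra_simps)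
        also have "\<dots> \<le> m powr (p + c - 1) * exp (- (Re z / 2) * m powr c)"
          using *[OF \<open>\<zeta> \<in> _\<close>] True by (intro mult_left_mono) auto
        finally show ?thesis using True by (simp add: w_def)
      qed (simp add: F_def w_def)
    qed (use z in auto)
  qed
  have "(LINT u|lborel. F s u) = of_real (Gamma (p/c) / c) * s powr (of_real (-p/c))"
  proof (rule right_half_plane_identity[OF holF _ _ assms(3)])
    show "(\<lambda>s. complex_of_real (Gamma (p / c) / c) * s powr complex_of_real (- p / c)) holomorphic_on {z. 0 < Re z}"
      by (intro holomorphic_intros) (auto simp: complex_nonpos_Reals_iff)
    fix x :: real assume x: "x > 0"
    have "(LINT u|lborel. F (of_real x) u)
       = (LINT u|lborel. complex_of_real (indicator {0<..} u *\<^sub>R (u powr (p - 1) * exp (- x * u powr c))))"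
      by (intro Bochner_Integration.integral_cong) (auto simp: F_def indicator_def exp_of_real[symmetric])
    also have "\<dots> = of_real (Gamma (p/c) / c * x powr (-p/c))"
      using power_exp_integral_real(2)[OF assms(1,2) x] unfolding set_lebesgue_integral_def
      by (subst integral_complex_of_real) simp
    also have "\<dots> = of_real (Gamma (p/c) / c) * of_real x powr (of_real (-p/c))"
      using x powr_of_real[of x "-(p/c)"] by simp
    finally show "(LINT u|lborel. F (of_real x) u) = of_real (Gamma (p/c) / c) * of_real x powr (of_real (-p/c))" .
  qed
  thus "(LINT u:{0<..}|lborel. complex_of_real (u powr (p - 1)) * exp (- s * of_real (u powr c)))
           = of_real (Gamma (p/c) / c) * s powr (of_real (-p/c))"
    unfolding set_lebesgue_integral_def F_def .
qed

lemma integrable_gaussian: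
  fixes r :: real assumes "r > 0"
  shows "integrable lborel (\<lambda>x::real. exp (- r * x\<^sup>2))"
proof -
  have "integrable lborel (\<lambda>x. sqrt (2 * pi * (1/(2*r))) * normal_density 0 (sqrt (1/(2*r))) x)"
    by (intro integrable_mult_right integrable_normal_density) (use assms in simp)
  moreover have "(\<lambda>x. sqrt (2 * pi * (1/(2*r))) * normal_density 0 (sqrt (1/(2*r))) x) = (\<lambda>x. exp (- r * x\<^sup>2))"
    using assms by (intro ext) (simp add: normal_density_def real_sqrt_mult real_sqrt_divide field_simps)
  ultimately show ?thesis by metis
qed

text \<open>This is the characteristic function of the standard normal distribution, rescaled.\<close>

lemma gaussian_fourier_real:
  fixes s y :: real assumes "s > 0"
  shows "(LINT x|lborel. exp (\<i> * of_real (y * x) - of_real (s * x\<^sup>2)))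
     = complex_of_real (sqrt (pi / s) * exp (- y\<^sup>2 / (4 * s)))"
proof -
  define \<sigma> where "\<sigma> = sqrt (2 * s)"
  have \<sigma>: "\<sigma> > 0" "\<sigma>\<^sup>2 = 2 * s" using assms by (auto simp: \<sigma>_def)
  have "complex_of_real (exp (- ((y/\<sigma>)\<^sup>2) / 2)) = char std_normal_distribution (y/\<sigma>)"
    by (simp add: char_std_normal_distribution)
  also have "\<dots> = (LINT x|lborel. std_normal_density x *\<^sub>R iexp (y/\<sigma> * x))"
    unfolding char_def by (subst integral_density) auto
  also have "\<dots> = \<bar>\<sigma>\<bar> *\<^sub>R (LINT x|lborel. std_normal_density (0 + \<sigma> * x) *\<^sub>R iexp (y/\<sigma> * (0 + \<sigma> * x)))"
    by (rule lborel_integral_real_affine) (use \<sigma> in simp)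
  also have "(\<lambda>x. std_normal_density (0 + \<sigma> * x) *\<^sub>R iexp (y/\<sigma> * (0 + \<sigma> * x)))
     = (\<lambda>x. (1 / sqrt (2 * pi)) *\<^sub>R exp (\<i> * of_real (y * x) - of_real (s * x\<^sup>2)))"
    using \<sigma> by (intro ext) (simp add: std_normal_density_def power_mult_distrib exp_diff exp_of_real[symmetric] scaleR_conv_of_real exp_minus field_simps)
  finally have "(LINT x|lborel. exp (\<i> * of_real (y * x) - of_real (s * x\<^sup>2)))
     = (sqrt (2 * pi) / \<sigma>) *\<^sub>R complex_of_real (exp (- ((y/\<sigma>)\<^sup>2) / 2))"
    using \<sigma>(1) by (simp add: scaleR_conv_of_real)
  also have "sqrt (2 * pi) / \<sigma> = sqrt (pi / s)"
    unfolding \<sigma>_def by (simp add: real_sqrt_mult real_sqrt_divide)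
  also have "- ((y/\<sigma>)\<^sup>2) / 2 = - y\<^sup>2 / (4 * s)" by (simp add: power_divide \<sigma>)
  finally show ?thesis by (simp add: scaleR_conv_of_real)
qed

text \<open>Both sides are holomorphic in \<open>s\<close> and agree for real \<open>s\<close>.\<close>

lemma gaussian_fourier_complex:
  fixes s :: complex and y :: real assumes "Re s > 0"
  shows "integrable lborel (\<lambda>x::real. exp (\<i> * of_real (y * x) - s * of_real (x\<^sup>2)))"
    and "(LINT x|lborel. exp (\<i> * of_real (y * x) - s * of_real (x\<^sup>2)))
     = of_real (sqrt pi) * s powr (-1/2) * exp (- of_real (y\<^sup>2) / (4 * s))"
proof -
  define F where "F = (\<lambda>s x. exp (\<i> * of_real (y * x) - s * complex_of_real (x\<^sup>2)))"
  have F_int: "integrable lborel (F s)" if "Re s > 0" for s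
    by (rule Bochner_Integration.integrable_bound[OF integrable_gaussian[OF that]])
       (auto simp: F_def norm_exp_eq_Re)
  show "integrable lborel (\<lambda>x::real. exp (\<i> * of_real (y * x) - s * of_real (x\<^sup>2)))"
    using F_int[OF assms] unfolding F_def .
  have holF: "(\<lambda>s. LINT u|lborel. F s u) holomorphic_on {z. 0 < Re z}"
  proof (rule holomorphic_parameter_integral[where F'="\<lambda>s u. - of_real (u\<^sup>2) * F s u"])
    show "open {z. 0 < Re z}" by (rule open_halfspace_Re_gt)
    show "integrable lborel (F z)" if "z \<in> {z. 0 < Re z}" for z using F_int that by simp
    show "((\<lambda>z. F z m) has_field_derivative - of_real (m\<^sup>2) * F z m) (at z)" for z m
      unfolding F_def by (auto intro!: derivative_eq_intros)
    fix z :: complex assume "z \<in> {z. 0 < Re z}"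
    hence z: "Re z > 0" by simp
    define w where "w = (\<lambda>u::real. (4 / Re z) * exp (- (Re z / 4) * u\<^sup>2))"
    show "\<exists>r>0. \<exists>w. ball z r \<subseteq> {z. 0 < Re z} \<and> integrable lborel w \<and>
         (\<forall>\<zeta>\<in>ball z r. \<forall>m\<in>space lborel. cmod (- of_real (m\<^sup>2) * F \<zeta> m) \<le> w m)"
    proof (intro exI[of _ "Re z / 2"] exI[of _ w] conjI ballI)
      have *: "Re \<zeta> > Re z / 2" if "\<zeta> \<in> ball z (Re z / 2)" for \<zeta>
        using that abs_Re_le_cmod[of "z - \<zeta>"] by (simp add: dist_norm)
      show "ball z (Re z / 2) \<subseteq> {z. 0 < Re z}" using * z by force
      show "integrable lborel w"
        unfolding w_def by (intro integrable_mult_right integrable_gaussian) (use z in simp)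
      fix \<zeta> and m :: real assume "\<zeta> \<in> ball z (Re z / 2)"
      have "cmod (- of_real (m\<^sup>2) * F \<zeta> m) = m\<^sup>2 * exp (- Re \<zeta> * m\<^sup>2)"
        by (simp add: F_def norm_mult norm_power norm_exp_eq_Re del: of_real_power)
      also have "\<dots> \<le> m\<^sup>2 * exp (- (Re z / 2) * m\<^sup>2)"
      proof -
        have "Re z / 2 * m\<^sup>2 \<le> Re \<zeta> * m\<^sup>2"
          using *[OF \<open>\<zeta> \<in> _\<close>] by (intro mult_right_mono) auto
        hence "exp (- Re \<zeta> * m\<^sup>2) \<le> exp (- (Re z / 2) * m\<^sup>2)"
          by (subst exp_le_cancel_iff) linarith
        thus ?thesis by (rule mult_left_mono) simp
      qed
      also have "\<dots> = (4 / Re z) * ((Re z / 4 * m\<^sup>2) * exp (- (Re z / 4) * m\<^sup>2)) * exp (- (Re z / 4) * m\<^sup>2)"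
        using z by (simp add: field_simps flip: exp_add)
      also have "\<dots> \<le> (4 / Re z) * 1 * exp (- (Re z / 4) * m\<^sup>2)"
      proof (intro mult_right_mono mult_left_mono)
        have "Re z / 4 * m\<^sup>2 \<le> exp (Re z / 4 * m\<^sup>2)" using exp_ge_add_one_self[of "Re z / 4 * m\<^sup>2"] by linarith
        thus "Re z / 4 * m\<^sup>2 * exp (- (Re z / 4) * m\<^sup>2) \<le> 1" by (simp add: exp_minus field_simps)
      qed (use z in auto)
      finally show "cmod (- of_real (m\<^sup>2) * F \<zeta> m) \<le> w m" by (simp add: w_def)
    qed (use z in auto)
  qed
  have "(LINT u|lborel. F s u) = of_real (sqrt pi) * s powr (-1/2) * exp (- of_real (y\<^sup>2) / (4 * s))"
  proof (rule right_half_plane_identity[OF holF _ _ assms])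
    show "(\<lambda>s. of_real (sqrt pi) * s powr (-1/2) * exp (- of_real (y\<^sup>2) / (4 * s))) holomorphic_on {z. 0 < Re z}"
      by (intro holomorphic_intros) (auto simp: complex_nonpos_Reals_iff)
    fix x :: real assume x: "x > 0"
    have "(LINT u|lborel. F (of_real x) u) = complex_of_real (sqrt (pi / x) * exp (- y\<^sup>2 / (4 * x)))"
      using gaussian_fourier_real[OF x, of y] by (simp add: F_def)
    also have "\<dots> = of_real (sqrt pi) * of_real (x powr (-1/2)) * exp (- of_real (y\<^sup>2) / (4 * of_real x))"
      using x by (simp add: real_sqrt_divide powr_minus powr_half_sqrt exp_of_real[symmetric] field_simps)
    also have "complex_of_real (x powr (-1/2)) = of_real x powr (-1/2)"
      using x powr_of_real[of x "-1/2"] by simp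
    finally show "(LINT u|lborel. F (of_real x) u) = of_real (sqrt pi) * of_real x powr (-1/2) * exp (- of_real (y\<^sup>2) / (4 * of_real x))" .
  qed
  thus "(LINT x|lborel. exp (\<i> * of_real (y * x) - s * of_real (x\<^sup>2)))
     = of_real (sqrt pi) * s powr (-1/2) * exp (- of_real (y\<^sup>2) / (4 * s))"
    unfolding F_def .
qed

abbreviation vline :: "real \<Rightarrow> real \<Rightarrow> complex" where
  "vline x u \<equiv> of_real x + \<i> * of_real u"

lemma vertical_line_integral_limit:
  assumes f: "integrable lborel (\<lambda>u. f (vline x u))"
    and P: "\<And>u. (P has_field_derivative f (vline x u)) (at (vline x u))"
  shows "(\<lambda>n::nat. P (vline x (real n)) - P (vline x (- real n))) \<longlonglongrightarrow> \<i> * (LINT u|lborel. f (vline x u))"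
proof -
  have "(\<lambda>n::nat. LINT u|lborel. indicator {- real n..real n} u *\<^sub>R (\<i> * f (vline x u))) \<longlonglongrightarrow> (LINT u|lborel. \<i> * f (vline x u))"
  proof (rule integral_dominated_convergence[where w="\<lambda>u. norm (f (vline x u))"])
    show "AE u in lborel. (\<lambda>n::nat. indicator {- real n..real n} u *\<^sub>R (\<i> * f (vline x u))) \<longlonglongrightarrow> \<i> * f (vline x u)"
    proof (intro AE_I2)
      fix u
      have "\<forall>\<^sub>F n::nat in sequentially. indicator {- real n..real n} u *\<^sub>R (\<i> * f (vline x u)) = \<i> * f (vline x u)"
        using eventually_ge_at_top[of "nat \<lceil>\<bar>u\<bar>\<rceil>"]
        by eventually_elim (auto simp: indicator_def nat_le_iff ceiling_le_iff)
      thus "(\<lambda>n::nat. indicator {- real n..real n} u *\<^sub>R (\<i> * f (vline x u))) \<longlonglongrightarrow> \<i> * f (vline x u)"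
        by (rule tendsto_eventually)
    qed
  qed (use f in \<open>auto simp: norm_mult indicator_def intro!: borel_measurable_integrable integrable_norm\<close>)
  moreover have "(LINT u|lborel. indicator {- real n..real n} u *\<^sub>R (\<i> * f (vline x u)))
      = P (vline x (real n)) - P (vline x (- real n))" for n :: nat
  proof -
    have "set_integrable lborel {- real n..real n} (\<lambda>u. \<i> * f (vline x u))"
      unfolding set_integrable_def by (rule integrable_mult_indicator) (use f in auto)
    from set_borel_integral_eq_integral(2)[OF this]
    have "(LINT u|lborel. indicator {- real n..real n} u *\<^sub>R (\<i> * f (vline x u)))
       = integral {- real n..real n} (\<lambda>u. \<i> * f (vline x u))"
      unfolding set_lebesgue_integral_def .
    also have "\<dots> = P (vline x (real n)) - P (vline x (- real n))"
    proof (rule integral_unique[OF fundamental_theorem_of_calculus])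
      show "((\<lambda>u. P (vline x u)) has_vector_derivative \<i> * f (vline x u)) (at u within {- real n..real n})" for u
        by (rule field_vector_diff_chain_within[of _ \<i>, unfolded o_def])
           (auto intro!: derivative_eq_intros has_field_derivative_at_within[OF P])
    qed simp
    finally show ?thesis .
  qed
  ultimately show ?thesis using f by simp
qed

text \<open>A holomorphic function on a half-plane has a primitive \<open>P\<close>, so the two line integrals differ only by
the increments of \<open>P\<close> along horizontal edges. These tend to zero with the integrand.\<close>

lemma vertical_line_integral_shift:
  assumes f: "f holomorphic_on {z. 0 < Re z}" and x: "0 < x1" "x1 \<le> x2"
    and int: "integrable lborel (\<lambda>u. f (vline x1 u))" "integrable lborel (\<lambda>u. f (vline x2 u))"
    and B: "(B \<longlongrightarrow> 0) at_top"
    and bd: "\<And>x u. x1 \<le> x \<Longrightarrow> x \<le> x2 \<Longrightarrow> norm (f (vline x u)) \<le> B \<bar>u\<bar>"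
  shows "(LINT u|lborel. f (vline x1 u)) = (LINT u|lborel. f (vline x2 u))"
proof -
  obtain P where P: "\<And>z. 0 < Re z \<Longrightarrow> (P has_field_derivative f z) (at z within {z. 0 < Re z})"
    using holomorphic_convex_primitive'[OF convex_halfspace_Re_gt open_halfspace_Re_gt f] by auto
  have P': "(P has_field_derivative f z) (at z)" if "0 < Re z" for z
    using P[OF that] at_within_open[of z "{z. 0 < Re z}"] open_halfspace_Re_gt[of 0] that by simp
  have lim: "(\<lambda>n::nat. (P (vline x2 (real n)) - P (vline x2 (- real n))) - (P (vline x1 (real n)) - P (vline x1 (- real n))))
     \<longlonglongrightarrow> \<i> * (LINT u|lborel. f (vline x2 u)) - \<i> * (LINT u|lborel. f (vline x1 u))"
    by (intro tendsto_diff vertical_line_integral_limit int P') (use x in auto)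
  \<comment> \<open>The increment along an edge is at most the length of the edge times the supremum on it.\<close>
  have edge: "norm (P (vline x2 u) - P (vline x1 u)) \<le> B \<bar>u\<bar> * (x2 - x1)" for u
  proof -
    define S where "S = closed_segment (vline x1 u) (vline x2 u)"
    have S: "\<exists>x. x1 \<le> x \<and> x \<le> x2 \<and> z = vline x u" if "z \<in> S" for z
    proof -
      from that obtain t where t: "0 \<le> t" "t \<le> 1" "z = (1 - t) *\<^sub>R vline x1 u + t *\<^sub>R vline x2 u"
        unfolding S_def in_segment by blast
      have "z = vline (x1 + t * (x2 - x1)) u" unfolding t by (simp add: complex_eq_iff algebra_simps)
      moreover have "t * (x2 - x1) \<le> x2 - x1" using t x by (intro mult_left_le_one_le) auto
      ultimately show ?thesis using t x by (intro exI[of _ "x1 + t * (x2 - x1)"]) auto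
    qed
    have "norm (P (vline x2 u) - P (vline x1 u)) \<le> B \<bar>u\<bar> * norm (vline x2 u - vline x1 u)"
    proof (rule field_differentiable_bound[where S=S and f'=f])
      show "convex S" by (simp add: S_def)
      fix z assume "z \<in> S"
      then obtain x where xx: "x1 \<le> x" "x \<le> x2" "z = vline x u" using S by blast
      show "(P has_field_derivative f z) (at z within S)"
        by (rule has_field_derivative_at_within[OF P']) (use xx x in auto)
      show "norm (f z) \<le> B \<bar>u\<bar>" using bd xx by auto
    qed (auto simp: S_def)
    also have "norm (vline x2 u - vline x1 u) = x2 - x1"
    proof -
      have "vline x2 u - vline x1 u = of_real (x2 - x1)" by simp
      thus ?thesis using x by (metis norm_of_real abs_of_nonneg diff_ge_0_iff_ge)
    qed
    finally show ?thesis .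
  qed
  have "(\<lambda>n::nat. (P (vline x2 (real n)) - P (vline x2 (- real n))) - (P (vline x1 (real n)) - P (vline x1 (- real n)))) \<longlonglongrightarrow> 0"
  proof (rule Lim_null_comparison)
    have "(\<lambda>n::nat. B (real n)) \<longlonglongrightarrow> 0" by (rule filterlim_compose[OF B filterlim_real_sequentially])
    thus "(\<lambda>n::nat. 2 * (B (real n) * (x2 - x1))) \<longlonglongrightarrow> 0" by (intro tendsto_mult_right_zero tendsto_mult_left_zero)
    show "\<forall>\<^sub>F n::nat in sequentially. norm ((P (vline x2 (real n)) - P (vline x2 (- real n))) - (P (vline x1 (real n)) - P (vline x1 (- real n)))) \<le> 2 * (B (real n) * (x2 - x1))"
    proof (intro always_eventually allI)
      fix n :: nat
      have "(P (vline x2 (real n)) - P (vline x2 (- real n))) - (P (vline x1 (real n)) - P (vline x1 (- real n)))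
         = (P (vline x2 (real n)) - P (vline x1 (real n))) - (P (vline x2 (- real n)) - P (vline x1 (- real n)))" by simp
      also have "norm \<dots> \<le> B (real n) * (x2 - x1) + B (real n) * (x2 - x1)"
        by (rule order_trans[OF norm_triangle_ineq4]) (intro add_mono order_trans[OF edge], auto)
      finally show "norm ((P (vline x2 (real n)) - P (vline x2 (- real n))) - (P (vline x1 (real n)) - P (vline x1 (- real n)))) \<le> 2 * (B (real n) * (x2 - x1))" by simp
    qed
  qed
  from LIMSEQ_unique[OF this lim] show ?thesis by (simp add: right_diff_distrib[symmetric])
qed

section \<open>Decay of exponentials of powers on vertical lines\<close>

text \<open>From \<open>y \<le> exp y\<close> at \<open>y = e * t / m\<close>, raised to the power \<open>m\<close>.\<close>

lemma powr_le_exp: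
  fixes m e t :: real
  assumes "m \<ge> 0" "e > 0" "t \<ge> 0"
  shows "t powr m \<le> ((m / e) powr m + 1) * exp (e * t)"
proof (cases "m = 0 \<or> t = 0")
  case True
  have "t powr m \<le> 1" using True by auto
  also have "1 \<le> ((m / e) powr m + 1) * exp (e * t)"
  proof -
    have "1 * 1 \<le> ((m / e) powr m + 1) * exp (e * t)"
      by (rule mult_mono) (use assms in auto)
    thus ?thesis by simp
  qed
  finally show ?thesis .
next
  case False
  hence m: "m > 0" "t > 0" using assms by auto
  have "e * t / m \<le> exp (e * t / m)" using exp_ge_add_one_self[of "e * t / m"] by linarith
  hence "(e * t / m) powr m \<le> exp (e * t / m) powr m" using assms m by (intro powr_mono2) auto
  also have "\<dots> = exp (e * t)" using m by (simp add: powr_def)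
  finally have *: "(e * t / m) powr m \<le> exp (e * t)" .
  have "t powr m = (m / e * (e * t / m)) powr m" using assms m by simp
  also have "\<dots> = (m / e) powr m * (e * t / m) powr m" using assms m by (intro powr_mult)
  also have "\<dots> \<le> (m / e) powr m * exp (e * t)" using * by (intro mult_left_mono) auto
  also have "\<dots> \<le> ((m / e) powr m + 1) * exp (e * t)" by (intro mult_right_mono) auto
  finally show ?thesis .
qed

lemma Re_powr_eq: "Re (z powr of_real c) = norm z powr c * cos (c * Arg z)" if "z \<noteq> 0"
proof -
  have "z powr of_real c = exp (of_real c * Ln z)" using that by (simp add: powr_def)
  also have "Re \<dots> = exp (c * ln (norm z)) * cos (c * Arg z)"
    using that by (simp add: Re_exp Re_Ln Arg_eq_Im_Ln)
  finally show ?thesis using that by (simp add: powr_def)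
qed

text \<open>On the right half-plane the argument of \<open>z powr \<kappa>\<close> is at most \<open>\<kappa> * pi / 2\<close>.\<close>

lemma Re_powr_ge:
  assumes "0 < \<kappa>" "\<kappa> \<le> 1" "Re z > 0"
  shows "Re (z powr of_real \<kappa>) \<ge> cos (\<kappa> * pi / 2) * norm z powr \<kappa>"
proof -
  have z: "z \<noteq> 0" using assms by auto
  have "\<bar>Arg z\<bar> < pi / 2" using assms(3) Arg_Re_pos by blast
  hence "\<kappa> * \<bar>Arg z\<bar> \<le> \<kappa> * (pi / 2)" using assms by (intro mult_left_mono) auto
  moreover have "\<kappa> * (pi / 2) \<le> 1 * (pi / 2)" using assms by (intro mult_right_mono) auto
  ultimately have "cos (\<kappa> * pi / 2) \<le> cos (\<kappa> * \<bar>Arg z\<bar>)"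
    using assms pi_gt_zero by (intro cos_monotone_0_pi_le) (auto)
  also have "\<dots> = cos (\<kappa> * Arg z)" by (cases "Arg z \<ge> 0") auto
  finally show ?thesis using z by (simp add: Re_powr_eq mult.commute mult_left_mono)
qed

text \<open>For \<open>1 < c < 2\<close> the power maps the boundary of the right half-plane into the open left half-plane. Near
the boundary the real part is therefore at most \<open>- \<delta> * norm z powr c\<close>, and away from the boundary
\<open>norm z\<close> is at most a multiple of \<open>Re z\<close>.\<close>

lemma Re_powr_le:
  assumes c: "1 < c" "c < 2"
  obtains A \<delta> where "A \<ge> 0" "\<delta> > 0"
    "\<And>z. Re z > 0 \<Longrightarrow> Re (z powr of_real c) \<le> A * Re z powr c - \<delta> * norm z powr c"
proof -
  \<comment> \<open>Any angle strictly between \<open>pi / 2\<close> and \<open>c * pi / 2\<close> separates the two regions.\<close>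
  define \<beta> where "\<beta> = (c * pi / 2 + pi / 2) / 2"
  have p: "pi < c * pi" "c * pi < 2 * pi" using c pi_gt_zero by auto
  have "pi / 2 < (q / 2 + pi / 2) / 2 \<and> (q / 2 + pi / 2) / 2 < q / 2 \<and> (q / 2 + pi / 2) / 2 < pi"
    if "pi < q" "q < 2 * pi" for q using that by auto
  from this[OF p] have \<beta>: "pi / 2 < \<beta>" "\<beta> < c * pi / 2" "\<beta> < pi" unfolding \<beta>_def by auto
  define \<delta> where "\<delta> = - cos \<beta>"
  have "cos \<beta> < cos (pi / 2)" using \<beta> by (intro cos_monotone_0_pi) auto
  hence \<delta>: "\<delta> > 0" by (simp add: \<delta>_def)
  define \<epsilon> where "\<epsilon> = cos (\<beta> / c)"
  have bc: "\<beta> / c < pi / 2" "0 < \<beta> / c" using \<beta> c pi_gt_zero by (auto simp: field_simps)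
  hence \<epsilon>: "\<epsilon> > 0" unfolding \<epsilon>_def by (intro cos_gt_zero_pi) auto
  show thesis
  proof (rule that[of "(1 + \<delta>) * \<epsilon> powr (-c)" \<delta>])
    fix z :: complex assume z: "Re z > 0"
    hence z0: "z \<noteq> 0" by auto
    have arg: "\<bar>Arg z\<bar> < pi / 2" using z Arg_Re_pos by blast
    have cosabs: "cos (c * Arg z) = cos (c * \<bar>Arg z\<bar>)" by (cases "Arg z \<ge> 0") auto
    show "Re (z powr of_real c) \<le> (1 + \<delta>) * \<epsilon> powr (-c) * Re z powr c - \<delta> * norm z powr c"
    proof (cases "\<beta> \<le> c * \<bar>Arg z\<bar>")
      case True
      have "c * \<bar>Arg z\<bar> \<le> 2 * (pi / 2)" using arg c by (intro mult_mono) auto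
      hence "cos (c * \<bar>Arg z\<bar>) \<le> cos \<beta>" using True \<beta> p by (intro cos_monotone_0_pi_le) auto
      hence "norm z powr c * cos (c * \<bar>Arg z\<bar>) \<le> norm z powr c * cos \<beta>" by (intro mult_left_mono) auto
      also have "\<dots> = - \<delta> * norm z powr c" by (simp add: \<delta>_def)
      finally have "norm z powr c * cos (c * \<bar>Arg z\<bar>) \<le> - \<delta> * norm z powr c" .
      moreover have "0 \<le> (1 + \<delta>) * \<epsilon> powr (-c) * Re z powr c" using \<delta> by simp
      ultimately show ?thesis unfolding Re_powr_eq[OF z0] cosabs by linarith
    next
      case False
      hence "\<bar>Arg z\<bar> \<le> \<beta> / c" using c by (simp add: field_simps)
      moreover have "\<beta> / c \<le> pi" using bc(1) pi_gt_zero by linarith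
      ultimately have "\<epsilon> \<le> cos \<bar>Arg z\<bar>" unfolding \<epsilon>_def by (intro cos_monotone_0_pi_le) auto
      also have "\<dots> = cos (Arg z)" by (cases "Arg z \<ge> 0") auto
      finally have "norm z * \<epsilon> \<le> norm z * cos (Arg z)" by (intro mult_left_mono) auto
      also have "\<dots> = Re z" using Re_powr_eq[OF z0, of 1] by (simp add: z0)
      finally have "norm z * \<epsilon> \<le> Re z" .
      hence "(norm z * \<epsilon>) powr c \<le> Re z powr c" using \<epsilon> c by (intro powr_mono2) auto
      hence "norm z powr c * \<epsilon> powr c \<le> Re z powr c" using \<epsilon> by (simp add: powr_mult)
      hence 1: "norm z powr c \<le> \<epsilon> powr (-c) * Re z powr c" using \<epsilon> by (simp add: powr_minus field_simps)
      have "Re (z powr of_real c) \<le> norm z powr c * 1"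
        unfolding Re_powr_eq[OF z0] by (intro mult_left_mono) auto
      also have "\<dots> = (1 + \<delta>) * norm z powr c - \<delta> * norm z powr c" by (simp add: algebra_simps)
      also have "\<dots> \<le> (1 + \<delta>) * (\<epsilon> powr (-c) * Re z powr c) - \<delta> * norm z powr c"
        using 1 \<delta> by (intro diff_right_mono mult_left_mono) auto
      finally show ?thesis by (simp add: mult.assoc)
    qed
  qed (use \<delta> in auto)
qed

lemma powr_ge_diff_one:
  fixes t c :: real assumes "t \<ge> 0" "c \<ge> 1" shows "t - 1 \<le> t powr c"
proof (cases "t \<ge> 1")
  case True
  hence "t powr 1 \<le> t powr c" using assms by (intro powr_mono) auto
  thus ?thesis using True by simp
next
  case False
  hence "t - 1 \<le> 0" by simp
  also have "0 \<le> t powr c" by simp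
  finally show ?thesis .
qed

lemma integral_split_at_zero:
  fixes f :: "real \<Rightarrow> complex"
  assumes "integrable lborel f"
  shows "(LINT u|lborel. f u) = (LINT u:{0<..}|lborel. f u) + (LINT u:{0<..}|lborel. f (- u))"
proof -
  have 1: "integrable lborel (\<lambda>u. indicator {0<..} u *\<^sub>R f u)" "integrable lborel (\<lambda>u. indicator {..<0} u *\<^sub>R f u)"
    using assms by (intro integrable_mult_indicator; simp)+
  have "(LINT u|lborel. f u) = (LINT u|lborel. indicator {0<..} u *\<^sub>R f u + indicator {..<0} u *\<^sub>R f u)"
  proof (rule integral_cong_AE)
    show "AE u in lborel. f u = indicator {0<..} u *\<^sub>R f u + indicator {..<0} u *\<^sub>R f u"
      using AE_lborel_singleton[of 0] by eventually_elim (auto simp: indicator_def)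
  qed (use assms in measurable)
  also have "\<dots> = (LINT u|lborel. indicator {0<..} u *\<^sub>R f u) + (LINT u|lborel. indicator {..<0} u *\<^sub>R f u)"
    by (rule Bochner_Integration.integral_add[OF 1])
  also have "(LINT u|lborel. indicator {..<0} u *\<^sub>R f u) = (LINT u|lborel. indicator {0<..} u *\<^sub>R f (- u))"
    by (subst lborel_integral_real_affine[of "-1" _ 0]) (auto intro!: Bochner_Integration.integral_cong simp: indicator_def)
  finally show ?thesis unfolding set_lebesgue_integral_def .
qed

lemma integrable_even_extension:
  fixes f :: "real \<Rightarrow> real"
  assumes "set_integrable lborel {0<..} f" and [measurable]: "f \<in> borel_measurable borel"
  shows "integrable lborel (\<lambda>u. f \<bar>u\<bar>)"
proof -
  have i: "integrable lborel (\<lambda>u::real. indicator {0<..} u *\<^sub>R f u)"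
    using assms(1) unfolding set_integrable_def .
  have j: "integrable lborel (\<lambda>u::real. indicator {0<..} (-u) *\<^sub>R f (-u))"
    using lborel_integrable_real_affine[OF i, of "-1" 0] by simp
  show ?thesis
  proof (rule integrable_cong_AE[THEN iffD1, OF _ _ _ Bochner_Integration.integrable_add[OF i j]])
    show "AE u::real in lborel. indicator {0<..} u *\<^sub>R f u + indicator {0<..} (- u) *\<^sub>R f (- u) = f \<bar>u\<bar>"
      using AE_lborel_singleton[of 0] by eventually_elim (auto simp: indicator_def)
  qed measurable
qed

lemma integrable_exp_abs:
  fixes e :: real assumes "e > 0" shows "integrable lborel (\<lambda>u::real. exp (- e * \<bar>u\<bar>))"
proof (rule integrable_even_extension)
  have "set_integrable lborel {0<..} (\<lambda>u::real. u powr (1 - 1) * exp (- e * u powr 1))"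
    by (rule power_exp_integral_real(1)) (use assms in auto)
  thus "set_integrable lborel {0<..} (\<lambda>u::real. exp (- e * u))"
    by (rule set_integrable_cong[THEN iffD1, rotated -1]) auto
qed measurable

text \<open>On a vertical strip away from \<open>0\<close>, the decay of \<open>exp (z powr c)\<close> absorbs every power of \<open>z\<close>. The lower
end \<open>x1\<close> of the strip controls the negative powers.\<close>

lemma exp_powr_decay:
  assumes c: "1 < c" "c < 2" and x: "0 < x1"
  obtains C e where "C \<ge> 0" "e > 0"
    "\<And>z. x1 \<le> Re z \<Longrightarrow> Re z \<le> x2 \<Longrightarrow>
        norm (exp (z powr of_real c)) * norm z powr m \<le> C * exp (- e * \<bar>Im z\<bar>)"
proof -
  from Re_powr_le[OF c] obtain A \<delta> where A: "A \<ge> 0" "\<delta> > 0"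
    "\<And>z. Re z > 0 \<Longrightarrow> Re (z powr of_real c) \<le> A * Re z powr c - \<delta> * norm z powr c" by metis
  define D where "D = x1 powr m + ((\<bar>m\<bar> / (\<delta>/2)) powr \<bar>m\<bar> + 1)"
  define C where "C = exp (A * x2 powr c + \<delta>) * D"
  show thesis
  proof (rule that[of C "\<delta>/2"])
    show "C \<ge> 0" by (simp add: C_def D_def)
    fix z assume z: "x1 \<le> Re z" "Re z \<le> x2"
    have nz: "x1 \<le> norm z" using z complex_Re_le_cmod[of z] by linarith
    have "Re (z powr of_real c) \<le> A * Re z powr c - \<delta> * norm z powr c" using A(3) z x by simp
    also have "\<dots> \<le> A * x2 powr c - \<delta> * (norm z - 1)"
      using A z x c by (intro diff_mono mult_left_mono powr_mono2 powr_ge_diff_one) auto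
    finally have 1: "norm (exp (z powr of_real c)) \<le> exp (A * x2 powr c + \<delta>) * exp (- \<delta> * norm z)"
      by (simp add: norm_exp_eq_Re algebra_simps flip: exp_add)
    have 2: "norm z powr m \<le> D * exp (\<delta>/2 * norm z)"
    proof (cases "m \<ge> 0")
      case True
      have "norm z powr m \<le> ((m / (\<delta>/2)) powr m + 1) * exp (\<delta>/2 * norm z)"
        using A True by (intro powr_le_exp) auto
      also have "\<dots> \<le> D * exp (\<delta>/2 * norm z)"
        using True by (intro mult_right_mono) (auto simp: D_def)
      finally show ?thesis .
    next
      case False
      have "norm z powr m \<le> x1 powr m" using False nz x by (intro powr_mono2') auto
      also have "\<dots> \<le> D" by (simp add: D_def)
      also have "D * 1 \<le> D * exp (\<delta>/2 * norm z)" using A by (intro mult_left_mono) (auto simp: D_def)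
      finally show ?thesis by simp
    qed
    have "norm (exp (z powr of_real c)) * norm z powr m
       \<le> (exp (A * x2 powr c + \<delta>) * exp (- \<delta> * norm z)) * (D * exp (\<delta>/2 * norm z))"
      using 1 2 by (intro mult_mono) auto
    also have "\<dots> = C * exp (- (\<delta>/2) * norm z)"
    proof -
      have "exp (- \<delta> * norm z) * exp (\<delta>/2 * norm z) = exp (- (\<delta>/2) * norm z)"
        by (simp flip: exp_add)
      moreover have "a * b1 * (D * b2) = a * D * (b1 * b2)" for a b1 b2 :: real by (simp add: mult_ac)
      ultimately show ?thesis unfolding C_def by metis
    qed
    also have "\<dots> \<le> C * exp (- (\<delta>/2) * \<bar>Im z\<bar>)"
      using A abs_Im_le_cmod[of z] by (intro mult_left_mono) (auto simp: C_def D_def)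
    finally show "norm (exp (z powr of_real c)) * norm z powr m \<le> C * exp (- (\<delta>/2) * \<bar>Im z\<bar>)" .
  qed (use A in auto)
qed

lemma measurable_vline_powr [measurable]:
  "(\<lambda>u. vline x u powr p) \<in> borel_measurable borel"
  unfolding powr_def by measurable

lemma integrable_exp_powr_vline:
  assumes "1 < c" "c < 2" "0 < x"
  shows "integrable lborel (\<lambda>u. exp (vline x u powr of_real c) * vline x u powr of_real m)"
proof -
  obtain C e where Ce: "C \<ge> 0" "e > 0" "\<And>z. x \<le> Re z \<Longrightarrow> Re z \<le> x \<Longrightarrow>
        norm (exp (z powr of_real c)) * norm z powr m \<le> C * exp (- e * \<bar>Im z\<bar>)"
    using exp_powr_decay[OF assms] by metis
  show ?thesis
  proof (rule Bochner_Integration.integrable_bound)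
    show "integrable lborel (\<lambda>u. C * exp (- e * \<bar>u\<bar>))"
      by (intro integrable_mult_right integrable_exp_abs Ce)
    show "AE u in lborel. norm (exp (vline x u powr of_real c) * vline x u powr of_real m) \<le> norm (C * exp (- e * \<bar>u\<bar>))"
      using Ce(3)[of "vline x _"] Ce(1) by (intro AE_I2) (simp add: norm_mult norm_powr_real_powr')
  qed measurable
qed

section \<open>Hankel's formula for the reciprocal Gamma function\<close>

lemma holomorphic_on_half_plane_powr [holomorphic_intros]:
  "(\<lambda>z. z powr p) holomorphic_on {z. 0 < Re z}"
  by (intro holomorphic_intros) (auto simp: complex_nonpos_Reals_iff)

lemma Re_vline [simp]: "Re (vline x u) = x" "Im (vline x u) = u" by simp_all

lemma measurable_on_vline:
  assumes "f holomorphic_on {z. 0 < Re z}" "0 < x"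
  shows "(\<lambda>u. f (vline x u)) \<in> borel_measurable borel"
proof (rule borel_measurable_continuous_onI)
  have "continuous_on UNIV (f \<circ> vline x)"
    by (rule continuous_on_compose)
       (auto intro!: continuous_intros continuous_on_subset[OF holomorphic_on_imp_continuous_on[OF assms(1)]] simp: assms(2))
  thus "continuous_on UNIV (\<lambda>u. f (vline x u))" by (simp add: o_def)
qed

text \<open>The form of the shift that all later integrands satisfy.\<close>

lemma vertical_shift_exp_powr:
  assumes c: "1 < c" "c < 2" and f: "f holomorphic_on {z. 0 < Re z}" and x: "0 < x1" "x1 \<le> x2"
    and bd: "\<And>z. x1 \<le> Re z \<Longrightarrow> Re z \<le> x2 \<Longrightarrow> norm (f z) \<le> K * (norm (exp (z powr of_real c)) * norm z powr m)"
    and K: "K \<ge> 0"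
  shows "integrable lborel (\<lambda>u. f (vline x1 u))"
    and "(LINT u|lborel. f (vline x1 u)) = (LINT u|lborel. f (vline x2 u))"
proof -
  obtain C e where Ce: "C \<ge> 0" "e > 0"
    "\<And>z. x1 \<le> Re z \<Longrightarrow> Re z \<le> x2 \<Longrightarrow>
        norm (exp (z powr of_real c)) * norm z powr m \<le> C * exp (- e * \<bar>Im z\<bar>)"
    using exp_powr_decay[OF c x(1)] by metis
  define B where "B = (\<lambda>u. K * (C * exp (- e * u)))"
  have fB: "norm (f (vline x u)) \<le> B \<bar>u\<bar>" if "x1 \<le> x" "x \<le> x2" for x u
  proof -
    have "norm (f (vline x u)) \<le> K * (norm (exp (vline x u powr of_real c)) * norm (vline x u) powr m)"
      using that by (intro bd) auto
    also have "\<dots> \<le> K * (C * exp (- e * \<bar>Im (vline x u)\<bar>))"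
      using that K by (intro mult_left_mono Ce) auto
    finally show ?thesis by (simp add: B_def)
  qed
  have int: "integrable lborel (\<lambda>u. f (vline x u))" if "x1 \<le> x" "x \<le> x2" for x
  proof (rule Bochner_Integration.integrable_bound)
    show "integrable lborel (\<lambda>u. B \<bar>u\<bar>)" unfolding B_def
      by (intro integrable_mult_right integrable_exp_abs Ce)
    show "(\<lambda>u. f (vline x u)) \<in> borel_measurable lborel"
      using measurable_on_vline[OF f, of x] x that by simp
    show "AE u in lborel. norm (f (vline x u)) \<le> norm (B \<bar>u\<bar>)"
      using fB[OF that] by (intro AE_I2) (smt (verit) real_norm_def)
  qed
  show "integrable lborel (\<lambda>u. f (vline x1 u))" using int x by simp
  show "(LINT u|lborel. f (vline x1 u)) = (LINT u|lborel. f (vline x2 u))"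
  proof (rule vertical_line_integral_shift[OF f x int int])
    have "((\<lambda>u. exp (- e * u)) \<longlongrightarrow> 0) at_top" using Ce(2) by real_asymp
    thus "(B \<longlongrightarrow> 0) at_top" unfolding B_def by (intro tendsto_mult_right_zero)
  qed (use fB x in auto)
qed

text \<open>Hankel's integrand \<open>exp z * z powr - w\<close> after the substitution \<open>z = v powr c\<close>, without the factor
  \<open>c\<close>; the term \<open>c - 1\<close> in the exponent comes from the derivative of \<open>v powr c\<close>.\<close>

definition hankel_integrand :: "real \<Rightarrow> real \<Rightarrow> complex \<Rightarrow> complex" where
  "hankel_integrand c w z = exp (z powr of_real c) * z powr of_real (c - 1 - c * w)"

lemma hankel_integrand_holomorphic: "hankel_integrand c w holomorphic_on {z. 0 < Re z}"
  unfolding hankel_integrand_def by (intro holomorphic_intros)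

lemma norm_hankel_integrand:
  "norm (hankel_integrand c w z) = norm (exp (z powr of_real c)) * norm z powr (c - 1 - c * w)"
  by (simp add: hankel_integrand_def norm_mult norm_powr_real_powr' del: of_real_diff of_real_mult)

lemma hankel_integrable:
  assumes "1 < c" "c < 2" "0 < x"
  shows "integrable lborel (\<lambda>u. hankel_integrand c w (vline x u))"
  by (rule vertical_shift_exp_powr(1)[OF assms(1,2) hankel_integrand_holomorphic assms(3) order_refl, where K=1 and m="c - 1 - c * w"])
     (auto simp: norm_hankel_integrand)

lemma hankel_shift:
  assumes "1 < c" "c < 2" "0 < x" "x \<le> y"
  shows "(LINT u|lborel. hankel_integrand c w (vline x u)) = (LINT u|lborel. hankel_integrand c w (vline y u))"
  by (rule vertical_shift_exp_powr(2)[OF assms(1,2) hankel_integrand_holomorphic assms(3,4), where K=1 and m="c - 1 - c * w"])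
     (auto simp: norm_hankel_integrand)

text \<open>Integration by parts: the combination of the two integrands is the derivative of
\<open>exp (z powr c) * z powr (- c * w)\<close>, which vanishes at both ends of the line.\<close>

lemma hankel_recursion:
  assumes c: "1 < c" "c < 2"
  shows "(LINT u|lborel. hankel_integrand c w (vline 1 u)) = of_real w * (LINT u|lborel. hankel_integrand c (w + 1) (vline 1 u))"
proof -
  define G :: "complex \<Rightarrow> complex" where "G = (\<lambda>z. exp (z powr of_real c) * z powr of_real (- c * w))"
  define g where "g = (\<lambda>z. of_real c * hankel_integrand c w z - of_real (c * w) * hankel_integrand c (w + 1) z)"
  have I: "integrable lborel (\<lambda>u. hankel_integrand c w (vline 1 u))" for w
    by (rule hankel_integrable) (use c in auto)
  have "(\<lambda>n::nat. G (vline 1 (real n)) - G (vline 1 (- real n))) \<longlonglongrightarrow> \<i> * (LINT u|lborel. g (vline 1 u))"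
  proof (rule vertical_line_integral_limit)
    show "integrable lborel (\<lambda>u. g (vline 1 u))" unfolding g_def
      by (intro Bochner_Integration.integrable_diff integrable_mult_right I)
    fix u
    define z where "z = vline 1 u"
    have z: "0 < Re z" "z \<notin> \<real>\<^sub>\<le>\<^sub>0" "z \<noteq> 0" unfolding z_def by (auto simp: complex_nonpos_Reals_iff complex_eq_iff)
    have "(G has_field_derivative exp (z powr of_real c) * (of_real c * z powr (of_real c - 1)) * z powr of_real (- c * w)
         + exp (z powr of_real c) * (of_real (- c * w) * z powr (of_real (- c * w) - 1))) (at z)"
      unfolding G_def using z
      by (auto intro!: derivative_eq_intros has_field_derivative_powr)
    also have "exp (z powr of_real c) * (of_real c * z powr (of_real c - 1)) * z powr of_real (- c * w)
         + exp (z powr of_real c) * (of_real (- c * w) * z powr (of_real (- c * w) - 1)) = g z"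
    proof -
      have "z powr (of_real c - 1) * z powr of_real (- c * w) = z powr of_real (c - 1 - c * w)"
        by (simp flip: powr_add)
      moreover have "of_real (- c * w) - 1 = complex_of_real (c - 1 - c * (w + 1))" by (simp add: algebra_simps)
      ultimately show ?thesis unfolding g_def hankel_integrand_def
        by (simp only: of_real_minus of_real_mult) (simp add: algebra_simps)
    qed
    finally show "(G has_field_derivative g (vline 1 u)) (at (vline 1 u))" unfolding z_def .
  qed
  moreover have "(\<lambda>n::nat. G (vline 1 (real n)) - G (vline 1 (- real n))) \<longlonglongrightarrow> 0"
  proof -
    obtain C e where Ce: "C \<ge> 0" "e > 0"
      "\<And>z. 1 \<le> Re z \<Longrightarrow> Re z \<le> 1 \<Longrightarrow>
        norm (exp (z powr of_real c)) * norm z powr (- c * w) \<le> C * exp (- e * \<bar>Im z\<bar>)"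
      using exp_powr_decay[OF c, of 1] by (metis zero_less_one)
    have bd: "norm (G (vline 1 u)) \<le> C * exp (- e * \<bar>u\<bar>)" for u
      using Ce(3)[of "vline 1 u"] by (simp add: G_def norm_mult norm_powr_real_powr' del: of_real_mult of_real_minus)
    have lim: "(\<lambda>n::nat. C * exp (- e * real n)) \<longlonglongrightarrow> 0"
    proof -
      have "(\<lambda>n::nat. exp (- e * real n)) \<longlonglongrightarrow> 0" using Ce(2) by real_asymp
      thus ?thesis by (rule tendsto_mult_right_zero)
    qed
    have "(\<lambda>n::nat. G (vline 1 (real n))) \<longlonglongrightarrow> 0"
      by (rule Lim_null_comparison[OF always_eventually lim]) (use bd[of "real _"] in auto)
    moreover have "(\<lambda>n::nat. G (vline 1 (- real n))) \<longlonglongrightarrow> 0"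
      by (rule Lim_null_comparison[OF always_eventually lim]) (use bd[of "- real _"] in auto)
    ultimately show ?thesis using tendsto_diff by fastforce
  qed
  ultimately have "(LINT u|lborel. g (vline 1 u)) = 0" using LIMSEQ_unique by fastforce
  hence "of_real c * ((LINT u|lborel. hankel_integrand c w (vline 1 u)) - of_real w * (LINT u|lborel. hankel_integrand c (w + 1) (vline 1 u))) = 0"
    unfolding g_def using I by (simp add: algebra_simps)
  thus ?thesis using c by simp
qed

lemma powr_imag_axis:
  assumes "u > 0"
  shows "(\<i> * of_real u) powr of_real p = of_real (u powr p) * cis (pi / 2 * p)"
    and "(- \<i> * of_real u) powr of_real p = of_real (u powr p) * cis (- (pi / 2 * p))"
proof -
  have u: "complex_of_real (u powr p) = exp (of_real (p * ln u))"
    using assms by (simp add: powr_def flip: exp_of_real)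
  have "Ln (\<i> * of_real u) = of_real (ln u) + \<i> * of_real (pi / 2)"
    using Ln_times_of_real[OF assms, of \<i>] by (simp add: mult.commute Ln_of_real assms)
  hence "(\<i> * of_real u) powr of_real p = exp (of_real p * (of_real (ln u) + \<i> * of_real (pi / 2)))"
    using assms by (simp add: powr_def)
  also have "of_real p * (of_real (ln u) + \<i> * of_real (pi / 2)) = of_real (p * ln u) + \<i> * complex_of_real (pi / 2 * p)"
    by (simp add: algebra_simps)
  finally show "(\<i> * of_real u) powr of_real p = of_real (u powr p) * cis (pi / 2 * p)"
    by (simp only: exp_add u cis_conv_exp)
  have "Ln (- \<i> * of_real u) = of_real (ln u) - \<i> * of_real (pi / 2)"
    using Ln_times_of_real[OF assms, of "- \<i>"] by (simp add: mult.commute Ln_of_real assms)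
  hence "(- \<i> * of_real u) powr of_real p = exp (of_real p * (of_real (ln u) - \<i> * of_real (pi / 2)))"
    using assms by (simp add: powr_def)
  also have "of_real p * (of_real (ln u) - \<i> * of_real (pi / 2)) = of_real (p * ln u) + \<i> * complex_of_real (- (pi / 2 * p))"
    by (simp add: algebra_simps)
  finally show "(- \<i> * of_real u) powr of_real p = of_real (u powr p) * cis (- (pi / 2 * p))"
    by (simp only: exp_add u cis_conv_exp)
qed

lemma cis_powr:
  assumes "- pi < t" "t \<le> pi" shows "cis t powr of_real p = cis (t * p)"
proof -
  have "Ln (cis t) = \<i> * of_real t"
    unfolding cis_conv_exp by (rule Ln_exp) (use assms in auto)
  thus ?thesis by (simp add: powr_def cis_conv_exp mult_ac)
qed

text \<open>For \<open>w < 1\<close> the line may be moved to the imaginary axis. There each half is a Gamma integral with a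
complex scale \<open>cis (- \<theta>)\<close> or \<open>cis \<theta>\<close>; the two phases combine to \<open>2 * sin (pi * w)\<close>, and the reflection
formula replaces \<open>Gamma (1 - w)\<close> by \<open>1 / Gamma w\<close>.\<close>

lemma hankel_imag_axis:
  assumes c: "1 < c" "c < 2" and w: "0 < w" "w < 1"
    and int: "integrable lborel (\<lambda>u. hankel_integrand c w (\<i> * of_real u))"
  shows "(LINT u|lborel. hankel_integrand c w (\<i> * of_real u)) = of_real (2 * pi / (c * Gamma w))"
proof -
  define p where "p = c - 1 - c * w"
  have p1: "p + 1 = c * (1 - w)" by (simp add: p_def algebra_simps)
  have p1': "p + 1 > 0" unfolding p1 using c w by simp
  \<comment> \<open>On the two halves \<open>z powr c\<close> is \<open>- cis (- \<theta>)\<close> and \<open>- cis \<theta>\<close> times a positive number, and both scales have positive real part.\<close>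
  define \<theta> where "\<theta> = pi - pi / 2 * c"
  have th: "0 < \<theta>" "\<theta> < pi / 2" unfolding \<theta>_def using c pi_gt_zero by (auto simp: field_simps)
  have Rs: "Re (cis \<sigma>) > 0" if "\<sigma> = \<theta> \<or> \<sigma> = - \<theta>" for \<sigma>
    using that cos_gt_zero[OF th] by auto
  have half: "(LINT u:{0<..}|lborel. complex_of_real (u powr p) * exp (- cis \<sigma> * of_real (u powr c)) * cis \<tau>)
      = of_real (Gamma (1 - w) / c) * cis (\<tau> - \<sigma> * (1 - w))" if "\<sigma> = \<theta> \<or> \<sigma> = - \<theta>" for \<sigma> \<tau>
  proof -
    have "(LINT u:{0<..}|lborel. complex_of_real (u powr p) * exp (- cis \<sigma> * of_real (u powr c)) * cis \<tau>)
       = (LINT u:{0<..}|lborel. complex_of_real (u powr (p + 1 - 1)) * exp (- cis \<sigma> * of_real (u powr c))) * cis \<tau>"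
      by simp
    also have "\<dots> = of_real (Gamma ((p + 1)/c) / c) * cis \<sigma> powr of_real (- (p + 1) / c) * cis \<tau>"
      by (subst power_exp_integral_complex(2)) (use p1' c Rs[OF that] in auto)
    also have "- (p + 1) / c = - (1 - w)" unfolding p1 using c by auto
    also have "(p + 1) / c = 1 - w" unfolding p1 using c by auto
    also have "cis \<sigma> powr of_real (- (1 - w)) = cis (\<sigma> * (- (1 - w)))"
      by (rule cis_powr) (use that th in auto)
    finally show ?thesis by (simp add: cis_mult algebra_simps)
  qed
  have ph: "cis (pi / 2 * p - (- \<theta>) * (1 - w)) = cis (pi / 2 - pi * w)"
       "cis (- (pi / 2 * p) - \<theta> * (1 - w)) = cis (- (pi / 2 - pi * w))"
    by (rule arg_cong[where f=cis], simp add: p_def \<theta>_def algebra_simps add_divide_distrib diff_divide_distrib)+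
  have e1: "hankel_integrand c w (\<i> * of_real u) = of_real (u powr p) * exp (- cis (- \<theta>) * of_real (u powr c)) * cis (pi / 2 * p)"
    if "u \<in> {0<..}" for u
  proof -
    have "- cis (- \<theta>) = cis (pi / 2 * c)" by (simp add: \<theta>_def complex_eq_iff cos_diff sin_diff)
    thus ?thesis using that unfolding hankel_integrand_def p_def[symmetric]
      by (simp add: powr_imag_axis mult_ac)
  qed
  have e2: "hankel_integrand c w (\<i> * of_real (- u)) = of_real (u powr p) * exp (- cis \<theta> * of_real (u powr c)) * cis (- (pi / 2 * p))"
    if "u \<in> {0<..}" for u
  proof -
    have "- cis \<theta> = cis (- (pi / 2 * c))" by (simp add: \<theta>_def complex_eq_iff cos_diff sin_diff)
    thus ?thesis using that powr_imag_axis(2)[of u] unfolding hankel_integrand_def p_def[symmetric]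
      by (simp add: mult_ac)
  qed
  have "(LINT u|lborel. hankel_integrand c w (\<i> * of_real u))
      = (LINT u:{0<..}|lborel. hankel_integrand c w (\<i> * of_real u)) + (LINT u:{0<..}|lborel. hankel_integrand c w (\<i> * of_real (- u)))"
    by (rule integral_split_at_zero[OF int])
  also have "(LINT u:{0<..}|lborel. hankel_integrand c w (\<i> * of_real u)) = of_real (Gamma (1 - w) / c) * cis (pi / 2 - pi * w)"
    using half[of "- \<theta>" "pi / 2 * p"] e1 ph by (subst set_lebesgue_integral_cong[OF _ allI[OF impI[OF e1]]]) auto
  also have "(LINT u:{0<..}|lborel. hankel_integrand c w (\<i> * of_real (- u))) = of_real (Gamma (1 - w) / c) * cis (- (pi / 2 - pi * w))"
    using half[of "\<theta>" "- (pi / 2 * p)"] e2 ph by (subst set_lebesgue_integral_cong[OF _ allI[OF impI[OF e2]]]) auto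
  also have "of_real (Gamma (1 - w) / c) * cis (pi / 2 - pi * w) + of_real (Gamma (1 - w) / c) * cis (- (pi / 2 - pi * w))
      = complex_of_real (2 * sin (pi * w) * Gamma (1 - w) / c)"
    by (simp add: complex_eq_iff cos_diff sin_diff cos_add)
  also have "2 * sin (pi * w) * Gamma (1 - w) / c = 2 * pi / (c * Gamma w)"
  proof -
    have "complex_of_real (Gamma w * Gamma (1 - w)) = of_real (pi / sin (pi * w))"
      using Gamma_reflection_complex[of "of_real w"] 
      by (simp add: Gamma_complex_of_real[symmetric] sin_of_real[symmetric])
    hence "Gamma w * Gamma (1 - w) = pi / sin (pi * w)" using of_real_eq_iff by blast
    moreover have "sin (pi * w) > 0" using w by (intro sin_gt_zero) (auto simp: field_simps)
    moreover have "Gamma w > 0" using w by simp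
    ultimately show ?thesis using c by (simp add: field_simps)
  qed
  finally show ?thesis .
qed

text \<open>By shifting, the integral over the line with real part \<open>1\<close> equals those over lines approaching the
imaginary axis, and dominated convergence passes to the limit. The exponent of \<open>z\<close> exceeds \<open>- 1\<close>
exactly because \<open>w < 1\<close>, so the singularity at \<open>0\<close> is integrable.\<close>

lemma hankel_below_one:
  assumes c: "1 < c" "c < 2" and w: "0 < w" "w < 1"
  shows "(LINT u|lborel. hankel_integrand c w (vline 1 u)) = of_real (2 * pi / (c * Gamma w))"
proof -
  define p where "p = c - 1 - c * w"
  have p1: "p + 1 = c * (1 - w)" by (simp add: p_def algebra_simps)
  have p1': "p + 1 > 0" unfolding p1 using c w by simp
  from Re_powr_le[OF c] obtain A \<delta> where A: "A \<ge> 0" "\<delta> > 0"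
    "\<And>z. Re z > 0 \<Longrightarrow> Re (z powr of_real c) \<le> A * Re z powr c - \<delta> * norm z powr c" by metis
  define D where "D = (\<bar>p\<bar> / (\<delta>/2)) powr \<bar>p\<bar> + 1"
  have D: "D \<ge> 0" by (simp add: D_def)
  \<comment> \<open>The first summand serves a negative exponent \<open>p\<close>, the second one a positive exponent.\<close>
  define B where "B = (\<lambda>u. exp A * (u powr p * exp (- \<delta> * u powr c)) + exp (A + \<delta>) * D * exp (- (\<delta>/2) * u))"
  have B0: "B u \<ge> 0" for u by (auto simp: B_def D)
  have B_int: "integrable lborel (\<lambda>u. B \<bar>u\<bar>)"
  proof -
    have "set_integrable lborel {0<..} (\<lambda>u. u powr (p + 1 - 1) * exp (- \<delta> * u powr c))"
      by (rule power_exp_integral_real(1)) (use p1' c A in auto)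
    hence "integrable lborel (\<lambda>u. \<bar>u\<bar> powr p * exp (- \<delta> * \<bar>u\<bar> powr c))"
      by (intro integrable_even_extension) simp_all
    thus ?thesis unfolding B_def using A
      by (intro Bochner_Integration.integrable_add integrable_mult_right integrable_exp_abs) auto
  qed
  have bd: "norm (hankel_integrand c w z) \<le> B \<bar>Im z\<bar>" if z: "0 < Re z" "Re z \<le> 1" "Im z \<noteq> 0" for z
  proof -
    have n0: "norm z > 0" using z by auto
    have "Re (z powr of_real c) \<le> A * Re z powr c - \<delta> * norm z powr c" using A z by simp
    also have "\<dots> \<le> A * 1 - \<delta> * norm z powr c"
      using A z c powr_mono2[of c "Re z" 1] by (intro diff_right_mono mult_left_mono) auto
    finally have "norm (exp (z powr of_real c)) \<le> exp A * exp (- \<delta> * norm z powr c)"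
      by (simp add: norm_exp_eq_Re flip: exp_add)
    hence 1: "norm (hankel_integrand c w z) \<le> exp A * exp (- \<delta> * norm z powr c) * norm z powr p"
      unfolding norm_hankel_integrand p_def by (intro mult_right_mono) auto
    have im: "\<bar>Im z\<bar> \<le> norm z" by (rule abs_Im_le_cmod)
    show ?thesis
    proof (cases "p \<le> 0")
      case True
      have "exp A * exp (- \<delta> * norm z powr c) * norm z powr p \<le> exp A * exp (- \<delta> * \<bar>Im z\<bar> powr c) * \<bar>Im z\<bar> powr p"
        using True im z A c by (intro mult_mono powr_mono2') (auto intro!: powr_mono2)
      also have "\<dots> \<le> B \<bar>Im z\<bar>" unfolding B_def using D by simp
      finally show ?thesis using 1 by linarith
    next
      case False
      have "norm z powr p \<le> D * exp (\<delta>/2 * norm z)"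
        using powr_le_exp[of p "\<delta>/2" "norm z"] A False by (simp add: D_def)
      moreover have "exp (- \<delta> * norm z powr c) \<le> exp (\<delta> - \<delta> * norm z)"
        using powr_ge_diff_one[of "norm z" c] c A mult_left_mono[of "norm z - 1" "norm z powr c" \<delta>]
        by (simp add: algebra_simps)
      ultimately have "exp A * exp (- \<delta> * norm z powr c) * norm z powr p \<le> exp A * exp (\<delta> - \<delta> * norm z) * (D * exp (\<delta>/2 * norm z))"
        using D by (intro mult_mono) auto
      also have "\<dots> = exp (A + \<delta>) * D * exp (- (\<delta>/2) * norm z)"
      proof -
        have "exp A * exp (\<delta> - \<delta> * norm z) * exp (\<delta>/2 * norm z) = exp (A + \<delta>) * exp (- (\<delta>/2) * norm z)"
          by (simp flip: exp_add)
        thus ?thesis by (simp add: mult_ac)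
      qed
      also have "\<dots> \<le> exp (A + \<delta>) * D * exp (- (\<delta>/2) * \<bar>Im z\<bar>)"
        using A im D by (intro mult_left_mono) auto
      also have "\<dots> \<le> B \<bar>Im z\<bar>" unfolding B_def by simp
      finally show ?thesis using 1 by linarith
    qed
  qed
  define X where "X = (\<lambda>n::nat. inverse (real (Suc n)))"
  have X: "0 < X n" "X n \<le> 1" for n by (auto simp: X_def field_simps)
  have ae: "AE u in lborel. (\<lambda>n. hankel_integrand c w (vline (X n) u)) \<longlonglongrightarrow> hankel_integrand c w (\<i> * of_real u)"
    using AE_lborel_singleton[of 0]
  proof eventually_elim
    fix u :: real assume u: "u \<noteq> 0"
    have "(\<lambda>n. vline (X n) u) \<longlonglongrightarrow> of_real 0 + \<i> * of_real u"
      unfolding X_def by (intro tendsto_intros LIMSEQ_inverse_real_of_nat)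
    hence l: "(\<lambda>n. vline (X n) u) \<longlonglongrightarrow> \<i> * of_real u" by simp
    have np: "\<i> * of_real u \<notin> \<real>\<^sub>\<le>\<^sub>0" using u by (auto simp: complex_nonpos_Reals_iff)
    have "isCont (hankel_integrand c w) (\<i> * of_real u)"
      unfolding hankel_integrand_def using np by (intro continuous_intros) auto
    thus "(\<lambda>n. hankel_integrand c w (vline (X n) u)) \<longlonglongrightarrow> hankel_integrand c w (\<i> * of_real u)"
      by (rule isCont_tendsto_compose[OF _ l])
  qed
  have m1: "(\<lambda>u. hankel_integrand c w (vline (X n) u)) \<in> borel_measurable lborel" for n
    using measurable_on_vline[OF hankel_integrand_holomorphic X(1)] by simp
  have m2: "(\<lambda>u. hankel_integrand c w (\<i> * of_real u)) \<in> borel_measurable lborel"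
    unfolding hankel_integrand_def powr_def by measurable
  have aeB: "AE u in lborel. norm (hankel_integrand c w (vline (X n) u)) \<le> B \<bar>u\<bar>" for n
    using AE_lborel_singleton[of 0] by eventually_elim (use bd[of "vline (X n) _"] X in auto)
  have lim: "(\<lambda>n. LINT u|lborel. hankel_integrand c w (vline (X n) u)) \<longlonglongrightarrow> (LINT u|lborel. hankel_integrand c w (\<i> * of_real u))"
    by (rule integral_dominated_convergence[OF m2 m1 B_int ae aeB])
  have int: "integrable lborel (\<lambda>u. hankel_integrand c w (\<i> * of_real u))"
    by (rule integrable_dominated_convergence[OF m2 m1 B_int ae aeB])
  have "(LINT u|lborel. hankel_integrand c w (vline (X n) u)) = (LINT u|lborel. hankel_integrand c w (vline 1 u))" for n
    by (rule hankel_shift[OF c X])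
  with lim have "(LINT u|lborel. hankel_integrand c w (vline 1 u)) = (LINT u|lborel. hankel_integrand c w (\<i> * of_real u))"
    by (simp add: LIMSEQ_const_iff)
  also have "\<dots> = of_real (2 * pi / (c * Gamma w))" by (rule hankel_imag_axis[OF c w int])
  finally show ?thesis .
qed

text \<open>Continuity in \<open>w\<close> from below; on the line with real part \<open>1\<close> the norms of the integrands decrease in \<open>w\<close>.\<close>

lemma hankel_one:
  assumes c: "1 < c" "c < 2"
  shows "(LINT u|lborel. hankel_integrand c 1 (vline 1 u)) = of_real (2 * pi / (c * Gamma 1))"
proof -
  define W where "W = (\<lambda>n::nat. 1 - inverse (real (Suc (Suc n))))"
  have W: "0 < W n" "W n < 1" for n by (auto simp: W_def field_simps)
  have Wl: "W \<longlonglongrightarrow> 1"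
    using tendsto_diff[OF tendsto_const[of 1] LIMSEQ_Suc[OF LIMSEQ_inverse_real_of_nat]] by (simp add: W_def)
  have m: "(\<lambda>u. hankel_integrand c w (vline 1 u)) \<in> borel_measurable lborel" for w
    using measurable_on_vline[OF hankel_integrand_holomorphic, of 1] by simp
  have "(\<lambda>n. LINT u|lborel. hankel_integrand c (W n) (vline 1 u)) \<longlonglongrightarrow> (LINT u|lborel. hankel_integrand c 1 (vline 1 u))"
  proof (rule integral_dominated_convergence[OF m m, where w="\<lambda>u. norm (hankel_integrand c 0 (vline 1 u))"])
    show "integrable lborel (\<lambda>u. norm (hankel_integrand c 0 (vline 1 u)))"
      by (intro integrable_norm hankel_integrable c) auto
    show "AE u in lborel. (\<lambda>n. hankel_integrand c (W n) (vline 1 u)) \<longlonglongrightarrow> hankel_integrand c 1 (vline 1 u)"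
    proof (intro AE_I2)
      fix u
      have z: "vline 1 u \<noteq> 0" by (auto simp: complex_eq_iff)
      have "(\<lambda>n. exp (vline 1 u powr of_real c) * exp (of_real (c - 1 - c * W n) * Ln (vline 1 u)))
         \<longlonglongrightarrow> exp (vline 1 u powr of_real c) * exp (of_real (c - 1 - c * 1) * Ln (vline 1 u))"
        by (intro tendsto_intros Wl)
      thus "(\<lambda>n. hankel_integrand c (W n) (vline 1 u)) \<longlonglongrightarrow> hankel_integrand c 1 (vline 1 u)"
        unfolding hankel_integrand_def powr_def using z by simp
    qed
    fix n
    show "AE u in lborel. norm (hankel_integrand c (W n) (vline 1 u)) \<le> norm (hankel_integrand c 0 (vline 1 u))"
    proof (intro AE_I2)
      fix u
      have "1 \<le> norm (vline 1 u)" using complex_Re_le_cmod[of "vline 1 u"] by simp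
      thus "norm (hankel_integrand c (W n) (vline 1 u)) \<le> norm (hankel_integrand c 0 (vline 1 u))"
        unfolding norm_hankel_integrand using W[of n] c by (intro mult_left_mono powr_mono) auto
    qed
  qed
  moreover have "(\<lambda>n. LINT u|lborel. hankel_integrand c (W n) (vline 1 u)) \<longlonglongrightarrow> of_real (2 * pi / (c * Gamma 1))"
  proof -
    have g: "(\<lambda>n. Gamma (W n)) \<longlonglongrightarrow> Gamma 1" by (rule tendsto_Gamma[OF Wl]) simp
    hence "(\<lambda>n. complex_of_real (2 * pi / (c * Gamma (W n)))) \<longlonglongrightarrow> of_real (2 * pi / (c * Gamma 1))"
      by (intro tendsto_of_real tendsto_divide tendsto_mult tendsto_const g) (use c in auto)
    thus ?thesis using hankel_below_one[OF c W] by simp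
  qed
  ultimately show ?thesis using LIMSEQ_unique by blast
qed

text \<open>The recursion carries the formula from \<open>{0<..1}\<close> to all positive \<open>w\<close>.\<close>

lemma hankel_representation:
  assumes c: "1 < c" "c < 2" and "0 < w" "0 < x"
  shows "(LINT u|lborel. hankel_integrand c w (vline x u)) = of_real (2 * pi / (c * Gamma w))"
proof -
  have *: "(LINT u|lborel. hankel_integrand c w (vline 1 u)) = of_real (2 * pi / (c * Gamma w))"
    if "real n < w" "w \<le> real n + 1" for n w using that
  proof (induction n arbitrary: w)
    case 0
    thus ?case using hankel_below_one[OF c, of w] hankel_one[OF c] by (cases "w = 1") auto
  next
    case (Suc n)
    have w: "w - 1 > 0" using Suc.prems by simp
    have "of_real (w - 1) * (LINT u|lborel. hankel_integrand c (w - 1 + 1) (vline 1 u))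
        = (LINT u|lborel. hankel_integrand c (w - 1) (vline 1 u))"
      by (rule hankel_recursion[OF c, symmetric])
    also have "\<dots> = of_real (2 * pi / (c * Gamma (w - 1)))" by (rule Suc.IH) (use Suc.prems in auto)
    also have "2 * pi / (c * Gamma (w - 1)) = (w - 1) * (2 * pi / (c * Gamma w))"
    proof -
      have "Gamma w = (w - 1) * Gamma (w - 1)" using Gamma_plus1[of "w - 1"] w
        by (metis add.commute add_0 diff_add_cancel nonpos_Ints_of_int nonpos_Ints_nonpos not_le)
      thus ?thesis using w Gamma_real_pos[OF w] c by simp
    qed
    finally show ?case using w by (simp only: of_real_mult mult_cancel_left diff_add_cancel) auto
  qed
  have 1: "(LINT u|lborel. hankel_integrand c w (vline 1 u)) = of_real (2 * pi / (c * Gamma w))"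
  proof (rule *[of "nat (\<lceil>w\<rceil> - 1)"])
    have "\<lceil>w\<rceil> \<ge> 1" using assms by simp
    thus "real (nat (\<lceil>w\<rceil> - 1)) < w" "w \<le> real (nat (\<lceil>w\<rceil> - 1)) + 1" by (simp; linarith)+
  qed
  have "(LINT u|lborel. hankel_integrand c w (vline x u)) = (LINT u|lborel. hankel_integrand c w (vline 1 u))"
    using hankel_shift[OF c \<open>0 < x\<close>, of 1 w] hankel_shift[OF c, of 1 x w] by (cases "x \<le> 1") auto
  with 1 show ?thesis by simp
qed

section \<open>The Mittag-Leffler function as a mixture of exponentials\<close>

text \<open>The factorisation shows that \<open>z powr (2 * k) + l\<close> has no zero in the right half-plane: the second
factor has positive real part because \<open>z powr k\<close> and its inverse have.\<close>

lemma powr_half_plane_add_bound: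
  assumes k: "0 < k" "k < 1" and l: "0 \<le> l" and z: "0 < Re z"
  shows "cos (k * pi / 2) * norm z powr (2 * k) \<le> norm (z powr of_real (2 * k) + of_real l)"
    and "z powr of_real (2 * k) + of_real l = z powr of_real k * (z powr of_real k + of_real l * z powr of_real (- k))"
    and "0 < cos (k * pi / 2) "
    and "cos (k * pi / 2) * norm z powr k \<le> Re (z powr of_real k + of_real l * z powr of_real (- k))"
proof -
  have z0: "z \<noteq> 0" using z by auto
  show d: "0 < cos (k * pi / 2)" using k pi_gt_zero by (intro cos_gt_zero) (auto simp: field_simps)
  show eq: "z powr of_real (2 * k) + of_real l = z powr of_real k * (z powr of_real k + of_real l * z powr of_real (- k))"
    using z0 by (simp add: distrib_left mult.left_commute[of _ "of_real l"] flip: powr_add)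
  have 1: "cos (k * pi / 2) * norm z powr k \<le> Re (z powr of_real k)"
    using Re_powr_ge[of k z] k z by simp
  have "Re (z powr of_real (- k)) \<ge> 0"
  proof -
    have "z powr of_real (- k) = inverse (z powr of_real k)" by (simp add: powr_minus)
    moreover have "Re (z powr of_real k) \<ge> 0" using 1 d by (smt (verit) mult_nonneg_nonneg powr_ge_zero)
    ultimately show ?thesis by simp
  qed
  hence "Re (of_real l * z powr of_real (- k)) \<ge> 0" using l by simp
  thus 2: "cos (k * pi / 2) * norm z powr k \<le> Re (z powr of_real k + of_real l * z powr of_real (- k))"
    using 1 by simp
  have e: "norm z powr (2 * k) = norm z powr k * norm z powr k"
    using powr_add[of "norm z" k k] by (simp only: mult_2)
  have "cos (k * pi / 2) * norm z powr (2 * k) = norm z powr k * (cos (k * pi / 2) * norm z powr k)"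
    unfolding e by (simp only: mult_ac)
  also have "\<dots> \<le> norm z powr k * norm (z powr of_real k + of_real l * z powr of_real (- k))"
    using 2 complex_Re_le_cmod[of "z powr of_real k + of_real l * z powr of_real (- k)"]
    by (intro mult_left_mono) auto
  also have "\<dots> = norm (z powr of_real (2 * k) + of_real l)"
    unfolding eq norm_mult by (simp add: norm_powr_real_powr')
  finally show "cos (k * pi / 2) * norm z powr (2 * k) \<le> norm (z powr of_real (2 * k) + of_real l)" .
qed

text \<open>On a line far enough to the right the quotient expands into a geometric series in \<open>l * z powr - (c * a)\<close>,
and the terms are Hankel integrals, whose values \<open>1 / Gamma (a * j + b)\<close> are the coefficients of the
Mittag-Leffler series. The line is then shifted back to real part \<open>1\<close>, which does not depend on \<open>l\<close>.\<close>

lemma mittag_leffler_contour_integral: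
  fixes a b c l :: real
  defines "k \<equiv> c * a / 2"
  assumes c: "1 < c" "c < 2" and k: "0 < k" "k < 1" and b: "0 < b" and l: "0 \<le> l"
  shows "integrable lborel (\<lambda>u. exp (vline 1 u powr of_real c) * vline 1 u powr of_real (2 * k - c * b + c - 1) / (vline 1 u powr of_real (2 * k) + of_real l))"
    and "(LINT u|lborel. exp (vline 1 u powr of_real c) * vline 1 u powr of_real (2 * k - c * b + c - 1) / (vline 1 u powr of_real (2 * k) + of_real l))
      = of_real (2 * pi / c * mittag_leffler a b (- l))"
proof -
  define f where "f = (\<lambda>z::complex. exp (z powr of_real c) * z powr of_real (2 * k - c * b + c - 1) / (z powr of_real (2 * k) + of_real l))"
  define d where "d = cos (k * pi / 2)"
  have a: "a > 0" using k c by (auto simp: k_def zero_less_mult_iff)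
  have d: "d > 0" unfolding d_def by (rule powr_half_plane_add_bound(3)[OF k l, of 1]) simp
  have ne: "z powr of_real (2 * k) + of_real l \<noteq> 0" if "0 < Re z" for z
  proof -
    have "norm z > 0" using that by auto
    hence "0 < d * norm z powr (2 * k)" using d by (intro mult_pos_pos) auto
    also have "\<dots> \<le> norm (z powr of_real (2 * k) + of_real l)"
      unfolding d_def by (rule powr_half_plane_add_bound(1)[OF k l that])
    finally show ?thesis by auto
  qed
  have hol: "f holomorphic_on {z. 0 < Re z}"
    unfolding f_def using ne by (intro holomorphic_intros) auto
  have fb: "norm (f z) \<le> inverse d * (norm (exp (z powr of_real c)) * norm z powr (c - 1 - c * b))" if z: "0 < Re z" for z
  proof -
    have n: "norm z > 0" using z by auto
    have "norm (f z) = norm (exp (z powr of_real c)) * norm z powr (2 * k - c * b + c - 1) / norm (z powr of_real (2 * k) + of_real l)"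
      unfolding f_def by (simp add: norm_mult norm_divide norm_powr_real_powr' del: of_real_diff of_real_add of_real_mult)
    also have "\<dots> \<le> norm (exp (z powr of_real c)) * norm z powr (2 * k - c * b + c - 1) / (d * norm z powr (2 * k))"
    proof (intro divide_left_mono mult_pos_pos)
      show "d * norm z powr (2 * k) \<le> norm (z powr of_real (2 * k) + of_real l)"
        unfolding d_def by (rule powr_half_plane_add_bound(1)[OF k l z])
      show "0 < norm (z powr of_real (2 * k) + of_real l)" using ne[OF z] by (simp only: zero_less_norm_iff not_False_eq_True)
    qed (use d n in auto)
    also have "norm z powr (2 * k - c * b + c - 1) = norm z powr (c - 1 - c * b) * norm z powr (2 * k)"
      by (simp add: algebra_simps flip: powr_add)
    finally show ?thesis using n d by (simp add: field_simps)
  qed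
  \<comment> \<open>To the right of \<open>X\<close> the ratio of the geometric series is at most \<open>1 / 2\<close>.\<close>
  define X where "X = max 1 ((2 * l) powr (1 / (2 * k)))"
  have X: "1 \<le> X" by (simp add: X_def)
  have Xl: "l * norm z powr (- (2 * k)) \<le> 1/2" if "X \<le> Re z" for z
  proof (cases "l = 0")
    case False
    have nz: "X \<le> norm z" using that complex_Re_le_cmod[of z] by linarith
    have "2 * l = ((2 * l) powr (1 / (2 * k))) powr (2 * k)" using l False k by (simp add: powr_powr)
    also have "\<dots> \<le> norm z powr (2 * k)" using nz k by (intro powr_mono2) (auto simp: X_def)
    finally have "2 * l \<le> norm z powr (2 * k)" .
    moreover have "norm z powr (2 * k) > 0" using nz X by auto
    ultimately show ?thesis by (simp add: powr_minus field_simps)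
  qed simp
  have int1: "integrable lborel (\<lambda>u. f (vline 1 u))"
    by (rule vertical_shift_exp_powr(1)[OF c hol _ X, where K="inverse d" and m="c - 1 - c * b"]) (use fb d in auto)
  have shift: "(LINT u|lborel. f (vline 1 u)) = (LINT u|lborel. f (vline X u))"
    by (rule vertical_shift_exp_powr(2)[OF c hol _ X, where K="inverse d" and m="c - 1 - c * b"]) (use fb d in auto)
  define T where "T = (\<lambda>j u. of_real ((- l) ^ j) * hankel_integrand c (a * real j + b) (vline X u))"
  have Tint: "integrable lborel (T j)" for j
    unfolding T_def by (intro integrable_mult_right hankel_integrable c) (use X in auto)
  have Tnorm: "norm (T j u) \<le> (1/2) ^ j * norm (hankel_integrand c b (vline X u))" for j u
  proof -
    define z where "z = vline X u"
    have n: "norm z > 0" using X unfolding z_def by (auto simp: complex_eq_iff)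
    have e: "c - 1 - c * (a * real j + b) = (c - 1 - c * b) + (- (2 * k)) * real j" by (simp add: k_def algebra_simps)
    have "norm (T j u) = l ^ j * (norm (exp (z powr of_real c)) * norm z powr (c - 1 - c * (a * real j + b)))"
      unfolding T_def norm_mult norm_hankel_integrand z_def[symmetric] using l by (simp add: norm_power power_abs)
    also have "norm z powr (c - 1 - c * (a * real j + b)) = norm z powr (c - 1 - c * b) * (norm z powr (- (2 * k))) ^ j"
      using n unfolding e powr_add by (simp add: powr_power mult.commute)
    also have "l ^ j * (norm (exp (z powr of_real c)) * (norm z powr (c - 1 - c * b) * (norm z powr (- (2 * k))) ^ j))
        = (l * norm z powr (- (2 * k))) ^ j * norm (hankel_integrand c b z)"
      unfolding norm_hankel_integrand by (simp add: power_mult_distrib mult_ac)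
    also have "\<dots> \<le> (1/2) ^ j * norm (hankel_integrand c b z)"
      using Xl[of z] l by (intro mult_right_mono power_mono) (auto simp: z_def)
    finally show ?thesis unfolding z_def .
  qed
  have Tsums: "(\<lambda>j. T j u) sums f (vline X u)" for u
  proof -
    define z where "z = vline X u"
    have z: "0 < Re z" "z \<noteq> 0" using X unfolding z_def by (auto simp: complex_eq_iff)
    define q where "q = - of_real l * z powr of_real (- (2 * k))"
    have nq: "norm q < 1" using Xl[of z] l unfolding q_def
      by (simp add: norm_mult norm_powr_real_powr' z_def del: of_real_mult of_real_minus)
    have Tq: "T j u = hankel_integrand c b z * q ^ j" for j
    proof -
      have "c - 1 - c * (a * real j + b) = (c - 1 - c * b) + (- (2 * k)) * real j" by (simp add: k_def algebra_simps)
      hence "z powr of_real (c - 1 - c * (a * real j + b)) = z powr of_real (c - 1 - c * b) * z powr (of_real (- (2 * k)) * of_nat j)"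
        by (simp only: of_real_add powr_add of_real_mult of_real_of_nat_eq)
      also have "z powr (of_real (- (2 * k)) * of_nat j) = (z powr of_real (- (2 * k))) ^ j"
        using z by (simp add: powr_def exp_of_nat_mult[symmetric] mult_ac)
      finally show ?thesis unfolding T_def z_def[symmetric] hankel_integrand_def q_def
        by (simp add: power_mult_distrib mult_ac) (simp flip: power_mult_distrib)
    qed
    have "(\<lambda>j. q ^ j) sums (1 / (1 - q))" by (rule geometric_sums[OF nq])
    hence "(\<lambda>j. T j u) sums (hankel_integrand c b z * (1 / (1 - q)))" unfolding Tq by (rule sums_mult)
    also have "hankel_integrand c b z * (1 / (1 - q)) = f z"
    proof -
      have p1: "z powr of_real (- (2 * k)) * z powr of_real (2 * k) = 1"
        using z by (simp flip: powr_add)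
      have e1: "(1 - q) * z powr of_real (2 * k) = z powr of_real (2 * k) + of_real l"
        unfolding q_def using p1 by (simp add: algebra_simps)
      have e2: "z powr of_real (2 * k - c * b + c - 1) = z powr of_real (c - 1 - c * b) * z powr of_real (2 * k)"
        by (simp add: algebra_simps flip: powr_add)
      have e3: "E * Q * (1 / R) = E * (Q * P) / (R * P)" if "P \<noteq> 0" for E Q R P :: complex
        using that by simp
      have "z powr of_real (2 * k) \<noteq> 0" using z by simp
      from e3[OF this] show ?thesis unfolding f_def hankel_integrand_def e1[symmetric] e2 .
    qed
    finally show ?thesis unfolding z_def .
  qed
  have bint: "integrable lborel (\<lambda>u. norm (hankel_integrand c b (vline X u)))"
    by (intro integrable_norm hankel_integrable c) (use X in auto)
  have "(\<lambda>j. LINT u|lborel. T j u) sums (LINT u|lborel. (\<Sum>j. T j u))"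
  proof (rule sums_integral[OF Tint])
    show "AE u in lborel. summable (\<lambda>j. norm (T j u))"
    proof (intro AE_I2)
      fix u
      show "summable (\<lambda>j. norm (T j u))"
        by (rule summable_comparison_test'[where N=0 and g="\<lambda>j. (1/2) ^ j * norm (hankel_integrand c b (vline X u))"])
           (use Tnorm in \<open>auto intro!: summable_mult2 summable_geometric\<close>)
    qed
    show "summable (\<lambda>j. LINT u|lborel. norm (T j u))"
    proof (rule summable_comparison_test'[where N=0 and g="\<lambda>j. (1/2) ^ j * (LINT u|lborel. norm (hankel_integrand c b (vline X u)))"])
      fix j
      have "(LINT u|lborel. norm (T j u)) \<le> (LINT u|lborel. (1/2) ^ j * norm (hankel_integrand c b (vline X u)))"
        by (intro integral_mono integrable_norm Tint integrable_mult_right bint Tnorm)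
      thus "norm (LINT u|lborel. norm (T j u)) \<le> (1/2) ^ j * (LINT u|lborel. norm (hankel_integrand c b (vline X u)))"
        by simp
    qed (auto intro!: summable_mult2 summable_geometric)
  qed
  also have "(\<lambda>u. \<Sum>j. T j u) = (\<lambda>u. f (vline X u))" using Tsums by (auto simp: sums_iff)
  also have "(\<lambda>j. LINT u|lborel. T j u) = (\<lambda>j. of_real (2 * pi / c * ((- l) ^ j / Gamma (a * real j + b))))"
  proof
    fix j
    have "(LINT u|lborel. T j u) = of_real ((- l) ^ j) * (LINT u|lborel. hankel_integrand c (a * real j + b) (vline X u))"
      unfolding T_def by simp
    also have "\<dots> = of_real ((- l) ^ j) * of_real (2 * pi / (c * Gamma (a * real j + b)))"
      by (subst hankel_representation[OF c]) (use a b X in \<open>auto intro: add_nonneg_pos\<close>)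
    finally show "(LINT u|lborel. T j u) = of_real (2 * pi / c * ((- l) ^ j / Gamma (a * real j + b)))"
      by (simp add: mult_ac)
  qed
  finally have s: "(\<lambda>j. complex_of_real (2 * pi / c * ((- l) ^ j / Gamma (a * real j + b)))) sums (LINT u|lborel. f (vline 1 u))"
    using shift by simp
  define Y where "Y = of_real (c / (2 * pi)) * (LINT u|lborel. f (vline 1 u))"
  have Y: "(\<lambda>j. complex_of_real ((- l) ^ j / Gamma (a * real j + b))) sums Y"
  proof -
    have "c / (2 * pi) * (2 * pi / c * t) = t" for t using c by simp
    with sums_mult[OF s, of "of_real (c / (2 * pi))"] show ?thesis
      unfolding Y_def of_real_mult[symmetric] by (simp only:)
  qed
  have "(\<lambda>j. (- l) ^ j / Gamma (a * real j + b)) sums Re Y"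
    using sums_Re[OF Y] by (simp only: Re_complex_of_real)
  moreover have "(\<lambda>j::nat. 0) sums Im Y" using sums_Im[OF Y] by (simp only: Im_complex_of_real)
  ultimately have "Y = of_real (mittag_leffler a b (- l))"
    unfolding mittag_leffler_def by (auto simp: complex_eq_iff dest: sums_unique)
  hence "of_real (2 * pi / c) * Y = of_real (2 * pi / c * mittag_leffler a b (- l))" by simp
  moreover have "of_real (2 * pi / c) * Y = (LINT u|lborel. f (vline 1 u))"
    unfolding Y_def mult.assoc[symmetric] of_real_mult[symmetric] using c by simp
  ultimately have "(LINT u|lborel. f (vline 1 u)) = of_real (2 * pi / c * mittag_leffler a b (- l))" by (simp only:)
  with int1 show "integrable lborel (\<lambda>u. exp (vline 1 u powr of_real c) * vline 1 u powr of_real (2 * k - c * b + c - 1) / (vline 1 u powr of_real (2 * k) + of_real l))"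
    and "(LINT u|lborel. exp (vline 1 u powr of_real c) * vline 1 u powr of_real (2 * k - c * b + c - 1) / (vline 1 u powr of_real (2 * k) + of_real l))
      = of_real (2 * pi / c * mittag_leffler a b (- l))"
    unfolding f_def by auto
qed

lemma laplace_exp_complex:
  assumes "Re S > 0"
  shows "integrable lborel (\<lambda>r::real. indicator {0<..} r *\<^sub>R exp (- (S * of_real r)))"
    and "(LINT r|lborel. indicator {0<..} r *\<^sub>R exp (- (S * of_real r))) = inverse S"
proof -
  have eq: "indicator {0<..} u *\<^sub>R (complex_of_real (u powr (1 - 1)) * exp (- S * of_real (u powr 1))) = indicator {0<..} u *\<^sub>R exp (- (S * of_real u))" for u
    by (cases "u > 0") auto
  show "integrable lborel (\<lambda>r::real. indicator {0<..} r *\<^sub>R exp (- (S * of_real r)))"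
    using power_exp_integral_complex(1)[of 1 1 S] assms unfolding set_integrable_def eq by simp
  have "S powr (- 1) = inverse S" using powr_minus[of S 1] assms by (auto simp: powr_to_1)
  thus "(LINT r|lborel. indicator {0<..} r *\<^sub>R exp (- (S * of_real r))) = inverse S"
    using power_exp_integral_complex(2)[of 1 1 S] assms unfolding set_lebesgue_integral_def eq by simp
qed

text \<open>The index is a pair \<open>(u, r)\<close>: the point \<open>v = 1 + i * u\<close> of the contour and the variable \<open>r\<close> of the
Laplace integral for the resolvent. The exponents are those of \<open>v\<close> instead of \<open>z = v powr c\<close>, so that
\<open>z powr (a / 2) = v powr k\<close> with \<open>k = c * a / 2 < 1\<close>. This makes \<open>s = r * v powr - k\<close> a time in the sector
\<open>Re (inverse s) \<ge> \<delta> / norm s\<close>. The weight stays bounded near \<open>r = 0\<close>, where \<open>norm s powr - \<theta>\<close>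
grows like \<open>r powr - \<theta>\<close>; this is integrable for \<open>\<theta> < 1\<close>.\<close>

lemma mittag_leffler_gaussian_mixture:
  fixes a b :: real
  assumes a: "1 < a" "a < 2" and b: "0 < b"
  obtains W s :: "real \<times> real \<Rightarrow> complex" and \<delta> :: real where
    "\<delta> > 0" "W \<in> borel_measurable borel" "s \<in> borel_measurable borel"
    "\<And>m. Re (s m) > 0" "\<And>m. Re (inverse (s m)) \<ge> \<delta> / norm (s m)"
    "\<And>\<theta>. 0 \<le> \<theta> \<Longrightarrow> \<theta> < 1 \<Longrightarrow> integrable lborel (\<lambda>m. norm (W m) * norm (s m) powr (- \<theta>))"
    "\<And>l. 0 \<le> l \<Longrightarrow> (LINT m|lborel. W m * exp (- s m * of_real l)) = of_real (mittag_leffler a b (- l))"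
proof -
  \<comment> \<open>Any value between \<open>1\<close> and \<open>2 / a\<close>: above \<open>1\<close> for the decay of \<open>exp (v powr c)\<close>, below \<open>2 / a\<close> for \<open>k < 1\<close>.\<close>
  define c where "c = (1 + 2 / a) / 2"
  define k where "k = c * a / 2"
  have a2: "1 < 2 / a" "2 / a < 2" using a by (auto simp: field_simps)
  have c: "1 < c" "c < 2" unfolding c_def using a2 by auto
  have "k = (a + 2) / 4" unfolding k_def c_def using a by (simp add: field_simps)
  hence k: "0 < k" "k < 1" using a by auto
  define d where "d = cos (k * pi / 2)"
  have d: "d > 0" "d \<le> 1" unfolding d_def using powr_half_plane_add_bound(3)[OF k order_refl, of 1] by auto
  define V where "V = (\<lambda>u. of_real (c / (2 * pi)) * exp (vline 1 u powr of_real c) * vline 1 u powr of_real (k - c * b + c - 1))"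
  define W where "W = (\<lambda>(u, r). indicator {0<..} r *\<^sub>R (V u * exp (- (of_real r * vline 1 u powr of_real k))))"
  \<comment> \<open>The value for \<open>r \<le> 0\<close>, where the weight vanishes, only has to lie in the sector.\<close>
  define s where "s = (\<lambda>(u, r). if r > 0 then of_real r * vline 1 u powr of_real (- k) else (1::complex))"
  have v0: "vline 1 u \<noteq> 0" for u by (auto simp: complex_eq_iff)
  have v1: "1 \<le> norm (vline 1 u)" for u using complex_Re_le_cmod[of "vline 1 u"] by simp
  have vk: "d * norm (vline 1 u) powr k \<le> Re (vline 1 u powr of_real k)" for u
    using Re_powr_ge[of k "vline 1 u"] k by (simp add: d_def)
  have vk1: "d \<le> Re (vline 1 u powr of_real k)" for u
  proof -
    have "d * 1 \<le> d * norm (vline 1 u) powr k" using d v1[of u] k by (intro mult_left_mono ge_one_powr_ge_zero) auto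
    with vk[of u] show ?thesis by simp
  qed
  have Vm: "V \<in> borel_measurable borel" unfolding V_def by measurable
  have Wm: "W \<in> borel_measurable borel"
  proof -
    note [measurable] = Vm
    have "W \<in> borel_measurable (borel \<Otimes>\<^sub>M borel)" unfolding W_def by measurable
    thus ?thesis by (simp add: borel_prod)
  qed
  have sm: "s \<in> borel_measurable borel"
  proof -
    have "s \<in> borel_measurable (borel \<Otimes>\<^sub>M borel)" unfolding s_def by measurable
    thus ?thesis by (simp add: borel_prod)
  qed
  have sinv: "inverse (s (u, r)) = of_real (inverse r) * vline 1 u powr of_real k"
    and snorm: "norm (s (u, r)) = r * norm (vline 1 u) powr (- k)" if "r > 0" for u r
    using that by (simp_all add: s_def powr_minus norm_mult norm_inverse norm_powr_real_powr' of_real_inverse)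
  have sRe: "Re (inverse (s m)) \<ge> d / norm (s m)" for m
  proof (cases m)
    case (Pair u r)
    show ?thesis
    proof (cases "r > 0")
      case True
      have "d / norm (s m) = inverse r * (d * norm (vline 1 u) powr k)"
        unfolding Pair snorm[OF True] by (simp add: powr_minus divide_inverse mult_ac)
      also have "\<dots> \<le> inverse r * Re (vline 1 u powr of_real k)" using vk True by (intro mult_left_mono) auto
      also have "\<dots> = Re (inverse (s m))" unfolding Pair sinv[OF True] by (simp del: of_real_inverse)
      finally show ?thesis .
    qed (use d Pair in \<open>auto simp: s_def\<close>)
  qed
  have spos: "Re (s m) > 0" for m
  proof -
    have n: "norm (s m) > 0" using v0 by (cases m) (auto simp: s_def)
    hence "0 < Re (inverse (s m))" using sRe[of m] d by (meson divide_pos_pos less_le_trans)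
    thus ?thesis by (auto simp: zero_less_divide_iff not_sum_power2_lt_zero)
  qed
  have Wint: "integrable lborel (\<lambda>m. norm (W m) * norm (s m) powr (- \<theta>))" if th: "0 \<le> \<theta>" "\<theta> < 1" for \<theta>
  proof -
    define g where "g = (\<lambda>u. norm (exp (vline 1 u powr of_real c) * vline 1 u powr of_real (k - c * b + c - 1 + k * \<theta>)))"
    define h where "h = (\<lambda>r. indicator {0<..} r *\<^sub>R (r powr (1 - \<theta> - 1) * exp (- d * r powr 1)))"
    have gi: "integrable lborel g" unfolding g_def
      by (intro integrable_norm integrable_exp_powr_vline c) auto
    have hi: "integrable lborel h" unfolding h_def
      using power_exp_integral_real(1)[of "1 - \<theta>" 1 d] th d unfolding set_integrable_def by simp
    have "integrable (lborel \<Otimes>\<^sub>M lborel) (\<lambda>(u, r). norm (W (u, r)) * norm (s (u, r)) powr (- \<theta>))"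
    proof (rule integrable_pair_dominated)
      show "(\<lambda>(u, r). norm (W (u, r)) * norm (s (u, r)) powr (- \<theta>)) \<in> borel_measurable (lborel \<Otimes>\<^sub>M lborel)"
        using Wm sm by (simp add: lborel_prod case_prod_unfold)
      show "integrable lborel (\<lambda>r. c / (2 * pi) * (g u * h r))" for u using hi by simp
      show "(LINT r|lborel. c / (2 * pi) * (g u * h r)) \<le> c / (2 * pi) * (g u * (LINT r|lborel. h r))" for u by simp
      show "integrable lborel (\<lambda>u. c / (2 * pi) * (g u * (LINT r|lborel. h r)))" using gi by simp
      show "norm (norm (W (u, r)) * norm (s (u, r)) powr (- \<theta>)) \<le> c / (2 * pi) * (g u * h r)" for u r
      proof -
        define m where m: "m = (u, r)"
        have "norm (W m) * norm (s m) powr (- \<theta>) \<le> c / (2 * pi) * (g u * h r)"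
        proof (cases "r > 0")
          case True
          define n where "n = norm (vline 1 u)"
          have n: "n > 0" using v0[of u] by (simp add: n_def)
          have "norm (s m) powr (- \<theta>) = r powr (- \<theta>) * n powr (k * \<theta>)"
            unfolding m snorm[OF True] n_def[symmetric] using True n by (simp add: powr_mult powr_powr)
          moreover have "norm (W m) \<le> norm (V u) * exp (- d * r)"
          proof -
            have "norm (W m) = norm (V u) * exp (- (r * Re (vline 1 u powr of_real k)))"
              using True by (simp add: W_def m norm_mult norm_exp_eq_Re)
            also have "\<dots> \<le> norm (V u) * exp (- d * r)"
              using mult_left_mono[OF vk1[of u], of r] True by (intro mult_left_mono) (auto simp: mult.commute)
            finally show ?thesis .
          qed
          ultimately have "norm (W m) * norm (s m) powr (- \<theta>) \<le> norm (V u) * exp (- d * r) * (r powr (- \<theta>) * n powr (k * \<theta>))"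
            by (simp add: mult_right_mono)
          also have "norm (V u) = c / (2 * pi) * (norm (exp (vline 1 u powr of_real c)) * n powr (k - c * b + c - 1))"
            using c unfolding V_def n_def by (simp add: norm_mult norm_divide norm_powr_real_powr' del: of_real_diff of_real_add of_real_mult)
          also have "c / (2 * pi) * (norm (exp (vline 1 u powr of_real c)) * n powr (k - c * b + c - 1)) * exp (- d * r) * (r powr (- \<theta>) * n powr (k * \<theta>))
              = c / (2 * pi) * (norm (exp (vline 1 u powr of_real c)) * (n powr (k - c * b + c - 1) * n powr (k * \<theta>)) * (r powr (- \<theta>) * exp (- d * r)))"
            by (simp only: mult_ac)
          also have "n powr (k - c * b + c - 1) * n powr (k * \<theta>) = n powr (k - c * b + c - 1 + k * \<theta>)"
            by (simp only: powr_add)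
          also have "norm (exp (vline 1 u powr of_real c)) * n powr (k - c * b + c - 1 + k * \<theta>) = g u"
            unfolding g_def n_def by (simp add: norm_mult norm_powr_real_powr' del: of_real_diff of_real_add of_real_mult)
          also have "r powr (- \<theta>) * exp (- d * r) = h r" using True by (simp add: h_def)
          finally show ?thesis .
        qed (auto simp: W_def m h_def)
        thus ?thesis unfolding m real_norm_def by (subst abs_of_nonneg) auto
      qed
    qed
    thus ?thesis by (simp add: lborel_prod case_prod_unfold)
  qed
  have rep: "(LINT m|lborel. W m * exp (- s m * of_real l)) = of_real (mittag_leffler a b (- l))" if l: "0 \<le> l" for l
  proof -
    define P where "P = (\<lambda>m. W m * exp (- s m * of_real l))"
    have Pint: "integrable (lborel \<Otimes>\<^sub>M lborel) P" unfolding lborel_prod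
    proof (rule Bochner_Integration.integrable_bound[OF Wint[of 0]])
      show "P \<in> borel_measurable lborel" unfolding P_def using Wm sm by simp
      show "AE m in lborel. norm (P m) \<le> norm (norm (W m) * norm (s m) powr - 0)"
      proof (intro AE_I2)
        fix m
        have "norm (exp (- s m * of_real l)) \<le> 1" using spos[of m] l by (simp add: norm_exp_eq_Re)
        hence "norm (W m) * norm (exp (- s m * of_real l)) \<le> norm (W m) * 1" by (intro mult_left_mono) auto
        moreover have "s m \<noteq> 0" using spos[of m] by auto
        ultimately show "norm (P m) \<le> norm (norm (W m) * norm (s m) powr - 0)" by (simp add: P_def norm_mult)
      qed
    qed auto
    have inner: "(LINT r|lborel. P (u, r)) = of_real (c / (2 * pi)) * (exp (vline 1 u powr of_real c) * vline 1 u powr of_real (2 * k - c * b + c - 1) / (vline 1 u powr of_real (2 * k) + of_real l))" for u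
    proof -
      define S where "S = vline 1 u powr of_real k + of_real l * vline 1 u powr of_real (- k)"
      have "d * norm (vline 1 u) powr k \<le> Re S"
        unfolding S_def d_def by (rule powr_half_plane_add_bound(4)[OF k l]) simp
      moreover have "0 < d * norm (vline 1 u) powr k" using d v0[of u] by simp
      ultimately have S: "Re S > 0" by linarith
      have PV: "P (u, r) = V u * (indicator {0<..} r *\<^sub>R exp (- (S * of_real r)))" for r
        unfolding P_def W_def s_def S_def by (cases "r > 0") (auto simp: algebra_simps exp_add exp_diff exp_minus divide_inverse)
      have "(LINT r|lborel. P (u, r)) = V u * inverse S"
        unfolding PV integral_mult_right_zero laplace_exp_complex(2)[OF S] ..
      also have "\<dots> = of_real (c / (2 * pi)) * (exp (vline 1 u powr of_real c) * (vline 1 u powr of_real (k - c * b + c - 1) * vline 1 u powr of_real k) / (vline 1 u powr of_real k * S))"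
      proof -
        have e: "K * E * X * inverse S = K * (E * (X * Z) / (Z * S))" if "Z \<noteq> 0" for K E X Z S :: complex
          using that by (simp add: inverse_eq_divide)
        show ?thesis unfolding V_def by (rule e) (simp only: powr_eq_0_iff v0 not_False_eq_True)
      qed
      also have "vline 1 u powr of_real k * S = vline 1 u powr of_real (2 * k) + of_real l"
        unfolding S_def by (rule powr_half_plane_add_bound(2)[OF k l, symmetric]) simp
      also have "vline 1 u powr of_real (k - c * b + c - 1) * vline 1 u powr of_real k = vline 1 u powr of_real (2 * k - c * b + c - 1)"
        by (simp add: algebra_simps flip: powr_add)
      finally show ?thesis .
    qed
    have "(LINT m|lborel. P m) = (LINT u|lborel. LINT r|lborel. P (u, r))"
      using lborel_pair.integral_fst'[OF Pint] by (simp add: lborel_prod)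
    also have "\<dots> = of_real (c / (2 * pi)) * of_real (2 * pi / c * mittag_leffler a b (- l))"
      unfolding inner integral_mult_right_zero
      by (simp only: mittag_leffler_contour_integral(2)[OF c, of a b l, folded k_def, OF k b l])
    also have "\<dots> = of_real (mittag_leffler a b (- l))"
    proof -
      have "c / (2 * pi) * (2 * pi / c * t) = t" for t using c by simp
      thus ?thesis by (simp only: of_real_mult[symmetric])
    qed
    finally show ?thesis unfolding P_def .
  qed
  show thesis by (rule that[OF d(1) Wm sm spos sRe Wint rep])
qed

section \<open>Jensen's and Minkowski's inequalities for extended nonnegative functions\<close>

text \<open>Real powers of extended nonnegative numbers. The infinite value is kept, since the integrals to
  which powers are applied may diverge at some points.\<close>

definition epowr :: "ennreal \<Rightarrow> real \<Rightarrow> ennreal" where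
  "epowr x p = (if x = \<infinity> then \<infinity> else ennreal (enn2real x powr p))"

lemma epowr_ennreal [simp]: "0 \<le> x \<Longrightarrow> epowr (ennreal x) p = ennreal (x powr p)"
  by (simp add: epowr_def)

lemma epowr_top [simp]: "epowr \<infinity> p = \<infinity>" "epowr top p = \<infinity>"
  by (simp_all add: epowr_def)

lemma epowr_measurable [measurable]:
  assumes [measurable]: "f \<in> borel_measurable M"
  shows "(\<lambda>x. epowr (f x) p) \<in> borel_measurable M"
  unfolding epowr_def by measurable

lemma epowr_mono:
  assumes "x \<le> y" "0 \<le> p" shows "epowr x p \<le> epowr y p"
proof (cases y)
  case (real b)
  then obtain a where "x = ennreal a" "0 \<le> a" "a \<le> b"
    using assms by (cases x) (auto simp: top_unique)
  with real assms show ?thesis by (auto intro!: ennreal_leI powr_mono2)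
qed auto

lemma epowr_mult:
  assumes "0 \<le> c" "0 < p" shows "epowr (ennreal c * x) p = ennreal (c powr p) * epowr x p"
proof (cases x)
  case (real a)
  thus ?thesis using assms by (simp add: powr_mult flip: ennreal_mult)
next
  case top
  thus ?thesis using assms by (cases "c = 0") (auto simp: ennreal_mult_top epowr_def)
qed

lemma epowr_eq_ennrealD:
  assumes "epowr x p \<le> ennreal b" "0 < p" "0 \<le> b" shows "x \<le> ennreal (b powr (1 / p))"
proof (cases x)
  case (real a)
  hence "a powr p \<le> b" using assms by simp
  hence "(a powr p) powr (1 / p) \<le> b powr (1 / p)" using assms by (intro powr_mono2) auto
  thus ?thesis using real assms by (simp add: powr_powr)
qed (use assms in \<open>auto simp: top_unique\<close>)

text \<open>The graph of \<open>x powr p\<close> lies above its tangent at \<open>m\<close>; written in this way it is Young's inequality.\<close>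

lemma powr_tangent:
  fixes m x p :: real
  assumes "1 \<le> p" "0 \<le> m" "0 \<le> x"
  shows "m powr (p - 1) * x \<le> x powr p / p + (1 - 1 / p) * m powr p"
proof (cases "p = 1")
  case True
  thus ?thesis using assms by (cases "m = 0") auto
next
  case False
  define q where "q = p / (p - 1)"
  have p: "1 < p" using False assms by simp
  have q: "1 < q" "1 / p + 1 / q = 1" "1 / q = 1 - 1 / p" using p by (auto simp: q_def field_simps)
  have "(p - 1) * q = p" using p by (simp add: q_def)
  hence "(m powr (p - 1)) powr q = m powr p" by (simp add: powr_powr)
  moreover have "x * m powr (p - 1) \<le> x powr p / p + (m powr (p - 1)) powr q / q"
    by (rule Youngs_inequality) (use p q assms in auto)
  ultimately show ?thesis using q(3) by (simp add: mult.commute divide_inverse)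
qed

text \<open>Integrate the tangent inequality at the mean \<open>m\<close>.\<close>

lemma (in prob_space) jensen_epowr:
  assumes [measurable]: "h \<in> borel_measurable M" and p: "1 \<le> p"
  shows "epowr (\<integral>\<^sup>+x. h x \<partial>M) p \<le> (\<integral>\<^sup>+x. epowr (h x) p \<partial>M)"
proof (cases "(\<integral>\<^sup>+x. epowr (h x) p \<partial>M)")
  case (real R)
  \<comment> \<open>This makes the mean finite when the right-hand side is.\<close>
  have le1: "h x \<le> 1 + epowr (h x) p" for x
  proof (cases "h x")
    case (real a)
    have "a \<le> 1 + a powr p"
      using powr_mono[of 1 p a] p real by (cases "a \<le> 1") (auto intro: add_increasing2)
    thus ?thesis using real by (simp flip: ennreal_1 ennreal_plus)
  qed auto
  have "(\<integral>\<^sup>+x. h x \<partial>M) \<le> (\<integral>\<^sup>+x. 1 + epowr (h x) p \<partial>M)" by (intro nn_integral_mono le1)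
  also have "\<dots> = 1 + ennreal R" using real by (subst nn_integral_add) (auto simp: emeasure_space_1)
  finally have "(\<integral>\<^sup>+x. h x \<partial>M) < \<infinity>" by (simp add: le_less_trans)
  then obtain m where m: "(\<integral>\<^sup>+x. h x \<partial>M) = ennreal m" "0 \<le> m"
    by (cases "\<integral>\<^sup>+x. h x \<partial>M") auto
  have tangent: "ennreal (m powr (p - 1)) * h x \<le> ennreal (1 / p) * epowr (h x) p + ennreal ((1 - 1 / p) * m powr p)" for x
  proof (cases "h x")
    case (real a)
    have "0 \<le> (1 - 1 / p) * m powr p" using p by simp
    hence "ennreal (1 / p) * ennreal (a powr p) + ennreal ((1 - 1 / p) * m powr p) = ennreal (a powr p / p + (1 - 1 / p) * m powr p)"
      using p by (simp add: ennreal_mult[symmetric])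
    moreover have "ennreal (m powr (p - 1)) * ennreal a = ennreal (m powr (p - 1) * a)"
      using real by (simp add: ennreal_mult)
    ultimately show ?thesis using powr_tangent[OF p m(2) real(1)] real by (simp add: ennreal_leI)
  next
    case top
    thus ?thesis using p by (simp add: ennreal_mult_top)
  qed
  have "ennreal (m powr (p - 1) * m) = (\<integral>\<^sup>+x. ennreal (m powr (p - 1)) * h x \<partial>M)"
    using m by (simp add: nn_integral_cmult ennreal_mult)
  also have "\<dots> \<le> (\<integral>\<^sup>+x. ennreal (1 / p) * epowr (h x) p + ennreal ((1 - 1 / p) * m powr p) \<partial>M)"
    by (intro nn_integral_mono tangent)
  also have "\<dots> = ennreal (1 / p) * ennreal R + ennreal ((1 - 1 / p) * m powr p)"
    using real by (subst nn_integral_add) (auto simp: nn_integral_cmult emeasure_space_1)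
  also have "\<dots> = ennreal (R / p + (1 - 1 / p) * m powr p)"
  proof -
    have "0 \<le> (1 - 1 / p) * m powr p" using p by simp
    thus ?thesis using p real by (simp add: ennreal_mult[symmetric])
  qed
  finally have "m powr (p - 1) * m \<le> R / p + (1 - 1 / p) * m powr p"
    using p real by (subst (asm) ennreal_le_iff) auto
  moreover have "m powr (p - 1) * m = m powr p"
    using m(2) p powr_add[of m "p - 1" 1] by (cases "m = 0") auto
  ultimately have "m powr p / p \<le> R / p" by (simp add: algebra_simps)
  hence "m powr p \<le> R" using p by (simp add: divide_le_cancel)
  thus ?thesis using m real by simp
qed simp

text \<open>Unlike \<^const>\<open>Lq_norm\<close>, this bound of the \<open>L\<^sup>q\<close>-norm is meaningful for every measurable function,
  so it serves for majorants before they are known to be finite almost everywhere.\<close>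

definition Lq_le :: "ereal \<Rightarrow> ('a::euclidean_space \<Rightarrow> ennreal) \<Rightarrow> real \<Rightarrow> bool" where
  "Lq_le q F B \<longleftrightarrow> (if q = \<infinity> then AE x in lborel. F x \<le> ennreal B
     else (\<integral>\<^sup>+x. epowr (F x) (real_of_ereal q) \<partial>lborel) \<le> ennreal (B powr real_of_ereal q))"

lemma real_of_ereal_ge_1: "1 \<le> q \<Longrightarrow> q \<noteq> \<infinity> \<Longrightarrow> 1 \<le> real_of_ereal q"
  by (cases q) auto

lemma Lq_le_mono:
  assumes "Lq_le q G B" "\<And>x. F x \<le> G x" "1 \<le> q" "B \<le> C" "0 \<le> B"
  shows "Lq_le q F C"
proof (cases "q = \<infinity>")
  case True
  have "AE x in lborel. G x \<le> ennreal B" using assms(1) True by (simp add: Lq_le_def)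
  hence "AE x in lborel. F x \<le> ennreal C"
    by eventually_elim (use assms in \<open>meson ennreal_leI order_trans\<close>)
  thus ?thesis using True by (simp add: Lq_le_def)
next
  case False
  note p = real_of_ereal_ge_1[OF assms(3) False]
  have "(\<integral>\<^sup>+x. epowr (F x) (real_of_ereal q) \<partial>lborel) \<le> (\<integral>\<^sup>+x. epowr (G x) (real_of_ereal q) \<partial>lborel)"
    using assms(2) p by (intro nn_integral_mono epowr_mono) auto
  also have "\<dots> \<le> ennreal (B powr real_of_ereal q)" using assms(1) False by (simp add: Lq_le_def)
  also have "\<dots> \<le> ennreal (C powr real_of_ereal q)" using assms p by (intro ennreal_leI powr_mono2) auto
  finally show ?thesis using False by (simp add: Lq_le_def)
qed

lemma Lq_le_cmult:
  assumes "Lq_le q F B" "1 \<le> q" "0 \<le> c" "0 \<le> B" and [measurable]: "F \<in> borel_measurable borel"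
  shows "Lq_le q (\<lambda>x. ennreal c * F x) (c * B)"
proof (cases "q = \<infinity>")
  case True
  have "AE x in lborel. F x \<le> ennreal B" using assms(1) True by (simp add: Lq_le_def)
  hence "AE x in lborel. ennreal c * F x \<le> ennreal (c * B)"
    by eventually_elim (use assms in \<open>simp add: ennreal_mult mult_left_mono\<close>)
  thus ?thesis using True by (simp add: Lq_le_def)
next
  case False
  note p = real_of_ereal_ge_1[OF assms(2) False]
  have "(\<integral>\<^sup>+x. epowr (ennreal c * F x) (real_of_ereal q) \<partial>lborel)
     = ennreal (c powr real_of_ereal q) * (\<integral>\<^sup>+x. epowr (F x) (real_of_ereal q) \<partial>lborel)"
    using p assms by (subst epowr_mult) (auto simp: nn_integral_cmult)
  also have "\<dots> \<le> ennreal (c powr real_of_ereal q) * ennreal (B powr real_of_ereal q)"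
    using assms(1) False by (intro mult_left_mono) (auto simp: Lq_le_def)
  also have "\<dots> = ennreal ((c * B) powr real_of_ereal q)" using assms by (simp add: powr_mult flip: ennreal_mult)
  finally show ?thesis using False by (simp add: Lq_le_def)
qed

text \<open>Minkowski's integral inequality, first for a strictly positive bound \<open>b\<close>: normalising
  \<open>b\<close> to a probability density turns it into Jensen's inequality.\<close>

lemma minkowski_positive:
  fixes F :: "'m \<Rightarrow> 'a::euclidean_space \<Rightarrow> ennreal"
  assumes "sigma_finite_measure M"
    and [measurable]: "(\<lambda>(m, x). F m x) \<in> borel_measurable (M \<Otimes>\<^sub>M lborel)" "b \<in> borel_measurable M"
    and b: "\<And>m. m \<in> space M \<Longrightarrow> 0 < b m" and beta: "(\<integral>\<^sup>+m. ennreal (b m) \<partial>M) = ennreal \<beta>" "0 \<le> \<beta>"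
    and p: "1 \<le> p" and F: "AE m in M. (\<integral>\<^sup>+x. epowr (F m x) p \<partial>lborel) \<le> ennreal (b m powr p)"
  shows "(\<integral>\<^sup>+x. epowr (\<integral>\<^sup>+m. F m x \<partial>M) p \<partial>lborel) \<le> ennreal (\<beta> powr p)"
proof (cases "\<beta> = 0")
  case True
  have "(\<integral>\<^sup>+m. ennreal (b m) \<partial>M) = 0" using beta True by simp
  hence "AE m in M. ennreal (b m) = 0" by (subst (asm) nn_integral_0_iff_AE) measurable
  hence "AE m in M. False"
    using AE_space by eventually_elim (use b in \<open>force simp: ennreal_eq_0_iff\<close>)
  hence "AE m in M. F m x = 0" for x by eventually_elim simp
  hence "(\<integral>\<^sup>+m. F m x \<partial>M) = 0" for x
    using nn_integral_cong_AE[of "\<lambda>m. F m x" "\<lambda>_. 0" M] by simp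
  thus ?thesis using True by (simp add: epowr_def)
next
  case False
  interpret M: sigma_finite_measure M by fact
  interpret pair_sigma_finite M lborel ..
  have be: "0 < \<beta>" using False beta by simp
  define N where "N = density M (\<lambda>m. ennreal (b m / \<beta>))"
  interpret N: prob_space N
  proof
    have "emeasure N (space N) = (\<integral>\<^sup>+m. ennreal (inverse \<beta>) * ennreal (b m) \<partial>M)"
      unfolding N_def using be b by (subst emeasure_density) (auto intro!: nn_integral_cong simp: divide_inverse mult.commute ennreal_mult less_imp_le)
    also have "\<dots> = 1" using be beta by (simp add: nn_integral_cmult flip: ennreal_mult)
    finally show "emeasure N (space N) = 1" .
  qed
  have Nint: "(\<integral>\<^sup>+m. g m \<partial>N) = (\<integral>\<^sup>+m. ennreal (b m / \<beta>) * g m \<partial>M)" if "g \<in> borel_measurable M" for g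
    unfolding N_def using that by (subst nn_integral_density) auto
  have "(\<integral>\<^sup>+x. epowr (\<integral>\<^sup>+m. F m x \<partial>M) p \<partial>lborel) \<le> (\<integral>\<^sup>+x. (\<integral>\<^sup>+m. ennreal (b m powr (1 - p) * \<beta> powr (p - 1)) * epowr (F m x) p \<partial>M) \<partial>lborel)"
  proof (intro nn_integral_mono)
    fix x :: 'a
    have "(\<integral>\<^sup>+m. F m x \<partial>M) = (\<integral>\<^sup>+m. ennreal (b m / \<beta>) * (ennreal (\<beta> / b m) * F m x) \<partial>M)"
    proof (rule nn_integral_cong)
      fix m assume "m \<in> space M"
      hence "ennreal (b m / \<beta>) * ennreal (\<beta> / b m) = 1" using b[of m] be by (simp flip: ennreal_mult)
      thus "F m x = ennreal (b m / \<beta>) * (ennreal (\<beta> / b m) * F m x)" by (simp flip: mult.assoc)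
    qed
    also have "\<dots> = (\<integral>\<^sup>+m. ennreal (\<beta> / b m) * F m x \<partial>N)" by (rule Nint[symmetric]) measurable
    finally have "epowr (\<integral>\<^sup>+m. F m x \<partial>M) p \<le> (\<integral>\<^sup>+m. epowr (ennreal (\<beta> / b m) * F m x) p \<partial>N)"
      using N.jensen_epowr[of "\<lambda>m. ennreal (\<beta> / b m) * F m x" p] p unfolding N_def by simp
    also have "\<dots> = (\<integral>\<^sup>+m. ennreal (b m / \<beta>) * epowr (ennreal (\<beta> / b m) * F m x) p \<partial>M)"
      by (rule Nint) measurable
    also have "\<dots> = (\<integral>\<^sup>+m. ennreal (b m powr (1 - p) * \<beta> powr (p - 1)) * epowr (F m x) p \<partial>M)"
    proof (rule nn_integral_cong)
      fix m assume m: "m \<in> space M"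
      have "b m / \<beta> * (\<beta> / b m) powr p = b m powr (1 - p) * \<beta> powr (p - 1)"
        using b[OF m] be by (simp add: powr_divide powr_diff)
      thus "ennreal (b m / \<beta>) * epowr (ennreal (\<beta> / b m) * F m x) p = ennreal (b m powr (1 - p) * \<beta> powr (p - 1)) * epowr (F m x) p"
        using b[OF m] be p by (subst epowr_mult) (auto simp flip: mult.assoc ennreal_mult)
    qed
    finally show "epowr (\<integral>\<^sup>+m. F m x \<partial>M) p \<le> (\<integral>\<^sup>+m. ennreal (b m powr (1 - p) * \<beta> powr (p - 1)) * epowr (F m x) p \<partial>M)" .
  qed
  also have "\<dots> = (\<integral>\<^sup>+m. (\<integral>\<^sup>+x. ennreal (b m powr (1 - p) * \<beta> powr (p - 1)) * epowr (F m x) p \<partial>lborel) \<partial>M)"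
    by (rule Fubini') measurable
  also have "\<dots> = (\<integral>\<^sup>+m. ennreal (b m powr (1 - p) * \<beta> powr (p - 1)) * (\<integral>\<^sup>+x. epowr (F m x) p \<partial>lborel) \<partial>M)"
    by (intro nn_integral_cong nn_integral_cmult) measurable
  also have "\<dots> \<le> (\<integral>\<^sup>+m. ennreal (\<beta> powr (p - 1)) * ennreal (b m) \<partial>M)"
  proof (rule nn_integral_mono_AE)
    from F AE_space show "AE m in M. ennreal (b m powr (1 - p) * \<beta> powr (p - 1)) * (\<integral>\<^sup>+x. epowr (F m x) p \<partial>lborel) \<le> ennreal (\<beta> powr (p - 1)) * ennreal (b m)"
    proof eventually_elim
      case (elim m)
      have "ennreal (b m powr (1 - p) * \<beta> powr (p - 1)) * (\<integral>\<^sup>+x. epowr (F m x) p \<partial>lborel) \<le> ennreal (b m powr (1 - p) * \<beta> powr (p - 1)) * ennreal (b m powr p)"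
        using elim by (intro mult_left_mono) auto
      also have "\<dots> = ennreal (\<beta> powr (p - 1) * (b m powr (1 - p) * b m powr p))"
        by (simp add: mult_ac flip: ennreal_mult)
      also have "b m powr (1 - p) * b m powr p = b m" using b[OF elim(2)] by (simp flip: powr_add)
      finally show ?case using b[OF elim(2)] by (simp add: ennreal_mult)
    qed
  qed
  also have "\<dots> = ennreal (\<beta> powr (p - 1) * \<beta>)" using beta by (simp add: nn_integral_cmult ennreal_mult)
  also have "\<beta> powr (p - 1) * \<beta> = \<beta> powr p" using be by (simp add: powr_diff)
  finally show ?thesis .
qed

text \<open>Minkowski's integral inequality. For finite \<open>q\<close>, adding a small multiple of a strictly positive
integrable function to the bound reduces it to the previous lemma; for \<open>q = \<infinity>\<close> it is Fubini's theorem for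
null sets.\<close>

lemma Lq_le_integral:
  fixes F :: "'m \<Rightarrow> 'a::euclidean_space \<Rightarrow> ennreal"
  assumes "sigma_finite_measure M" and q: "1 \<le> q"
    and Fm[measurable]: "(\<lambda>(m, x). F m x) \<in> borel_measurable (M \<Otimes>\<^sub>M lborel)"
    and bm[measurable]: "b \<in> borel_measurable M"
    and b: "\<And>m. m \<in> space M \<Longrightarrow> 0 \<le> b m" and B: "(\<integral>\<^sup>+m. ennreal (b m) \<partial>M) \<le> ennreal B" "0 \<le> B"
    and F: "AE m in M. Lq_le q (F m) (b m)"
  shows "Lq_le q (\<lambda>x. \<integral>\<^sup>+m. F m x \<partial>M) B"
proof -
  interpret M: sigma_finite_measure M by fact
  interpret pair_sigma_finite M lborel ..
  show ?thesis
  proof (cases "q = \<infinity>")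
    case True
    have "AE m in M. AE x in lborel. F m x \<le> ennreal (b m)" using F True by (simp add: Lq_le_def)
    moreover have "{y \<in> space (M \<Otimes>\<^sub>M lborel). F (fst y) (snd y) \<le> ennreal (b (fst y))} \<in> sets (M \<Otimes>\<^sub>M lborel)"
    proof -
      have [measurable]: "(\<lambda>y. F (fst y) (snd y)) \<in> borel_measurable (M \<Otimes>\<^sub>M lborel)"
        using Fm by (simp add: case_prod_unfold)
      show ?thesis by measurable
    qed
    ultimately have "AE x in lborel. AE m in M. F m x \<le> ennreal (b m)"
      using AE_commute[of "\<lambda>m x. F m x \<le> ennreal (b m)"] by simp
    hence "AE x in lborel. (\<integral>\<^sup>+m. F m x \<partial>M) \<le> ennreal B"
    proof eventually_elim
      case (elim x)
      have "(\<integral>\<^sup>+m. F m x \<partial>M) \<le> (\<integral>\<^sup>+m. ennreal (b m) \<partial>M)" by (rule nn_integral_mono_AE[OF elim])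
      thus ?case using B(1) by (rule order_trans)
    qed
    thus ?thesis using True by (simp add: Lq_le_def)
  next
    case False
    define p where "p = real_of_ereal q"
    have p: "1 \<le> p" unfolding p_def by (rule real_of_ereal_ge_1[OF q False])
    obtain w0 where w0[measurable]: "w0 \<in> borel_measurable M" "integral\<^sup>N M w0 \<noteq> \<infinity>" "\<And>x. x \<in> space M \<Longrightarrow> 0 < w0 x \<and> w0 x < \<infinity>"
      using M.Ex_finite_integrable_function by blast
    define w where "w = (\<lambda>m. enn2real (w0 m))"
    obtain I where I: "integral\<^sup>N M w0 = ennreal I" "0 \<le> I" using w0(2) by (cases "integral\<^sup>N M w0") auto
    have w: "w m > 0" "ennreal (w m) = w0 m" if "m \<in> space M" for m
      using w0(3)[OF that] by (auto simp: w_def enn2real_positive_iff)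
    have [measurable]: "w \<in> borel_measurable M" unfolding w_def by measurable
    have wI: "(\<integral>\<^sup>+m. ennreal (w m) \<partial>M) = ennreal I" using w I by (simp cong: nn_integral_cong)
    have F': "AE m in M. (\<integral>\<^sup>+x. epowr (F m x) p \<partial>lborel) \<le> ennreal (b m powr p)"
      using F False by (simp add: Lq_le_def p_def)
    \<comment> \<open>The claim follows for \<open>e\<close> tending to \<open>0\<close>.\<close>
    have step: "(\<integral>\<^sup>+x. epowr (\<integral>\<^sup>+m. F m x \<partial>M) p \<partial>lborel) \<le> ennreal ((B + e * I) powr p)" if e: "e > 0" for e
    proof -
      have le: "(\<integral>\<^sup>+m. ennreal (b m + e * w m) \<partial>M) \<le> ennreal (B + e * I)"
      proof -
        have "(\<integral>\<^sup>+m. ennreal (b m + e * w m) \<partial>M) = (\<integral>\<^sup>+m. ennreal (b m) + ennreal e * ennreal (w m) \<partial>M)"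
          using b w e by (intro nn_integral_cong) (auto simp: ennreal_mult less_imp_le)
        also have "\<dots> = (\<integral>\<^sup>+m. ennreal (b m) \<partial>M) + ennreal e * ennreal I"
          using wI by (simp add: nn_integral_add nn_integral_cmult)
        also have "\<dots> \<le> ennreal B + ennreal e * ennreal I" using B by (intro add_mono) auto
        finally show ?thesis using e I B by (simp add: ennreal_mult)
      qed
      then obtain \<beta> where \<beta>: "(\<integral>\<^sup>+m. ennreal (b m + e * w m) \<partial>M) = ennreal \<beta>" "0 \<le> \<beta>"
        by (cases "\<integral>\<^sup>+m. ennreal (b m + e * w m) \<partial>M") (auto simp: top_unique)
      have "\<beta> \<le> B + e * I"
        using le[unfolded \<beta>(1)] B I e by (subst (asm) ennreal_le_iff) auto
      have "(\<integral>\<^sup>+x. epowr (\<integral>\<^sup>+m. F m x \<partial>M) p \<partial>lborel) \<le> ennreal (\<beta> powr p)"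
      proof (rule minkowski_positive[OF assms(1) Fm _ _ \<beta> p])
        show "0 < b m + e * w m" if "m \<in> space M" for m using b[OF that] w[OF that] e by (simp add: add_nonneg_pos)
        from F' AE_space show "AE m in M. (\<integral>\<^sup>+x. epowr (F m x) p \<partial>lborel) \<le> ennreal ((b m + e * w m) powr p)"
        proof eventually_elim
          case (elim m)
          have "b m powr p \<le> (b m + e * w m) powr p"
            using b[OF elim(2)] w[OF elim(2)] e p by (intro powr_mono2) auto
          thus ?case using elim(1) by (meson ennreal_leI order_trans)
        qed
      qed measurable
      also have "\<dots> \<le> ennreal ((B + e * I) powr p)"
        using \<open>\<beta> \<le> B + e * I\<close> \<beta> p by (intro ennreal_leI powr_mono2) auto
      finally show ?thesis .
    qed
    have "((\<lambda>e. ennreal ((B + e * I) powr p)) \<longlongrightarrow> ennreal ((B + 0 * I) powr p)) (at_right 0)"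
      using p B by (intro tendsto_ennrealI tendsto_powr' tendsto_intros) (auto simp: eventually_at_filter intro!: eventuallyI add_nonneg_nonneg mult_nonneg_nonneg I)
    hence "(\<integral>\<^sup>+x. epowr (\<integral>\<^sup>+m. F m x \<partial>M) p \<partial>lborel) \<le> ennreal ((B + 0 * I) powr p)"
      by (rule tendsto_lowerbound) (use step in \<open>auto simp: eventually_at_filter\<close>)
    thus ?thesis using False by (simp add: Lq_le_def p_def)
  qed
qed

text \<open>A sum is an integral over a two-point space.\<close>

lemma Lq_le_add:
  assumes q: "1 \<le> q" and F: "Lq_le q F A" and G: "Lq_le q G B" and nn: "0 \<le> A" "0 \<le> B"
    and [measurable]: "F \<in> borel_measurable borel" "G \<in> borel_measurable borel"
  shows "Lq_le q (\<lambda>x. F x + G x) (A + B)"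
proof -
  define H where "H = (\<lambda>i::bool. if i then F else G)"
  define b where "b = (\<lambda>i::bool. if i then A else B)"
  have U: "(UNIV::bool set) = {True, False}" by auto
  have "Lq_le q (\<lambda>x. \<integral>\<^sup>+i. H i x \<partial>count_space UNIV) (A + B)"
  proof (rule Lq_le_integral[where b=b])
    show "sigma_finite_measure (count_space (UNIV::bool set))" by (rule sigma_finite_measure_count_space)
    show "(\<lambda>(m, x). H m x) \<in> borel_measurable (count_space UNIV \<Otimes>\<^sub>M lborel)"
      by (rule measurable_pair_measure_countable1) (auto simp: H_def)
    show "(\<integral>\<^sup>+m. ennreal (b m) \<partial>count_space UNIV) \<le> ennreal (A + B)"
      using nn by (simp add: nn_integral_count_space_finite U b_def)
  qed (use q F G nn in \<open>auto simp: AE_count_space H_def b_def\<close>)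
  thus ?thesis by (simp add: nn_integral_count_space_finite U H_def)
qed

section \<open>Smoothing by the heat kernel\<close>

lemma real_of_ereal_inverse: "1 \<le> q \<Longrightarrow> q \<noteq> \<infinity> \<Longrightarrow> real_of_ereal (1 / q) = 1 / real_of_ereal q"
  by (cases q) (auto simp: one_ereal_def)

definition heat_kernel :: "real \<Rightarrow> 'a::euclidean_space \<Rightarrow> real" where
  "heat_kernel \<tau> z = exp (- (norm z)\<^sup>2 / (4 * \<tau>)) / sqrt (4 * pi * \<tau>) ^ DIM('a)"

lemma heat_kernel_measurable [measurable]:
  "(\<lambda>(\<tau>, z). heat_kernel \<tau> (z::'a::euclidean_space)) \<in> borel_measurable (borel \<Otimes>\<^sub>M borel)"
  unfolding heat_kernel_def by measurable

lemma heat_kernel_nonneg: "0 \<le> \<tau> \<Longrightarrow> 0 \<le> heat_kernel \<tau> z"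
  by (simp add: heat_kernel_def)

lemma heat_kernel_minus: "heat_kernel \<tau> (x - y) = heat_kernel \<tau> (y - x)"
  by (simp add: heat_kernel_def norm_minus_commute)

lemma heat_kernel_le:
  assumes "0 < \<tau>" shows "heat_kernel \<tau> (z::'a::euclidean_space) \<le> (4 * pi * \<tau>) powr (- (real DIM('a) / 2))"
proof -
  have e: "sqrt (4 * pi * \<tau>) ^ DIM('a) = (4 * pi * \<tau>) powr (real DIM('a) / 2)"
    using assms by (simp add: powr_half_sqrt[symmetric] powr_realpow[symmetric] powr_powr)
  have "exp (- (norm z)\<^sup>2 / (4 * \<tau>)) * inverse (sqrt (4 * pi * \<tau>) ^ DIM('a)) \<le> 1 * inverse (sqrt (4 * pi * \<tau>) ^ DIM('a))"
    using assms by (intro mult_right_mono) auto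
  thus ?thesis unfolding heat_kernel_def powr_minus e divide_inverse by simp
qed

lemma heat_kernel_prod_normal:
  assumes "0 < \<tau>"
  shows "heat_kernel \<tau> (x - y :: 'a::euclidean_space) = (\<Prod>b\<in>Basis. normal_density (y \<bullet> b) (sqrt (2 * \<tau>)) (x \<bullet> b))"
proof -
  have "(norm (x - y))\<^sup>2 = (\<Sum>b\<in>Basis. (x \<bullet> b - y \<bullet> b)\<^sup>2)"
    unfolding power2_norm_eq_inner by (subst euclidean_inner) (simp add: inner_diff_left power2_eq_square)
  hence "exp (- (norm (x - y))\<^sup>2 / (4 * \<tau>)) = (\<Prod>b\<in>Basis. exp (- (x \<bullet> b - y \<bullet> b)\<^sup>2 / (4 * \<tau>)))"
    by (simp add: exp_sum[symmetric] sum_negf sum_divide_distrib)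
  thus ?thesis using assms unfolding heat_kernel_def normal_density_def
    by (simp add: prod_dividef mult.assoc)
qed

lemma nn_integral_heat_kernel:
  assumes "0 < \<tau>"
  shows "(\<integral>\<^sup>+x. ennreal (heat_kernel \<tau> (x - y :: 'a::euclidean_space)) \<partial>lborel) = 1"
    and "(\<integral>\<^sup>+x. ennreal (heat_kernel \<tau> (y - x :: 'a::euclidean_space)) \<partial>lborel) = 1"
proof -
  have "(\<integral>\<^sup>+x. ennreal (heat_kernel \<tau> (x - y :: 'a)) \<partial>lborel)
     = (\<integral>\<^sup>+x. (\<Prod>b\<in>Basis. ennreal (normal_density (y \<bullet> b) (sqrt (2 * \<tau>)) (x \<bullet> b))) \<partial>lborel)"
    using assms by (simp add: heat_kernel_prod_normal prod_ennreal)
  also have "\<dots> = (\<Prod>b\<in>(Basis::'a set). (\<integral>\<^sup>+t. ennreal (normal_density (y \<bullet> b) (sqrt (2 * \<tau>)) t) \<partial>lborel))"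
    by (rule nn_integral_lborel_prod) auto
  also have "\<dots> = 1"
    using assms by (simp add: nn_integral_eq_integral integrable_normal_density integral_normal_density)
  finally show "(\<integral>\<^sup>+x. ennreal (heat_kernel \<tau> (x - y :: 'a::euclidean_space)) \<partial>lborel) = 1" .
  thus "(\<integral>\<^sup>+x. ennreal (heat_kernel \<tau> (y - x :: 'a::euclidean_space)) \<partial>lborel) = 1"
    by (simp add: heat_kernel_minus)
qed

text \<open>The \<open>L\<^sup>r\<close>-\<open>L\<^sup>q\<close> smoothing estimate of the heat semigroup. Jensen's inequality for the
  probability density \<^term>\<open>heat_kernel\<close> gives both the supremum bound (with the height of the
  kernel) and the \<open>L\<^sup>r\<close> bound; splitting off \<open>q - r\<close> powers of the supremum interpolates.\<close>

lemma heat_smoothing: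
  fixes F :: "'a::euclidean_space \<Rightarrow> ennreal"
  assumes [measurable]: "F \<in> borel_measurable borel" and \<tau>: "0 < \<tau>"
    and rq: "1 \<le> r" "r \<le> q" and F: "Lq_le r F B" and B: "0 \<le> B"
  shows "Lq_le q (\<lambda>x. \<integral>\<^sup>+y. ennreal (heat_kernel \<tau> (x - y)) * F y \<partial>lborel)
     ((4 * pi * \<tau>) powr (- (real DIM('a) / 2 * (real_of_ereal (1 / r) - real_of_ereal (1 / q)))) * B)"
proof (cases "r = \<infinity>")
  case True
  hence q: "q = \<infinity>" using rq by simp
  have "(\<integral>\<^sup>+y. ennreal (heat_kernel \<tau> (x - y)) * F y \<partial>lborel) \<le> ennreal B" for x
  proof -
    have "AE y in lborel. F y \<le> ennreal B" using F True by (simp add: Lq_le_def)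
    from this have "(\<integral>\<^sup>+y. ennreal (heat_kernel \<tau> (x - y)) * F y \<partial>lborel) \<le> (\<integral>\<^sup>+y. ennreal (heat_kernel \<tau> (x - y)) * ennreal B \<partial>lborel)"
    proof (rule nn_integral_mono_AE[OF eventually_mono])
      show "ennreal (heat_kernel \<tau> (x - y)) * F y \<le> ennreal (heat_kernel \<tau> (x - y)) * ennreal B" if "F y \<le> ennreal B" for y
        using that by (rule mult_left_mono) simp
    qed
    also have "\<dots> = ennreal B" by (simp add: nn_integral_multc nn_integral_heat_kernel[OF \<tau>])
    finally show ?thesis .
  qed
  thus ?thesis using q True \<tau> by (simp add: Lq_le_def)
next
  case False
  define p where "p = real_of_ereal r"
  define n where "n = real DIM('a)"
  have p: "1 \<le> p" unfolding p_def by (rule real_of_ereal_ge_1[OF rq(1) False])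
  have rp: "real_of_ereal (1 / r) = 1 / p" unfolding p_def by (rule real_of_ereal_inverse[OF rq(1) False])
  define H where "H = (4 * pi * \<tau>) powr (- (n / 2))"
  define P where "P = (\<lambda>G x. \<integral>\<^sup>+y. ennreal (heat_kernel \<tau> (x - y)) * G y \<partial>(lborel::'a measure))"
  have H: "H > 0" using \<tau> by (simp add: H_def)
  have Fp: "(\<integral>\<^sup>+x. epowr (F x) p \<partial>lborel) \<le> ennreal (B powr p)"
    using F False by (simp add: Lq_le_def p_def)
  have jensen: "epowr (P F x) p \<le> P (\<lambda>y. epowr (F y) p) x" for x
  proof -
    interpret N: prob_space "density lborel (\<lambda>y. ennreal (heat_kernel \<tau> (x - y)))"
      by (rule prob_spaceI) (simp add: emeasure_density nn_integral_heat_kernel[OF \<tau>])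
    show ?thesis using N.jensen_epowr[of F p] p unfolding P_def by (simp add: nn_integral_density)
  qed
  have sup: "P F x \<le> ennreal (H powr (1 / p) * B)" for x
  proof -
    have "P (\<lambda>y. epowr (F y) p) x \<le> (\<integral>\<^sup>+y. ennreal H * epowr (F y) p \<partial>lborel)"
      unfolding P_def H_def n_def using heat_kernel_le[OF \<tau>] by (intro nn_integral_mono mult_right_mono ennreal_leI) auto
    also have "\<dots> = ennreal H * (\<integral>\<^sup>+y. epowr (F y) p \<partial>lborel)" by (simp add: nn_integral_cmult)
    also have "\<dots> \<le> ennreal H * ennreal (B powr p)" by (intro mult_left_mono Fp) auto
    finally have "epowr (P F x) p \<le> ennreal (H * B powr p)"
      using jensen[of x] H by (simp add: ennreal_mult)
    hence "P F x \<le> ennreal ((H * B powr p) powr (1 / p))" by (rule epowr_eq_ennrealD) (use p H in auto)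
    thus ?thesis using p H B by (simp add: powr_mult powr_powr)
  qed
  show ?thesis
  proof (cases "q = \<infinity>")
    case True
    have "H powr (1 / p) = (4 * pi * \<tau>) powr (- (n / 2 * (1 / p - 0)))" by (simp add: H_def powr_powr)
    thus ?thesis using sup True rp unfolding Lq_le_def P_def n_def by simp
  next
    case qf: False
    define s where "s = real_of_ereal q"
    have q1: "1 \<le> q" using rq by simp
    have ps: "p \<le> s" using rq False qf unfolding p_def s_def by (cases r; cases q) auto
    have qs: "real_of_ereal (1 / q) = 1 / s" unfolding s_def by (rule real_of_ereal_inverse[OF q1 qf])
    define S where "S = H powr (1 / p) * B"
    have S: "S \<ge> 0" using B by (simp add: S_def)
    have pt: "epowr (P F x) s \<le> ennreal (S powr (s - p)) * P (\<lambda>y. epowr (F y) p) x" for x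
    proof -
      obtain a where a: "P F x = ennreal a" "0 \<le> a" "a \<le> S"
        using sup[of x] S unfolding S_def[symmetric] by (cases "P F x") (auto simp: top_unique)
      have "a powr s = a powr (s - p) * a powr p" by (simp flip: powr_add)
      also have "\<dots> \<le> S powr (s - p) * a powr p" using a ps by (intro mult_right_mono powr_mono2) auto
      finally have "epowr (P F x) s \<le> ennreal (S powr (s - p)) * epowr (P F x) p"
        using a by (simp add: ennreal_leI flip: ennreal_mult)
      also have "\<dots> \<le> ennreal (S powr (s - p)) * P (\<lambda>y. epowr (F y) p) x"
        by (intro mult_left_mono jensen) auto
      finally show ?thesis .
    qed
    have "(\<integral>\<^sup>+x. P (\<lambda>y. epowr (F y) p) x \<partial>lborel) = (\<integral>\<^sup>+y. (\<integral>\<^sup>+x. ennreal (heat_kernel \<tau> (x - y)) * epowr (F y) p \<partial>lborel) \<partial>lborel)"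
      unfolding P_def by (rule lborel_pair.Fubini') measurable
    also have "\<dots> = (\<integral>\<^sup>+y. epowr (F y) p \<partial>lborel)"
      by (simp add: nn_integral_multc nn_integral_heat_kernel[OF \<tau>])
    finally have mass: "(\<integral>\<^sup>+x. P (\<lambda>y. epowr (F y) p) x \<partial>lborel) = (\<integral>\<^sup>+y. epowr (F y) p \<partial>lborel)" .
    have [measurable]: "P (\<lambda>y. epowr (F y) p) \<in> borel_measurable borel" unfolding P_def by measurable
    have "(\<integral>\<^sup>+x. epowr (P F x) s \<partial>lborel) \<le> (\<integral>\<^sup>+x. ennreal (S powr (s - p)) * P (\<lambda>y. epowr (F y) p) x \<partial>lborel)"
      by (intro nn_integral_mono pt)
    also have "\<dots> = ennreal (S powr (s - p)) * (\<integral>\<^sup>+y. epowr (F y) p \<partial>lborel)"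
      by (simp add: nn_integral_cmult mass)
    also have "\<dots> \<le> ennreal (S powr (s - p)) * ennreal (B powr p)" by (intro mult_left_mono Fp) auto
    also have "\<dots> = ennreal (((4 * pi * \<tau>) powr (- (n / 2 * (1 / p - 1 / s))) * B) powr s)"
    proof -
      have "S powr (s - p) * B powr p = H powr (1 / p * (s - p)) * (B powr (s - p) * B powr p)"
        using B H by (simp add: S_def powr_mult powr_powr mult_ac)
      also have "B powr (s - p) * B powr p = B powr s" by (simp flip: powr_add)
      also have "H powr (1 / p * (s - p)) = (4 * pi * \<tau>) powr (- (n / 2 * (1 / p - 1 / s)) * s)"
      proof -
        have "- (n / 2) * (1 / p * (s - p)) = - (n / 2 * (1 / p - 1 / s)) * s"
          using p ps by (simp add: field_simps)
        thus ?thesis by (simp only: H_def powr_powr)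
      qed
      finally show ?thesis using B by (simp add: powr_mult powr_powr flip: ennreal_mult)
    qed
    finally show ?thesis using qf rp qs unfolding Lq_le_def P_def n_def s_def by simp
  qed
qed

text \<open>Lebesgue measurable data are replaced by Borel functions throughout, because joint measurability on
product spaces is only available for these.\<close>

lemma completion_ex_borel_measurable_complex:
  fixes g :: "'a \<Rightarrow> complex"
  assumes g: "g \<in> borel_measurable (completion M)"
  shows "\<exists>g'\<in>borel_measurable M. AE x in M. g x = g' x"
proof -
  have "(\<lambda>x. Re (g x)) \<in> borel_measurable (completion M)" "(\<lambda>x. Im (g x)) \<in> borel_measurable (completion M)"
    using g by auto
  from this[THEN completion_ex_borel_measurable_real] obtain a b where
    ab[measurable]: "a \<in> borel_measurable M" "b \<in> borel_measurable M"
    and ae: "AE x in M. Re (g x) = a x" "AE x in M. Im (g x) = b x" by blast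
  have "AE x in M. g x = Complex (a x) (b x)" using ae by eventually_elim (simp add: complex_eq_iff)
  moreover have "(\<lambda>x. Complex (a x) (b x)) \<in> borel_measurable M"
    unfolding Complex_eq by measurable
  ultimately show ?thesis by (intro bexI[of _ "\<lambda>x. Complex (a x) (b x)"])
qed

lemma esssup_norm_nonneg:
  fixes f :: "'a::euclidean_space \<Rightarrow> complex"
  shows "0 \<le> esssup lebesgue (\<lambda>x. ereal (norm (f x)))"
proof -
  have "0 = esssup (lebesgue :: 'a measure) (\<lambda>x. 0::ereal)"
    by (rule esssup_const[symmetric]) (simp add: emeasure_lborel_UNIV)
  also have "\<dots> \<le> esssup lebesgue (\<lambda>x. ereal (norm (f x)))" by (rule esssup_mono) auto
  finally show ?thesis .
qed

lemma Lq_norm_nonneg: "0 \<le> Lq_norm q f"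
  using esssup_norm_nonneg[of f] by (auto simp: Lq_norm_def real_of_ereal_pos)

text \<open>The finiteness of the norm is used here: for \<open>q = \<infinity>\<close> the essential supremum is a real number.\<close>

lemma Lq_imp_Lq_le:
  fixes f :: "'a::euclidean_space \<Rightarrow> complex"
  assumes f: "f \<in> Lq q" and q: "1 \<le> q" and g: "g \<in> borel_measurable borel" "AE x in lborel. f x = g x"
  shows "Lq_le q (\<lambda>x. ennreal (norm (g x))) (Lq_norm q f)"
proof (cases "q = \<infinity>")
  case True
  define e where "e = esssup lebesgue (\<lambda>x. ereal (norm (f x)))"
  from f have fm: "f \<in> borel_measurable lebesgue" by (simp add: Lq_def)
  from f True obtain c where "AE x in lebesgue. norm (f x) \<le> c" by (auto simp: Lq_def)
  hence le: "e \<le> ereal c" unfolding e_def using fm by (intro esssup_I) auto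
  have ae: "AE x in lebesgue. ereal (norm (f x)) \<le> e" unfolding e_def by (rule esssup_AE)
  have "0 \<le> e" unfolding e_def by (rule esssup_norm_nonneg)
  then obtain r where r: "e = ereal r" using le by (cases e) auto
  have "AE x in lborel. ereal (norm (f x)) \<le> e" using ae by (simp add: AE_completion_iff)
  with g(2) have "AE x in lborel. ennreal (norm (g x)) \<le> ennreal (Lq_norm q f)"
    by eventually_elim (use True r in \<open>auto simp: Lq_norm_def e_def[symmetric] intro!: ennreal_leI\<close>)
  thus ?thesis using True by (simp add: Lq_le_def)
next
  case False
  define p where "p = real_of_ereal q"
  have p: "1 \<le> p" unfolding p_def by (rule real_of_ereal_ge_1[OF q False])
  have int: "integrable lebesgue (\<lambda>x. norm (f x) powr p)" using f False by (simp add: Lq_def p_def)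
  define I where "I = (LINT x|lebesgue. norm (f x) powr p)"
  have I: "I \<ge> 0" unfolding I_def by (intro integral_nonneg_AE) auto
  have "(\<integral>\<^sup>+x. epowr (ennreal (norm (g x))) p \<partial>lborel) = (\<integral>\<^sup>+x. ennreal (norm (f x) powr p) \<partial>lborel)"
    by (rule nn_integral_cong_AE) (use g(2) in \<open>eventually_elim, simp\<close>)
  also have "\<dots> = (\<integral>\<^sup>+x. ennreal (norm (f x) powr p) \<partial>lebesgue)" by (simp add: nn_integral_completion)
  also have "\<dots> = ennreal I" unfolding I_def by (rule nn_integral_eq_integral[OF int]) auto
  also have "I = Lq_norm q f powr p"
    using False I p unfolding Lq_norm_def real_of_ereal_inverse[OF q False] p_def[symmetric] I_def[symmetric]
    by (simp add: powr_powr)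
  finally show ?thesis using False by (simp add: Lq_le_def p_def)
qed

lemma Lq_le_imp_Lq:
  fixes f :: "'a::euclidean_space \<Rightarrow> complex"
  assumes fm: "f \<in> borel_measurable lebesgue" and q: "1 \<le> q"
    and le: "Lq_le q (\<lambda>x. ennreal (norm (f x))) B" and B: "0 \<le> B"
  shows "f \<in> Lq q" "Lq_norm q f \<le> B"
proof -
  have "f \<in> Lq q \<and> Lq_norm q f \<le> B"
  proof (cases "q = \<infinity>")
    case True
    have ae: "AE x in lebesgue. norm (f x) \<le> B"
      using le True B by (auto simp: Lq_le_def AE_completion_iff ennreal_le_iff)
    hence "esssup lebesgue (\<lambda>x. ereal (norm (f x))) \<le> ereal B" using fm by (intro esssup_I) auto
    hence "real_of_ereal (esssup lebesgue (\<lambda>x. ereal (norm (f x)))) \<le> B"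
      using B by (cases "esssup lebesgue (\<lambda>x. ereal (norm (f x)))") auto
    thus ?thesis using ae fm True by (auto simp: Lq_def Lq_norm_def)
  next
    case False
    define p where "p = real_of_ereal q"
    have p: "1 \<le> p" unfolding p_def by (rule real_of_ereal_ge_1[OF q False])
    have nn: "(\<integral>\<^sup>+x. ennreal (norm (f x) powr p) \<partial>lebesgue) \<le> ennreal (B powr p)"
      using le False by (simp add: Lq_le_def p_def nn_integral_completion)
    have int: "integrable lebesgue (\<lambda>x. norm (f x) powr p)"
    proof (rule integrableI_nonneg)
      show "(\<integral>\<^sup>+x. ennreal (norm (f x) powr p) \<partial>lebesgue) < \<infinity>" using nn by (simp add: le_less_trans)
    qed (use fm in auto)
    have "ennreal (LINT x|lebesgue. norm (f x) powr p) \<le> ennreal (B powr p)"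
      using nn nn_integral_eq_integral[OF int] by simp
    hence "(LINT x|lebesgue. norm (f x) powr p) \<le> B powr p" by (simp add: ennreal_le_iff)
    hence "(LINT x|lebesgue. norm (f x) powr p) powr (1 / p) \<le> (B powr p) powr (1 / p)"
      using p by (intro powr_mono2) auto
    also have "\<dots> = B" using p B by (simp add: powr_powr)
    finally show ?thesis using int fm False p unfolding Lq_def Lq_norm_def real_of_ereal_inverse[OF q False] p_def by simp
  qed
  thus "f \<in> Lq q" "Lq_norm q f \<le> B" by auto
qed

section \<open>Schwartz functions\<close>

text \<open>Gaussians times polynomials. The rules generate just enough functions to be closed under directional
  derivatives, which is all that is needed to see that Gaussians are Schwartz functions.\<close>

inductive gauss_poly :: "real \<Rightarrow> 'a::euclidean_space \<Rightarrow> ('a \<Rightarrow> complex) \<Rightarrow> bool"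
  for k :: real and y :: "'a::euclidean_space" where
  gauss: "gauss_poly k y (\<lambda>x. of_real (exp (- k * (norm (x - y))\<^sup>2)))"
| coord: "gauss_poly k y f \<Longrightarrow> gauss_poly k y (\<lambda>x. of_real ((x - y) \<bullet> b) * f x)"
| add: "gauss_poly k y f \<Longrightarrow> gauss_poly k y g \<Longrightarrow> gauss_poly k y (\<lambda>x. f x + g x)"
| scale: "gauss_poly k y f \<Longrightarrow> gauss_poly k y (\<lambda>x. c * f x)"

lemma gauss_poly_derivative:
  assumes "gauss_poly k y f"
  shows "\<exists>D. (\<forall>x. (f has_derivative (\<lambda>h. D h x)) (at x)) \<and> (\<forall>h. gauss_poly k y (D h))"
  using assms
proof induction
  case gauss
  have "((\<lambda>x. complex_of_real (exp (- k * (norm (x - y))\<^sup>2))) has_derivative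
     (\<lambda>h. of_real (-2 * k) * (of_real ((x - y) \<bullet> h) * of_real (exp (- k * (norm (x - y))\<^sup>2))))) (at x)" for x
    unfolding power2_norm_eq_inner
    by (auto intro!: derivative_eq_intros simp: fun_eq_iff algebra_simps inner_commute)
  thus ?case
    by (intro exI[of _ "\<lambda>h x. of_real (-2 * k) * (of_real ((x - y) \<bullet> h) * of_real (exp (- k * (norm (x - y))\<^sup>2)))"] conjI allI)
       (assumption, intro gauss_poly.intros)
next
  case (coord f b)
  then obtain D where D: "\<And>x. (f has_derivative (\<lambda>h. D h x)) (at x)" "\<And>h. gauss_poly k y (D h)" by blast
  have "((\<lambda>x. of_real ((x - y) \<bullet> b) * f x) has_derivative (\<lambda>h. of_real (h \<bullet> b) * f x + of_real ((x - y) \<bullet> b) * D h x)) (at x)" for x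
    by (auto intro!: derivative_eq_intros D(1) simp: algebra_simps)
  thus ?case
    by (intro exI[of _ "\<lambda>h x. of_real (h \<bullet> b) * f x + of_real ((x - y) \<bullet> b) * D h x"])
       (use D coord in \<open>auto intro!: gauss_poly.intros\<close>)
next
  case (add f g)
  then obtain D E where D: "\<And>x. (f has_derivative (\<lambda>h. D h x)) (at x)" "\<And>h. gauss_poly k y (D h)"
    "\<And>x. (g has_derivative (\<lambda>h. E h x)) (at x)" "\<And>h. gauss_poly k y (E h)" by blast
  have "((\<lambda>x. f x + g x) has_derivative (\<lambda>h. D h x + E h x)) (at x)" for x
    by (intro has_derivative_add D)
  thus ?case
    by (intro exI[of _ "\<lambda>h x. D h x + E h x"]) (use D in \<open>auto intro!: gauss_poly.intros\<close>)
next
  case (scale f c)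
  then obtain D where D: "\<And>x. (f has_derivative (\<lambda>h. D h x)) (at x)" "\<And>h. gauss_poly k y (D h)" by blast
  have "((\<lambda>x. c * f x) has_derivative (\<lambda>h. c * D h x)) (at x)" for x
    by (intro has_derivative_mult_right D)
  thus ?case
    by (intro exI[of _ "\<lambda>h x. c * D h x"]) (use D in \<open>auto intro!: gauss_poly.intros\<close>)
qed

text \<open>For all powers \<open>j\<close> at once, since a coordinate factor costs one more power of the norm.\<close>

lemma gauss_poly_bounded:
  assumes "gauss_poly k y f" and k: "0 < k"
  shows "\<exists>C. \<forall>x. norm (x - y) ^ j * norm (f x) \<le> C"
  using assms(1)
proof (induction arbitrary: j)
  case gauss
  have "norm (x - y) ^ j * norm (complex_of_real (exp (- k * (norm (x - y))\<^sup>2))) \<le> (real j / 2 / k) powr (real j / 2) + 2" for x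
  proof -
    define t where "t = (norm (x - y))\<^sup>2"
    have "norm (x - y) ^ j \<le> t powr (real j / 2) + 1"
    proof (cases "norm (x - y) = 0")
      case True thus ?thesis by (cases "j = 0") (auto simp: t_def power_0_left)
    next
      case False
      hence "t powr (real j / 2) = norm (x - y) powr real j"
        by (simp add: t_def powr_powr flip: powr_numeral)
      thus ?thesis using False by (simp add: powr_realpow)
    qed
    hence "norm (x - y) ^ j * exp (- k * t) \<le> (t powr (real j / 2) + 1) * exp (- k * t)"
      by (intro mult_right_mono) auto
    also have "\<dots> = t powr (real j / 2) * exp (- k * t) + exp (- k * t)" by (simp add: distrib_right)
    also have "\<dots> \<le> ((real j / 2 / k) powr (real j / 2) + 1) * exp (k * t) * exp (- k * t) + 1"
      using k by (intro add_mono mult_right_mono powr_le_exp) (auto simp: t_def)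
    also have "\<dots> = (real j / 2 / k) powr (real j / 2) + 2" by (simp add: mult.assoc flip: exp_add)
    finally show ?thesis by (simp add: t_def)
  qed
  thus ?case by blast
next
  case (coord f b)
  obtain C where C: "\<And>x. norm (x - y) ^ Suc j * norm (f x) \<le> C" using coord.IH by blast
  have "norm (x - y) ^ j * norm (of_real ((x - y) \<bullet> b) * f x) \<le> norm b * C" for x
  proof -
    have "norm (x - y) ^ j * norm (of_real ((x - y) \<bullet> b) * f x) \<le> norm (x - y) ^ j * ((norm (x - y) * norm b) * norm (f x))"
      using Cauchy_Schwarz_ineq2[of "x - y" b] unfolding norm_mult by (intro mult_left_mono mult_right_mono) auto
    also have "\<dots> = norm b * (norm (x - y) ^ Suc j * norm (f x))" by (simp add: mult_ac)
    also have "\<dots> \<le> norm b * C" by (intro mult_left_mono C) auto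
    finally show ?thesis .
  qed
  thus ?case by blast
next
  case (add f g)
  obtain C D where C: "\<And>x. norm (x - y) ^ j * norm (f x) \<le> C" "\<And>x. norm (x - y) ^ j * norm (g x) \<le> D"
    using add.IH by blast
  have "norm (x - y) ^ j * norm (f x + g x) \<le> C + D" for x
  proof -
    have "norm (x - y) ^ j * norm (f x + g x) \<le> norm (x - y) ^ j * (norm (f x) + norm (g x))"
      by (intro mult_left_mono norm_triangle_ineq) auto
    thus ?thesis using C[of x] by (simp add: distrib_left)
  qed
  thus ?case by blast
next
  case (scale f c)
  obtain C where C: "\<And>x. norm (x - y) ^ j * norm (f x) \<le> C" using scale.IH by blast
  have "norm (x - y) ^ j * norm (c * f x) \<le> norm c * C" for x
    using mult_left_mono[OF C[of x], of "norm c"] by (simp add: norm_mult mult_ac)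
  thus ?case by blast
qed

lemma gauss_poly_iter_deriv:
  "gauss_poly k y f \<Longrightarrow> gauss_poly k y (iter_deriv bs f)"
proof (induction bs)
  case (Cons b bs)
  from gauss_poly_derivative[OF Cons.IH[OF Cons.prems]] obtain D
    where D: "\<And>x. (iter_deriv bs f has_derivative (\<lambda>h. D h x)) (at x)" "\<And>h. gauss_poly k y (D h)" by blast
  have "iter_deriv (b # bs) f = D b"
    using frechet_derivative_at[OF D(1)] by (auto simp: fun_eq_iff)
  thus ?case using D(2) by simp
qed simp

lemma schwartz_gaussian:
  fixes y :: "'a::euclidean_space"
  assumes k: "0 < k"
  shows "schwartz (\<lambda>x. complex_of_real (exp (- k * (norm (x - y))\<^sup>2)))"
  unfolding schwartz_def
proof (intro allI impI conjI)
  fix bs :: "'a list" and j :: nat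
  define f where "f = iter_deriv bs (\<lambda>x. complex_of_real (exp (- k * (norm (x - y))\<^sup>2)))"
  have gp: "gauss_poly k y f" unfolding f_def by (intro gauss_poly_iter_deriv gauss_poly.gauss)
  from gauss_poly_derivative[OF gp] show "f differentiable_on UNIV"
    unfolding differentiable_on_def differentiable_def by (metis has_derivative_at_withinI)
  obtain C D where C: "\<And>x. norm (x - y) ^ j * norm (f x) \<le> C" "\<And>x. norm (x - y) ^ 0 * norm (f x) \<le> D"
    using gauss_poly_bounded[OF gp k] by meson
  show "\<exists>C. \<forall>x. norm x ^ j * norm (f x) \<le> C"
  proof (intro exI allI)
    fix x
    have "norm x ^ j \<le> (norm (x - y) + norm y) ^ j"
      using norm_triangle_ineq[of "x - y" y] by (intro power_mono) auto
    also have "\<dots> \<le> (2 * max (norm (x - y)) (norm y)) ^ j" by (intro power_mono) auto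
    also have "\<dots> \<le> 2 ^ j * (norm (x - y) ^ j + norm y ^ j)"
      by (auto simp: power_mult_distrib max_def)
    finally have "norm x ^ j * norm (f x) \<le> 2 ^ j * (norm (x - y) ^ j + norm y ^ j) * norm (f x)"
      by (intro mult_right_mono) auto
    also have "\<dots> = 2 ^ j * (norm (x - y) ^ j * norm (f x) + norm y ^ j * norm (f x))" by (simp add: algebra_simps)
    also have "\<dots> \<le> 2 ^ j * (C + norm y ^ j * D)"
      using C by (intro mult_left_mono add_mono) auto
    finally show "norm x ^ j * norm (f x) \<le> 2 ^ j * (C + norm y ^ j * D)" .
  qed
qed

lemma integrable_inverse_quadratic: "integrable lborel (\<lambda>t::real. inverse (1 + t\<^sup>2))"
proof -
  have "set_integrable lborel {0<..} (\<lambda>t::real. inverse (1 + t\<^sup>2))"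
  proof -
    have "(\<integral>\<^sup>+t. ennreal (inverse (1 + t\<^sup>2)) * indicator {0..} t \<partial>lborel) = ennreal (pi / 2 - arctan 0)"
      by (rule nn_integral_FTC_atLeast)
         (auto intro!: derivative_eq_intros tendsto_arctan_at_top simp: add_nonneg_eq_0_iff)
    hence fin: "(\<integral>\<^sup>+t. ennreal (inverse (1 + t\<^sup>2)) * indicator {0..} t \<partial>lborel) < \<infinity>" by simp
    have "integrable lborel (\<lambda>t::real. indicator {0..} t *\<^sub>R inverse (1 + t\<^sup>2))"
    proof (rule integrableI_nonneg)
      have "(\<integral>\<^sup>+t. ennreal (indicator {0..} t *\<^sub>R inverse (1 + t\<^sup>2)) \<partial>lborel) = (\<integral>\<^sup>+t. ennreal (inverse (1 + t\<^sup>2)) * indicator {0..} t \<partial>lborel)"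
        by (intro nn_integral_cong) (auto simp: indicator_def)
      thus "(\<integral>\<^sup>+t. ennreal (indicator {0..} (t::real) *\<^sub>R inverse (1 + t\<^sup>2)) \<partial>lborel) < \<infinity>" using fin by simp
    qed (auto simp: indicator_def)
    hence "set_integrable lborel {0..} (\<lambda>t::real. inverse (1 + t\<^sup>2))" by (simp add: set_integrable_def)
    thus ?thesis by (rule set_integrable_subset) auto
  qed
  from integrable_even_extension[OF this] show ?thesis by simp
qed

lemma integrable_prod_inverse_quadratic:
  "integrable lborel (\<lambda>x::'a::euclidean_space. \<Prod>b\<in>Basis. inverse (1 + (x \<bullet> b)\<^sup>2))"
proof (rule integrableI_nonneg)
  have "(\<integral>\<^sup>+x. ennreal (\<Prod>b\<in>Basis. inverse (1 + ((x::'a) \<bullet> b)\<^sup>2)) \<partial>lborel)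
      = (\<integral>\<^sup>+x. (\<Prod>b\<in>Basis. ennreal (inverse (1 + ((x::'a) \<bullet> b)\<^sup>2))) \<partial>lborel)"
    by (simp add: prod_ennreal)
  also have "\<dots> = (\<Prod>b\<in>(Basis::'a set). \<integral>\<^sup>+t. ennreal (inverse (1 + t\<^sup>2)) \<partial>lborel)"
    by (rule nn_integral_lborel_prod) auto
  also have "\<dots> < \<infinity>"
    using nn_integral_eq_integral[OF integrable_inverse_quadratic]
    by (simp add: ennreal_power)
  finally show "(\<integral>\<^sup>+x. ennreal (\<Prod>b\<in>Basis. inverse (1 + ((x::'a) \<bullet> b)\<^sup>2)) \<partial>lborel) < \<infinity>" .
qed (auto intro!: prod_nonneg AE_I2)

text \<open>Decay in each coordinate separately suits both the Fourier transform, where it comes from one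
derivative at a time, and Tonelli's theorem.\<close>

lemma integrable_of_prod_decay:
  fixes f :: "'a::euclidean_space \<Rightarrow> complex"
  assumes "f \<in> borel_measurable borel" and bd: "\<And>x. (\<Prod>b\<in>Basis. 1 + (x \<bullet> b)\<^sup>2) * norm (f x) \<le> C"
  shows "integrable lborel f"
proof (rule Bochner_Integration.integrable_bound)
  show "integrable lborel (\<lambda>x::'a. C * (\<Prod>b\<in>Basis. inverse (1 + (x \<bullet> b)\<^sup>2)))"
    by (intro integrable_mult_right integrable_prod_inverse_quadratic)
  show "AE x in lborel. norm (f x) \<le> norm (C * (\<Prod>b\<in>Basis. inverse (1 + (x \<bullet> b)\<^sup>2)))"
  proof (intro AE_I2)
    fix x :: 'a
    define Q where "Q = (\<Prod>b\<in>Basis. 1 + (x \<bullet> b)\<^sup>2)"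
    have Q: "Q > 0" unfolding Q_def by (intro prod_pos) (auto simp: add_pos_nonneg)
    have "norm (f x) \<le> C * inverse Q" using bd[of x] Q unfolding Q_def[symmetric] by (simp add: field_simps)
    thus "norm (f x) \<le> norm (C * (\<Prod>b\<in>Basis. inverse (1 + (x \<bullet> b)\<^sup>2)))"
    proof -
      have "(\<Prod>b\<in>Basis. inverse (1 + (x \<bullet> b)\<^sup>2)) = inverse Q"
        unfolding Q_def using prod_inversef[of "\<lambda>b. 1 + (x \<bullet> b)\<^sup>2" Basis] by (simp add: o_def)
      thus ?thesis using \<open>norm (f x) \<le> C * inverse Q\<close> by simp
    qed
  qed
qed (use assms in auto)

lemma iter_deriv_append: "iter_deriv (as @ bs) f = iter_deriv as (iter_deriv bs f)"
  by (induction as) auto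

lemma schwartz_iter_deriv: "schwartz f \<Longrightarrow> set bs \<subseteq> Basis \<Longrightarrow> schwartz (iter_deriv bs f)"
  unfolding schwartz_def by (auto simp flip: iter_deriv_append)

lemma schwartz_has_derivative:
  assumes "schwartz f" shows "(f has_derivative frechet_derivative f (at x)) (at x)"
proof -
  have "f differentiable_on UNIV" using assms unfolding schwartz_def by (metis empty_set empty_subsetI iter_deriv.simps(1))
  thus ?thesis by (simp add: differentiable_on_def frechet_derivative_works)
qed

lemma schwartz_continuous: "schwartz f \<Longrightarrow> continuous_on UNIV f"
  by (rule has_derivative_continuous_on[where f'="\<lambda>x. frechet_derivative f (at x)"])
     (auto dest: schwartz_has_derivative)

lemma schwartz_measurable: "schwartz f \<Longrightarrow> f \<in> borel_measurable borel"
  by (intro borel_measurable_continuous_onI schwartz_continuous)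

lemma schwartz_decay:
  assumes "schwartz f" shows "\<exists>C. \<forall>x. norm x ^ k * norm (f x) \<le> C"
  using assms unfolding schwartz_def by (metis empty_set empty_subsetI iter_deriv.simps(1))

lemma schwartz_bounded: "schwartz f \<Longrightarrow> \<exists>C. \<forall>x. norm (f x) \<le> C"
  using schwartz_decay[of f 0] by simp

text \<open>The product of the \<open>1 + (x \<bullet> b)\<^sup>2\<close> is at most \<open>(1 + (norm x)\<^sup>2) ^ n\<close>.\<close>

lemma schwartz_integrable:
  fixes f :: "'a::euclidean_space \<Rightarrow> complex"
  assumes f: "schwartz f" shows "integrable lborel f"
proof -
  define n where "n = DIM('a)"
  obtain C D where C: "\<And>x. norm x ^ (2 * n) * norm (f x) \<le> C" "\<And>x. norm (f x) \<le> D"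
    using schwartz_decay[OF f] schwartz_bounded[OF f] by meson
  show ?thesis
  proof (rule integrable_of_prod_decay)
    fix x :: 'a
    have "(\<Prod>b\<in>Basis. 1 + (x \<bullet> b)\<^sup>2) \<le> (\<Prod>b\<in>(Basis::'a set). 1 + (norm x)\<^sup>2)"
    proof (intro prod_mono conjI)
      fix b :: 'a assume "b \<in> Basis"
      hence "\<bar>x \<bullet> b\<bar> \<le> norm x" by (rule Basis_le_norm)
      thus "1 + (x \<bullet> b)\<^sup>2 \<le> 1 + (norm x)\<^sup>2" 
        by (metis abs_ge_zero power2_abs power_mono add_left_mono)
    qed auto
    also have "\<dots> = (1 + (norm x)\<^sup>2) ^ n" by (simp add: n_def)
    also have "\<dots> \<le> (2 * max 1 ((norm x)\<^sup>2)) ^ n" by (intro power_mono) auto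
    also have "\<dots> \<le> 2 ^ n * (1 + norm x ^ (2 * n))"
      by (auto simp: power_mult_distrib max_def power_mult)
    finally have "(\<Prod>b\<in>Basis. 1 + (x \<bullet> b)\<^sup>2) * norm (f x) \<le> 2 ^ n * (1 + norm x ^ (2 * n)) * norm (f x)"
      by (intro mult_right_mono) auto
    also have "\<dots> = 2 ^ n * (norm (f x) + norm x ^ (2 * n) * norm (f x))" by (simp add: algebra_simps)
    also have "\<dots> \<le> 2 ^ n * (D + C)" using C by (intro mult_left_mono add_mono) auto
    finally show "(\<Prod>b\<in>Basis. 1 + (x \<bullet> b)\<^sup>2) * norm (f x) \<le> 2 ^ n * (D + C)" .
  qed (rule schwartz_measurable[OF f])
qed

section \<open>Integrability of inverse Fourier transforms of Schwartz functions\<close>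

lemma lborel_integral_translate:
  fixes f :: "'a::euclidean_space \<Rightarrow> 'b::{banach, second_countable_topology}"
  assumes "f \<in> borel_measurable borel"
  shows "(LINT x|lborel. f (x + c)) = (LINT x|lborel. f x)"
proof -
  have "(LINT x|lborel. f x) = (LINT x|distr lborel borel ((+) c). f x)" by (simp add: lborel_distr_plus)
  also have "\<dots> = (LINT x|lborel. f (c + x))" by (rule integral_distr) (use assms in auto)
  finally show ?thesis by (simp add: add.commute)
qed

lemma lborel_integrable_translate:
  fixes f :: "'a::euclidean_space \<Rightarrow> 'b::{banach, second_countable_topology}"
  assumes "integrable lborel f" shows "integrable lborel (\<lambda>x. f (x + c))"
proof -
  have "integrable (distr lborel borel ((+) c)) f" using assms by (simp add: lborel_distr_plus)
  hence "integrable lborel (\<lambda>x. f (c + x))" by (subst (asm) integrable_distr_eq) (use assms in auto)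
  thus ?thesis by (simp add: add.commute)
qed

text \<open>Integrating the increment \<open>k (x + b) - k x\<close> over the whole space gives zero by
  translation invariance; written as an integral of the derivative along the segment it gives the
  integral of the derivative.\<close>

lemma integral_directional_derivative:
  fixes k :: "'a::euclidean_space \<Rightarrow> complex"
  assumes der: "\<And>x. (k has_derivative D x) (at x)" and kint: "integrable lborel k"
    and cont: "continuous_on UNIV (\<lambda>x. D x b)" and Dint: "integrable lborel (\<lambda>x. D x b)"
  shows "(LINT x|lborel. D x b) = 0"
proof -
  define g where "g = (\<lambda>x. D x b)"
  have gm[measurable]: "g \<in> borel_measurable borel" using Dint by (auto simp: g_def)
  have km: "k \<in> borel_measurable borel" using kint by auto
  have ftc: "(LINT \<tau>|lborel. indicator {0..1} \<tau> *\<^sub>R g (x + \<tau> *\<^sub>R b)) = k (x + b) - k x" for x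
  proof -
    have "continuous_on {0..1} (\<lambda>\<tau>. g (x + \<tau> *\<^sub>R b))"
      using cont unfolding g_def by (rule continuous_on_compose2) (auto intro!: continuous_intros)
    hence si: "set_integrable lborel {0..1} (\<lambda>\<tau>. g (x + \<tau> *\<^sub>R b))"
      by (intro borel_integrable_atLeastAtMost') 
    have "((\<lambda>\<tau>. g (x + \<tau> *\<^sub>R b)) has_integral (k (x + 1 *\<^sub>R b) - k (x + 0 *\<^sub>R b))) {0..1}"
    proof (rule fundamental_theorem_of_calculus)
      fix \<tau> :: real
      have "((\<lambda>\<tau>. x + \<tau> *\<^sub>R b) has_derivative (\<lambda>h. h *\<^sub>R b)) (at \<tau> within {0..1})"
        by (auto intro!: derivative_eq_intros)
      from has_derivative_compose[OF this der]
      have "((\<lambda>\<tau>. k (x + \<tau> *\<^sub>R b)) has_derivative (\<lambda>h. D (x + \<tau> *\<^sub>R b) (h *\<^sub>R b))) (at \<tau> within {0..1})" .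
      moreover have "D (x + \<tau> *\<^sub>R b) (h *\<^sub>R b) = h *\<^sub>R D (x + \<tau> *\<^sub>R b) b" for h
        using has_derivative_bounded_linear[OF der] by (rule linear_simps(5))
      ultimately show "((\<lambda>\<tau>. k (x + \<tau> *\<^sub>R b)) has_vector_derivative g (x + \<tau> *\<^sub>R b)) (at \<tau> within {0..1})"
        by (simp add: has_vector_derivative_def g_def)
    qed simp
    from integral_unique[OF this] show ?thesis
      using set_borel_integral_eq_integral(2)[OF si] by (simp add: set_lebesgue_integral_def)
  qed
  have int: "integrable (lborel \<Otimes>\<^sub>M lborel) (\<lambda>(\<tau>::real, x::'a). indicator {0..1} \<tau> *\<^sub>R g (x + \<tau> *\<^sub>R b))"
  proof (rule integrable_pair_dominated)
    show "(\<lambda>(\<tau>::real, x::'a). indicator {0..1} \<tau> *\<^sub>R g (x + \<tau> *\<^sub>R b)) \<in> borel_measurable (lborel \<Otimes>\<^sub>M lborel)"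
      by measurable
    show "integrable lborel (\<lambda>x. indicator {0..1} \<tau> *\<^sub>R norm (g (x + \<tau> *\<^sub>R b)))" for \<tau> :: real
      using Dint by (auto simp: g_def intro!: lborel_integrable_translate[of "\<lambda>x. norm (D x b)"])
    show "(LINT x|lborel. indicator {0..1} \<tau> *\<^sub>R norm (g (x + \<tau> *\<^sub>R b))) \<le> indicator {0..1} \<tau> *\<^sub>R (LINT x|lborel. norm (g x))" for \<tau> :: real
      using lborel_integral_translate[of "\<lambda>x. norm (g x)" "\<tau> *\<^sub>R b"] by (auto simp: indicator_def)
  qed auto
  have "(LINT x|lborel. g x) = (LINT \<tau>|lborel. indicator {0..1} (\<tau>::real) *\<^sub>R (LINT x|lborel. g x))"
    by (subst integral_scaleR_left) auto
  also have "\<dots> = (LINT \<tau>|lborel. LINT x|lborel. indicator {0..1} (\<tau>::real) *\<^sub>R g (x + \<tau> *\<^sub>R b))"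
    by (simp add: lborel_integral_translate)
  also have "\<dots> = (LINT x|lborel. LINT \<tau>|lborel. indicator {0..1} (\<tau>::real) *\<^sub>R g (x + \<tau> *\<^sub>R b))"
    using lborel_pair.Fubini_integral[OF int] by simp
  also have "\<dots> = (LINT x|lborel. k (x + b) - k x)" unfolding ftc ..
  also have "\<dots> = 0"
    using kint km by (simp add: lborel_integrable_translate lborel_integral_translate)
  finally show ?thesis unfolding g_def .
qed

lemma inv_fourier_lborel:
  fixes x :: "'a::euclidean_space"
  assumes "\<phi> \<in> borel_measurable borel"
  shows "inv_fourier \<phi> x = (LINT \<xi>|lborel. exp (\<i> * of_real (x \<bullet> \<xi>)) * \<phi> \<xi>) / (2 * pi) ^ DIM('a)"
  unfolding inv_fourier_def using assms by (subst integral_completion) auto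

lemma norm_exp_i [simp]: "norm (exp (\<i> * complex_of_real r)) = 1"
  by (simp add: norm_exp_eq_Re)

lemma integrable_exp_i_mult:
  fixes \<phi> :: "'a::euclidean_space \<Rightarrow> complex"
  assumes "integrable lborel \<phi>" shows "integrable lborel (\<lambda>\<xi>. exp (\<i> * of_real (x \<bullet> \<xi>)) * \<phi> \<xi>)"
  by (rule Bochner_Integration.integrable_bound[OF assms]) (use assms in \<open>auto simp: norm_mult\<close>)

lemma inv_fourier_bounded:
  fixes \<phi> :: "'a::euclidean_space \<Rightarrow> complex"
  assumes "integrable lborel \<phi>"
  shows "norm (inv_fourier \<phi> x) \<le> (LINT \<xi>|lborel. norm (\<phi> \<xi>)) / (2 * pi) ^ DIM('a)"
proof -
  have "norm (LINT \<xi>|lborel. exp (\<i> * of_real (x \<bullet> \<xi>)) * \<phi> \<xi>) \<le> (LINT \<xi>|lborel. norm (exp (\<i> * of_real (x \<bullet> \<xi>)) * \<phi> \<xi>))"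
    by (rule integral_norm_bound)
  also have "\<dots> = (LINT \<xi>|lborel. norm (\<phi> \<xi>))" by (simp add: norm_mult)
  finally show ?thesis using assms
    by (subst inv_fourier_lborel) (auto simp: norm_divide norm_mult norm_power intro!: divide_right_mono)
qed

text \<open>Integration by parts: the derivative of the exponential times \<open>\<phi>\<close> has integral zero.\<close>

lemma inv_fourier_derivative:
  fixes \<phi> :: "'a::euclidean_space \<Rightarrow> complex"
  assumes \<phi>: "schwartz \<phi>" and b: "b \<in> Basis"
  shows "inv_fourier (iter_deriv [b] \<phi>) x = - \<i> * of_real (x \<bullet> b) * inv_fourier \<phi> x"
proof -
  define d where "d = iter_deriv [b] \<phi>"
  have d: "schwartz d" unfolding d_def by (rule schwartz_iter_deriv[OF \<phi>]) (use b in auto)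
  define D where "D = (\<lambda>\<xi> h. exp (\<i> * of_real (x \<bullet> \<xi>)) * frechet_derivative \<phi> (at \<xi>) h + (\<i> * of_real (x \<bullet> h)) * (exp (\<i> * of_real (x \<bullet> \<xi>)) * \<phi> \<xi>))"
  have Db: "D \<xi> b = exp (\<i> * of_real (x \<bullet> \<xi>)) * d \<xi> + (\<i> * of_real (x \<bullet> b)) * (exp (\<i> * of_real (x \<bullet> \<xi>)) * \<phi> \<xi>)" for \<xi>
    by (simp add: D_def d_def)
  have e: "((\<lambda>\<xi>. exp (\<i> * complex_of_real (x \<bullet> \<xi>))) has_derivative (\<lambda>h. (\<i> * of_real (x \<bullet> h)) * exp (\<i> * of_real (x \<bullet> \<xi>)))) (at \<xi>)" for \<xi>
  proof -
    have "((\<lambda>\<xi>. \<i> * complex_of_real (x \<bullet> \<xi>)) has_derivative (\<lambda>h. \<i> * of_real (x \<bullet> h))) (at \<xi>)"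
      by (intro has_derivative_mult_right has_derivative_of_real has_derivative_inner_right has_derivative_ident)
    from has_derivative_compose[OF this DERIV_exp[THEN has_field_derivative_imp_has_derivative]]
    show ?thesis by (simp add: mult_ac)
  qed
  note i1 = integrable_exp_i_mult[OF schwartz_integrable[OF d], of x]
  note i2 = integrable_exp_i_mult[OF schwartz_integrable[OF \<phi>], of x]
  have "(LINT \<xi>|lborel. D \<xi> b) = 0"
  proof (rule integral_directional_derivative)
    show "((\<lambda>\<xi>. exp (\<i> * of_real (x \<bullet> \<xi>)) * \<phi> \<xi>) has_derivative D \<xi>) (at \<xi>)" for \<xi>
      using has_derivative_mult[OF e schwartz_has_derivative[OF \<phi>]] unfolding D_def by (simp add: mult_ac)
    show "integrable lborel (\<lambda>\<xi>. exp (\<i> * of_real (x \<bullet> \<xi>)) * \<phi> \<xi>)" by (rule i2)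
    show "continuous_on UNIV (\<lambda>\<xi>. D \<xi> b)" unfolding Db
      by (intro continuous_intros schwartz_continuous d \<phi>)
    show "integrable lborel (\<lambda>\<xi>. D \<xi> b)" unfolding Db
      by (intro Bochner_Integration.integrable_add integrable_mult_right i1 i2)
  qed
  hence "(LINT \<xi>|lborel. exp (\<i> * of_real (x \<bullet> \<xi>)) * d \<xi>) = - \<i> * of_real (x \<bullet> b) * (LINT \<xi>|lborel. exp (\<i> * of_real (x \<bullet> \<xi>)) * \<phi> \<xi>)"
    unfolding Db using i1 i2 by (simp add: add_eq_0_iff)
  thus ?thesis unfolding d_def[symmetric]
    by (simp only: inv_fourier_lborel[OF schwartz_measurable[OF d]] inv_fourier_lborel[OF schwartz_measurable[OF \<phi>]] times_divide_eq_right)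
qed

text \<open>Induction on the set of coordinates, for all Schwartz functions at once: a factor \<open>(x \<bullet> b)\<^sup>2\<close> is absorbed
by passing from \<open>\<phi>\<close> to its second derivative in direction \<open>b\<close>.\<close>

lemma inv_fourier_schwartz_decay:
  fixes S :: "'a::euclidean_space set"
  assumes "finite S" "S \<subseteq> Basis" "schwartz \<phi>"
  shows "\<exists>C. \<forall>x. (\<Prod>b\<in>S. 1 + (x \<bullet> b)\<^sup>2) * norm (inv_fourier \<phi> x) \<le> C"
  using assms
proof (induction arbitrary: \<phi>)
  case empty
  thus ?case using inv_fourier_bounded[OF schwartz_integrable] by fastforce
next
  case (insert b S)
  have b: "b \<in> Basis" using insert.prems by simp
  define \<psi> where "\<psi> = iter_deriv [b] (iter_deriv [b] \<phi>)"
  have s1: "schwartz (iter_deriv [b] \<phi>)" by (rule schwartz_iter_deriv) (use insert.prems in auto)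
  have s2: "schwartz \<psi>" unfolding \<psi>_def by (rule schwartz_iter_deriv[OF s1]) (use insert.prems in auto)
  have "inv_fourier \<psi> x = - \<i> * of_real (x \<bullet> b) * (- \<i> * of_real (x \<bullet> b) * inv_fourier \<phi> x)" for x
    unfolding \<psi>_def inv_fourier_derivative[OF s1 b] inv_fourier_derivative[OF insert.prems(2) b] ..
  hence n: "norm (inv_fourier \<psi> x) = (x \<bullet> b)\<^sup>2 * norm (inv_fourier \<phi> x)" for x
    by (simp add: norm_mult power2_eq_square abs_mult[symmetric])
  obtain C1 C2 where C: "\<And>x. (\<Prod>b\<in>S. 1 + (x \<bullet> b)\<^sup>2) * norm (inv_fourier \<phi> x) \<le> C1"
     "\<And>x. (\<Prod>b\<in>S. 1 + (x \<bullet> b)\<^sup>2) * norm (inv_fourier \<psi> x) \<le> C2"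
    using insert.IH[OF _ insert.prems(2)] insert.IH[OF _ s2] insert.prems(1) by auto
  have "(\<Prod>b\<in>insert b S. 1 + (x \<bullet> b)\<^sup>2) * norm (inv_fourier \<phi> x) \<le> C1 + C2" for x
    using C[of x] insert.hyps unfolding n by (simp add: algebra_simps)
  thus ?case by blast
qed

lemma inv_fourier_schwartz_integrable:
  fixes \<phi> :: "'a::euclidean_space \<Rightarrow> complex"
  assumes \<phi>: "schwartz \<phi>" shows "integrable lborel (inv_fourier \<phi>)"
proof -
  obtain C where C: "\<And>x. (\<Prod>b\<in>Basis. 1 + (x \<bullet> b)\<^sup>2) * norm (inv_fourier \<phi> x) \<le> C"
    using inv_fourier_schwartz_decay[OF finite_Basis subset_refl \<phi>] by blast
  show ?thesis
  proof (rule integrable_of_prod_decay[OF _ C])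
    note [measurable] = schwartz_measurable[OF \<phi>]
    have "inv_fourier \<phi> = (\<lambda>x. (LINT \<xi>|lborel. exp (\<i> * of_real (x \<bullet> \<xi>)) * \<phi> \<xi>) / (2 * pi) ^ DIM('a))"
      by (intro ext inv_fourier_lborel) measurable
    also have "\<dots> \<in> borel_measurable borel" by measurable
    finally show "inv_fourier \<phi> \<in> borel_measurable borel" .
  qed
qed

section \<open>Uniqueness of the function representing a distribution\<close>

lemma schwartz_heat_kernel:
  assumes "0 < \<tau>" shows "schwartz (\<lambda>x. complex_of_real (exp (- (norm (x - y))\<^sup>2 / (4 * \<tau>))))"
  using schwartz_gaussian[of "1 / (4 * \<tau>)" y] assms by simp

text \<open>Splitting the exponent in two halves trades a factor of Gaussian decay against a doubling
  of the time.\<close>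

lemma heat_kernel_tail:
  assumes \<tau>: "0 < \<tau>" and r: "0 \<le> r" "r \<le> norm z"
  shows "heat_kernel \<tau> (z :: 'a::euclidean_space) \<le> exp (- r\<^sup>2 / (8 * \<tau>)) * sqrt 2 ^ DIM('a) * heat_kernel (2 * \<tau>) z"
proof -
  have "(norm z)\<^sup>2 / (4 * \<tau>) = (norm z)\<^sup>2 / (8 * \<tau>) + (norm z)\<^sup>2 / (8 * \<tau>)" by simp
  moreover have "r\<^sup>2 / (8 * \<tau>) \<le> (norm z)\<^sup>2 / (8 * \<tau>)" using assms by (intro divide_right_mono power_mono) auto
  ultimately have "- (norm z)\<^sup>2 / (4 * \<tau>) \<le> - r\<^sup>2 / (8 * \<tau>) + - (norm z)\<^sup>2 / (8 * \<tau>)" by simp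
  hence "exp (- (norm z)\<^sup>2 / (4 * \<tau>)) \<le> exp (- r\<^sup>2 / (8 * \<tau>)) * exp (- (norm z)\<^sup>2 / (8 * \<tau>))"
    by (subst exp_add[symmetric]) (simp only: exp_le_cancel_iff)
  hence "heat_kernel \<tau> z \<le> exp (- r\<^sup>2 / (8 * \<tau>)) * exp (- (norm z)\<^sup>2 / (8 * \<tau>)) / sqrt (4 * pi * \<tau>) ^ DIM('a)"
    unfolding heat_kernel_def using \<tau> by (intro divide_right_mono) auto
  also have "sqrt (4 * pi * (2 * \<tau>)) = sqrt 2 * sqrt (4 * pi * \<tau>)"
    unfolding real_sqrt_mult[symmetric] by (simp add: mult_ac)
  hence "exp (- r\<^sup>2 / (8 * \<tau>)) * exp (- (norm z)\<^sup>2 / (8 * \<tau>)) / sqrt (4 * pi * \<tau>) ^ DIM('a)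
     = exp (- r\<^sup>2 / (8 * \<tau>)) * sqrt 2 ^ DIM('a) * heat_kernel (2 * \<tau>) z"
    unfolding heat_kernel_def by (simp add: power_mult_distrib)
  finally show ?thesis .
qed

lemma integrable_heat_kernel:
  assumes "0 < \<tau>" shows "integrable lborel (\<lambda>y :: 'a::euclidean_space. heat_kernel \<tau> (x - y))"
    and "(LINT y|lborel. heat_kernel \<tau> (x - y :: 'a)) = 1"
proof -
  have m: "(\<lambda>y :: 'a. heat_kernel \<tau> (x - y)) \<in> borel_measurable lborel" by measurable
  have "(\<integral>\<^sup>+y. ennreal (heat_kernel \<tau> (x - y :: 'a)) \<partial>lborel) = ennreal 1"
    using nn_integral_heat_kernel(2)[OF assms, of x] by simp
  moreover have "AE y :: 'a in lborel. 0 \<le> heat_kernel \<tau> (x - y)" using assms by (auto simp: heat_kernel_nonneg)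
  ultimately show "integrable lborel (\<lambda>y :: 'a. heat_kernel \<tau> (x - y))" "(LINT y|lborel. heat_kernel \<tau> (x - y :: 'a)) = 1"
    using m by (auto intro!: integrableI_nonneg simp: integral_eq_nn_integral)
qed

text \<open>The last bound says that little heat reaches points at distance \<open>r\<close> from \<open>S\<close>.\<close>

lemma heat_average:
  fixes x :: "'a::euclidean_space"
  assumes [measurable]: "S \<in> sets borel" and \<tau>: "0 < \<tau>"
  shows "integrable lborel (\<lambda>y. indicator S y * heat_kernel \<tau> (x - y))"
    and "0 \<le> (LINT y|lborel. indicator S y * heat_kernel \<tau> (x - y))"
    and "0 \<le> r \<Longrightarrow> (\<And>y. y \<in> S \<Longrightarrow> r \<le> norm (x - y)) \<Longrightarrow>
       (LINT y|lborel. indicator S y * heat_kernel \<tau> (x - y)) \<le> exp (- r\<^sup>2 / (8 * \<tau>)) * sqrt 2 ^ DIM('a)"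
proof -
  show i: "integrable lborel (\<lambda>y. indicator S y * heat_kernel \<tau> (x - y))"
    by (rule Bochner_Integration.integrable_bound[OF integrable_heat_kernel(1)[OF \<tau>, of x]])
       (auto simp: indicator_def)
  show "0 \<le> (LINT y|lborel. indicator S y * heat_kernel \<tau> (x - y))"
    using \<tau> by (intro integral_nonneg_AE) (auto simp: heat_kernel_nonneg)
  assume r: "0 \<le> r" "\<And>y. y \<in> S \<Longrightarrow> r \<le> norm (x - y)"
  have "(LINT y|lborel. indicator S y * heat_kernel \<tau> (x - y)) \<le> (LINT y|lborel. exp (- r\<^sup>2 / (8 * \<tau>)) * sqrt 2 ^ DIM('a) * heat_kernel (2 * \<tau>) (x - y))"
  proof (rule integral_mono[OF i])
    show "integrable lborel (\<lambda>y. exp (- r\<^sup>2 / (8 * \<tau>)) * sqrt 2 ^ DIM('a) * heat_kernel (2 * \<tau>) (x - y))"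
      using \<tau> by (intro integrable_mult_right integrable_heat_kernel) auto
    fix y :: 'a
    have "0 \<le> exp (- r\<^sup>2 / (8 * \<tau>)) * sqrt 2 ^ DIM('a) * heat_kernel (2 * \<tau>) (x - y)"
      using \<tau> by (intro mult_nonneg_nonneg heat_kernel_nonneg) auto
    thus "indicator S y * heat_kernel \<tau> (x - y) \<le> exp (- r\<^sup>2 / (8 * \<tau>)) * sqrt 2 ^ DIM('a) * heat_kernel (2 * \<tau>) (x - y)"
      using heat_kernel_tail[OF \<tau> r(1), of "x - y"] r(2)[of y] by (auto simp: indicator_def)
  qed
  also have "\<dots> = exp (- r\<^sup>2 / (8 * \<tau>)) * sqrt 2 ^ DIM('a)"
    using \<tau> integrable_heat_kernel(2)[of "2 * \<tau>" x] by simp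
  finally show "(LINT y|lborel. indicator S y * heat_kernel \<tau> (x - y)) \<le> exp (- r\<^sup>2 / (8 * \<tau>)) * sqrt 2 ^ DIM('a)" .
qed

text \<open>The positive and the negative part have the same integrals over boxes, hence they are densities of the
same measure.\<close>

lemma AE_eq_0_if_box_integrals_0:
  fixes u :: "'a::euclidean_space \<Rightarrow> real"
  assumes [measurable]: "u \<in> borel_measurable borel"
    and int: "\<And>a b. integrable lborel (\<lambda>x. indicator (box a b) x * u x)"
    and zero: "\<And>a b. (LINT x|lborel. indicator (box a b) x * u x) = 0"
  shows "AE x in lborel. u x = 0"
proof -
  define M where "M = (\<lambda>s. density lborel (\<lambda>x::'a. ennreal (s * u x)))"
  have em: "emeasure (M s) (box a b) = (\<integral>\<^sup>+x. ennreal (indicator (box a b) x * (s * u x)) \<partial>lborel)" for s a b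
    unfolding M_def by (subst emeasure_density) (auto intro!: nn_integral_cong simp: indicator_def)
  have fin: "emeasure (M s) (box a b) \<noteq> \<infinity>" for s a b
  proof -
    have "integrable lborel (\<lambda>x. s * (indicator (box a b) x * u x))" using int by simp
    hence "(\<integral>\<^sup>+x. ennreal (norm (s * (indicator (box a b) x * u x))) \<partial>lborel) < \<infinity>"
      unfolding integrable_iff_bounded by blast
    moreover have "emeasure (M s) (box a b) \<le> (\<integral>\<^sup>+x. ennreal (norm (s * (indicator (box a b) x * u x))) \<partial>lborel)"
      unfolding em by (intro nn_integral_mono ennreal_leI) (auto simp: indicator_def)
    ultimately show ?thesis by auto
  qed
  have eq: "emeasure (M 1) (box a b) = emeasure (M (-1)) (box a b)" for a b
  proof -
    have "ennreal 0 = ennreal (LINT x|lborel. indicator (box a b) x * u x)" using zero by simp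
    have "enn2real (emeasure (M 1) (box a b)) - enn2real (emeasure (M (-1)) (box a b)) = (LINT x|lborel. indicator (box a b) x * u x)"
      unfolding em using real_lebesgue_integral_def[OF int[of a b]] by simp
    hence "enn2real (emeasure (M 1) (box a b)) = enn2real (emeasure (M (-1)) (box a b))" using zero by simp
    thus ?thesis using fin by (metis ennreal_enn2real infinity_ennreal_def less_top)
  qed
  have "M 1 = M (-1)"
  proof (rule measure_eqI_generator_eq)
    let ?E = "range (\<lambda>(a, b). box a b::'a set)"
    show "Int_stable ?E" by (auto simp: Int_stable_def box_Int_box)
    show "?E \<subseteq> Pow UNIV" "sets (M 1) = sigma_sets UNIV ?E" "sets (M (-1)) = sigma_sets UNIV ?E"
      by (simp_all add: borel_eq_box M_def)
    let ?A = "\<lambda>n::nat. box (- (real n *\<^sub>R One)) (real n *\<^sub>R One) :: 'a set"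
    show "range ?A \<subseteq> ?E" "(\<Union>i. ?A i) = UNIV" unfolding UN_box_eq_UNIV by auto
    show "emeasure (M 1) (?A i) \<noteq> \<infinity>" for i by (rule fin)
    show "emeasure (M 1) X = emeasure (M (-1)) X" if "X \<in> ?E" for X using that eq by auto
  qed
  hence "AE x in lborel. ennreal (1 * u x) = ennreal (- 1 * u x)"
    unfolding M_def by (intro sigma_finite_measure.density_unique[OF sigma_finite_lborel]) auto
  thus ?thesis
  proof eventually_elim
    case (elim x)
    thus ?case by (cases "u x" "0::real" rule: linorder_cases) (auto simp: ennreal_neg ennreal_eq_0_iff)
  qed
qed

text \<open>A function whose pairing with every Gaussian vanishes is zero: averaging the Gaussians over
  a box approximates the indicator function of the box.\<close>

lemma gaussian_pairing_zero_imp_zero: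
  fixes g :: "'a::euclidean_space \<Rightarrow> complex"
  assumes [measurable]: "g \<in> borel_measurable borel"
    and int: "\<And>\<tau> y. 0 < \<tau> \<Longrightarrow> integrable lborel (\<lambda>x. g x * of_real (exp (- (norm (x - y))\<^sup>2 / (4 * \<tau>))))"
    and zero: "\<And>\<tau> y. 0 < \<tau> \<Longrightarrow> (LINT x|lborel. g x * of_real (exp (- (norm (x - y))\<^sup>2 / (4 * \<tau>)))) = 0"
  shows "AE x in lborel. g x = 0"
proof -
  have box: "integrable lborel (\<lambda>x. indicator (box a b) x *\<^sub>R g x) \<and> (LINT x|lborel. indicator (box a b) x *\<^sub>R g x) = 0" for a b
  proof -
    define S where "S = box a b"
    have [measurable]: "S \<in> sets borel" by (simp add: S_def)
    obtain R where R: "0 < R" "\<And>y. y \<in> S \<Longrightarrow> norm y \<le> R"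
      using bounded_box[of a b] unfolding S_def[symmetric] bounded_pos by blast
    define \<Phi> where "\<Phi> = (\<lambda>\<tau> x. LINT y|lborel. indicator S y * heat_kernel \<tau> (x - y))"
    \<comment> \<open>A Gaussian that dominates the averages for all times up to \<open>1\<close>; paired with \<open>g\<close> it is integrable by assumption.\<close>
    define w where "w = (\<lambda>x::'a. exp (R\<^sup>2 / 8) * sqrt 2 ^ DIM('a) * exp (- (norm (x - 0))\<^sup>2 / (4 * 4)))"
    have wint: "integrable lborel (\<lambda>x. norm (g x) * w x)"
    proof -
      have "integrable lborel (\<lambda>x. (exp (R\<^sup>2 / 8) * sqrt 2 ^ DIM('a)) * norm (g x * of_real (exp (- (norm (x - 0))\<^sup>2 / (4 * 4)))))"
        by (intro integrable_mult_right integrable_norm int) auto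
      thus ?thesis unfolding w_def by (simp add: norm_mult mult_ac)
    qed
    have split: "r\<^sup>2 / 2 - R\<^sup>2 \<le> s\<^sup>2" if "r \<le> s + R" "0 \<le> r" "0 \<le> s" for r s :: real
    proof -
      have "r\<^sup>2 \<le> (s + R)\<^sup>2" using that by (intro power_mono) auto
      also have "\<dots> \<le> 2 * s\<^sup>2 + 2 * R\<^sup>2" using sum_squares_bound[of s R] by (simp add: power2_sum)
      finally show ?thesis by simp
    qed
    have \<Phi>w: "\<Phi> \<tau> x \<le> w x" if \<tau>: "0 < \<tau>" "\<tau> \<le> 1" for \<tau> x
    proof -
      define r where "r = max 0 (norm x - R)"
      have "r \<le> norm (x - y)" if "y \<in> S" for y
        using norm_triangle_ineq2[of x y] R(2)[OF that] by (auto simp: r_def)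
      hence "\<Phi> \<tau> x \<le> exp (- r\<^sup>2 / (8 * \<tau>)) * sqrt 2 ^ DIM('a)"
        unfolding \<Phi>_def by (intro heat_average(3) \<tau>) (auto simp: r_def)
      also have "\<dots> \<le> exp (- r\<^sup>2 / 8) * sqrt 2 ^ DIM('a)"
      proof -
        have "r\<^sup>2 / 8 \<le> r\<^sup>2 / (8 * \<tau>)" using \<tau> by (intro divide_left_mono) auto
        thus ?thesis by (intro mult_right_mono) auto
      qed
      also have "exp (- r\<^sup>2 / 8) \<le> exp (R\<^sup>2 / 8) * exp (- (norm (x - 0))\<^sup>2 / (4 * 4))"
      proof -
        have "(norm x)\<^sup>2 / 2 - R\<^sup>2 \<le> r\<^sup>2" by (rule split) (auto simp: r_def)
        thus ?thesis by (simp flip: exp_add)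
      qed
      finally show ?thesis by (simp add: w_def mult_ac mult_right_mono)
    qed
    have \<Phi>0: "0 \<le> \<Phi> \<tau> x" if "0 < \<tau>" for \<tau> x unfolding \<Phi>_def by (rule heat_average(2)) (use that in auto)
    have [measurable]: "\<Phi> \<tau> \<in> borel_measurable borel" for \<tau> unfolding \<Phi>_def by measurable
    have zero\<Phi>: "(LINT x|lborel. \<Phi> \<tau> x *\<^sub>R g x) = 0" if \<tau>: "0 < \<tau>" "\<tau> \<le> 1" for \<tau>
    proof -
      have prod: "integrable (lborel \<Otimes>\<^sub>M lborel) (\<lambda>(x, y). (indicator S y * heat_kernel \<tau> (x - y)) *\<^sub>R g x)"
      proof (rule integrable_pair_dominated[OF _ _ _ _ wint])
        show "(\<lambda>(x, y). (indicator S y * heat_kernel \<tau> (x - y)) *\<^sub>R g x) \<in> borel_measurable (lborel \<Otimes>\<^sub>M lborel)" by measurable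
        show "norm ((indicator S y * heat_kernel \<tau> (x - y)) *\<^sub>R g x) \<le> norm (g x) * (indicator S y * heat_kernel \<tau> (x - y))" for x y
          using heat_kernel_nonneg[of \<tau> "x - y"] \<tau> by (simp add: abs_mult)
        show "integrable lborel (\<lambda>y. norm (g x) * (indicator S y * heat_kernel \<tau> (x - y)))" for x
          by (intro integrable_mult_right heat_average(1) \<tau>) measurable
        show "(LINT y|lborel. norm (g x) * (indicator S y * heat_kernel \<tau> (x - y))) \<le> norm (g x) * w x" for x
          unfolding integral_mult_right_zero using \<Phi>w[OF \<tau>, of x] unfolding \<Phi>_def by (intro mult_left_mono) auto
      qed
      have "(LINT x|lborel. \<Phi> \<tau> x *\<^sub>R g x) = (LINT x|lborel. LINT y|lborel. (indicator S y * heat_kernel \<tau> (x - y)) *\<^sub>R g x)"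
      proof (rule Bochner_Integration.integral_cong[OF refl])
        fix x
        show "\<Phi> \<tau> x *\<^sub>R g x = (LINT y|lborel. (indicator S y * heat_kernel \<tau> (x - y)) *\<^sub>R g x)"
          unfolding \<Phi>_def using heat_average(1)[of S \<tau> x] \<tau> by (subst integral_scaleR_left) auto
      qed
      also have "\<dots> = (LINT y|lborel. LINT x|lborel. (indicator S y * heat_kernel \<tau> (x - y)) *\<^sub>R g x)"
        using lborel_pair.Fubini_integral[OF prod] by simp
      also have "\<dots> = (LINT y|lborel. (indicator S y / sqrt (4 * pi * \<tau>) ^ DIM('a)) *\<^sub>R (LINT x|lborel. g x * of_real (exp (- (norm (x - y))\<^sup>2 / (4 * \<tau>)))))"
      proof (rule Bochner_Integration.integral_cong[OF refl])
        fix y :: 'a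
        have "(LINT x|lborel. (indicator S y * heat_kernel \<tau> (x - y)) *\<^sub>R g x)
          = (LINT x|lborel. (indicator S y / sqrt (4 * pi * \<tau>) ^ DIM('a)) *\<^sub>R (g x * of_real (exp (- (norm (x - y))\<^sup>2 / (4 * \<tau>)))))"
          by (intro Bochner_Integration.integral_cong) (auto simp: heat_kernel_def scaleR_conv_of_real)
        thus "(LINT x|lborel. (indicator S y * heat_kernel \<tau> (x - y)) *\<^sub>R g x)
          = (indicator S y / sqrt (4 * pi * \<tau>) ^ DIM('a)) *\<^sub>R (LINT x|lborel. g x * of_real (exp (- (norm (x - y))\<^sup>2 / (4 * \<tau>))))"
          by simp
      qed
      also have "\<dots> = 0" using zero[OF \<tau>(1)] by simp
      finally show ?thesis .
    qed
    define T where "T = (\<lambda>n::nat. inverse (real (Suc n)))"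
    have T: "0 < T n" "T n \<le> 1" for n by (auto simp: T_def field_simps)
    \<comment> \<open>Off the boundary of the box the averages converge to the indicator function as the time tends to \<open>0\<close>.\<close>
    have \<Phi>lim: "(\<lambda>n. \<Phi> (T n) x) \<longlonglongrightarrow> indicator S x" if x: "x \<notin> cbox a b - box a b" for x
    proof -
      have tail: "(\<lambda>n. exp (- e\<^sup>2 / (8 * T n)) * sqrt 2 ^ DIM('a)) \<longlonglongrightarrow> 0" if "e > 0" for e :: real
      proof -
        have "(\<lambda>n. exp (- e\<^sup>2 / (8 * inverse (real (Suc n))))) \<longlonglongrightarrow> 0" using that by real_asymp
        thus ?thesis unfolding T_def by (rule tendsto_mult_left_zero)
      qed
      show ?thesis
      proof (cases "x \<in> S")
        case True
        obtain e where e: "e > 0" "ball x e \<subseteq> S" using True open_box unfolding S_def open_contains_ball by blast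
        have m: "- S \<in> sets borel" by simp
        have "1 - \<Phi> (T n) x = (LINT y|lborel. indicator (- S) y * heat_kernel (T n) (x - y))" for n
        proof -
          have "(LINT y|lborel. indicator S y * heat_kernel (T n) (x - y)) + (LINT y|lborel. indicator (- S) y * heat_kernel (T n) (x - y))
             = (LINT y|lborel. indicator S y * heat_kernel (T n) (x - y) + indicator (- S) y * heat_kernel (T n) (x - y))"
            by (rule Bochner_Integration.integral_add[symmetric, OF heat_average(1)[OF _ T(1)] heat_average(1)[OF m T(1)]]) simp
          also have "\<dots> = (LINT y|lborel. heat_kernel (T n) (x - y))"
            by (intro Bochner_Integration.integral_cong) (auto simp: indicator_def)
          also have "\<dots> = 1" by (rule integrable_heat_kernel(2)[OF T(1)])
          finally show ?thesis unfolding \<Phi>_def by linarith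
        qed
        moreover have "(LINT y|lborel. indicator (- S) y * heat_kernel (T n) (x - y)) \<le> exp (- e\<^sup>2 / (8 * T n)) * sqrt 2 ^ DIM('a)" for n
          by (rule heat_average(3)[OF m T(1)]) (use e in \<open>auto simp: subset_iff dist_norm not_less\<close>)
        moreover have "0 \<le> (LINT y|lborel. indicator (- S) y * heat_kernel (T n) (x - y))" for n
          by (rule heat_average(2)[OF m T(1)])
        ultimately have "(\<lambda>n. 1 - \<Phi> (T n) x) \<longlonglongrightarrow> 0"
          by (intro tendsto_sandwich[OF _ _ tendsto_const tail[OF e(1)]]) auto
        from tendsto_diff[OF tendsto_const[of 1] this] show ?thesis using True by simp
      next
        case False
        hence "x \<in> - cbox a b" using x by (auto simp: S_def)
        moreover have "open (- cbox a b)" using closed_cbox[of a b] by auto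
        ultimately obtain e where e: "e > 0" "ball x e \<subseteq> - cbox a b" unfolding open_contains_ball by blast
        have "\<Phi> (T n) x \<le> exp (- e\<^sup>2 / (8 * T n)) * sqrt 2 ^ DIM('a)" for n
          unfolding \<Phi>_def
        proof (rule heat_average(3)[OF _ T(1)])
          show "e \<le> norm (x - y)" if "y \<in> S" for y
            using e that box_subset_cbox[of a b] by (force simp: S_def dist_norm not_less)
        qed (use e in auto)
        hence "(\<lambda>n. \<Phi> (T n) x) \<longlonglongrightarrow> 0"
          using \<Phi>0[OF T(1)] by (intro tendsto_sandwich[OF _ _ tendsto_const tail[OF e(1)]]) auto
        thus ?thesis using False by simp
      qed
    qed
    have bdry: "AE x in lborel. x \<notin> cbox a b - box a b"
    proof -
      have "negligible (cbox a b - box a b)" by (rule negligible_frontier_interval)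
      hence "cbox a b - box a b \<in> null_sets lebesgue" by (simp add: negligible_iff_null_sets)
      hence "AE x in lebesgue. x \<notin> cbox a b - box a b" by (rule AE_not_in)
      thus ?thesis by (simp add: AE_completion_iff)
    qed
    have ae: "AE x in lborel. (\<lambda>n. \<Phi> (T n) x *\<^sub>R g x) \<longlonglongrightarrow> indicator S x *\<^sub>R g x"
      using bdry by eventually_elim (intro tendsto_scaleR \<Phi>lim tendsto_const)
    have bd: "AE x in lborel. norm (\<Phi> (T n) x *\<^sub>R g x) \<le> norm (g x) * w x" for n
    proof (intro AE_I2)
      fix x
      have "norm (g x) * \<Phi> (T n) x \<le> norm (g x) * w x" by (intro mult_left_mono \<Phi>w T) auto
      thus "norm (\<Phi> (T n) x *\<^sub>R g x) \<le> norm (g x) * w x" using \<Phi>0[OF T(1)] by (simp add: mult.commute)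
    qed
    have "(\<lambda>n. LINT x|lborel. \<Phi> (T n) x *\<^sub>R g x) \<longlonglongrightarrow> (LINT x|lborel. indicator S x *\<^sub>R g x)"
      by (rule integral_dominated_convergence[OF _ _ wint ae bd]) measurable
    hence "(LINT x|lborel. indicator S x *\<^sub>R g x) = 0" using zero\<Phi>[OF T] by (simp add: LIMSEQ_const_iff)
    moreover have "integrable lborel (\<lambda>x. indicator S x *\<^sub>R g x)"
      by (rule integrable_dominated_convergence[OF _ _ wint ae bd]) measurable
    ultimately show ?thesis by (simp add: S_def)
  qed
  have re: "AE x in lborel. Re (g x) = 0"
  proof (rule AE_eq_0_if_box_integrals_0)
    fix a b
    have eq: "Re (indicator (box a b) x *\<^sub>R g x) = indicator (box a b) x * Re (g x)" for x by simp
    show "integrable lborel (\<lambda>x. indicator (box a b) x * Re (g x))"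
      using integrable_Re[OF conjunct1[OF box[of a b]]] unfolding eq .
    show "(LINT x|lborel. indicator (box a b) x * Re (g x)) = 0"
      using integral_Re[OF conjunct1[OF box[of a b]]] conjunct2[OF box[of a b]] unfolding eq by simp
  qed measurable
  have im: "AE x in lborel. Im (g x) = 0"
  proof (rule AE_eq_0_if_box_integrals_0)
    fix a b
    have eq: "Im (indicator (box a b) x *\<^sub>R g x) = indicator (box a b) x * Im (g x)" for x by simp
    show "integrable lborel (\<lambda>x. indicator (box a b) x * Im (g x))"
      using integrable_Im[OF conjunct1[OF box[of a b]]] unfolding eq .
    show "(LINT x|lborel. indicator (box a b) x * Im (g x)) = 0"
      using integral_Im[OF conjunct1[OF box[of a b]]] conjunct2[OF box[of a b]] unfolding eq by simp
  qed measurable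
  from re im show ?thesis by eventually_elim (simp add: complex_eq_iff)
qed

text \<open>The difference of two representatives pairs to zero with all Schwartz functions, in particular with Gaussians.\<close>

lemma represents_unique:
  fixes g1 g2 :: "'a::euclidean_space \<Rightarrow> complex"
  assumes "represents g1 T" "represents g2 T"
  shows "AE x in lborel. g1 x = g2 x"
proof -
  define h where "h = (\<lambda>x. g1 x - g2 x)"
  have hm: "h \<in> borel_measurable lebesgue" using assms unfolding h_def represents_def by auto
  then obtain g where g[measurable]: "g \<in> borel_measurable lborel" and ae: "AE x in lborel. h x = g x"
    using completion_ex_borel_measurable_complex by blast
  have pair: "integrable lborel (\<lambda>x. g x * \<phi> x) \<and> (LINT x|lborel. g x * \<phi> x) = 0" if \<phi>: "schwartz \<phi>" for \<phi>
  proof -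
    have [measurable]: "\<phi> \<in> borel_measurable borel" by (rule schwartz_measurable[OF \<phi>])
    have i: "integrable lebesgue (\<lambda>x. g1 x * \<phi> x)" "integrable lebesgue (\<lambda>x. g2 x * \<phi> x)"
      and e: "(LINT x|lebesgue. g1 x * \<phi> x) = (LINT x|lebesgue. g2 x * \<phi> x)"
      using assms \<phi> unfolding represents_def regular_dist_def by auto
    have hi: "integrable lebesgue (\<lambda>x. h x * \<phi> x)" and hz: "(LINT x|lebesgue. h x * \<phi> x) = 0"
      using i e unfolding h_def by (auto simp: left_diff_distrib)
    have aeL: "AE x in lebesgue. h x * \<phi> x = g x * \<phi> x"
      using AE_completion[OF ae] by eventually_elim simp
    have gm: "(\<lambda>x. g x * \<phi> x) \<in> borel_measurable lborel" by measurable
    have gmL: "(\<lambda>x. g x * \<phi> x) \<in> borel_measurable lebesgue" using gm by (rule measurable_completion)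
    have "integrable lebesgue (\<lambda>x. g x * \<phi> x)"
      using hi by (rule integrable_cong_AE[THEN iffD1, rotated 3]) (use hi gmL aeL in auto)
    moreover have "(LINT x|lebesgue. g x * \<phi> x) = 0"
      using integral_cong_AE[OF _ gmL aeL] hi hz by auto
    ultimately show ?thesis using gm by (simp add: integrable_completion integral_completion)
  qed
  have "AE x in lborel. g x = 0"
    by (rule gaussian_pairing_zero_imp_zero) (use g pair[OF schwartz_heat_kernel] in auto)
  with ae show ?thesis by eventually_elim (simp add: h_def)
qed

section \<open>The heat kernel at complex times\<close>

lemma integral_lborel_prod:
  fixes f :: "'a::euclidean_space \<Rightarrow> real \<Rightarrow> complex"
  assumes "\<And>b. b \<in> Basis \<Longrightarrow> integrable lborel (f b)"
  shows "(LINT x|lborel. (\<Prod>b\<in>Basis. f b (x \<bullet> b))) = (\<Prod>b\<in>Basis. LINT t|lborel. f b t)"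
proof -
  interpret product_sigma_finite "\<lambda>_::'a. lborel :: real measure" ..
  have [measurable]: "f b \<in> borel_measurable borel" if "b \<in> Basis" for b
    using borel_measurable_integrable[OF assms[OF that]] by simp
  have "(LINT x|lborel. (\<Prod>b\<in>Basis. f b (x \<bullet> b)))
     = (LINT y|(\<Pi>\<^sub>M b\<in>(Basis::'a set). lborel). (\<Prod>b\<in>Basis. f b ((\<Sum>b\<in>Basis. y b *\<^sub>R b) \<bullet> b)))"
    by (subst lborel_eq, rule integral_distr) measurable
  also have "\<dots> = (LINT y|(\<Pi>\<^sub>M b\<in>(Basis::'a set). lborel). (\<Prod>b\<in>Basis. f b (y b)))"
    by (intro Bochner_Integration.integral_cong prod.cong) auto
  also have "\<dots> = (\<Prod>b\<in>Basis. LINT t|lborel. f b t)"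
    by (rule product_integral_prod) (use assms in auto)
  finally show ?thesis .
qed

lemma Re_of_real_mult: "Re (of_real r * z) = r * Re z"
  by simp

text \<open>Writing the normalising factor as a power of a square root keeps it holomorphic on the right
  half-plane and a product over the coordinates.\<close>

definition complex_heat_kernel :: "complex \<Rightarrow> 'a::euclidean_space \<Rightarrow> complex" where
  "complex_heat_kernel s x =
     (s powr (-1/2) / of_real (sqrt (4 * pi))) ^ DIM('a) * exp (- of_real ((norm x)\<^sup>2) / (4 * s))"

lemma complex_heat_kernel_measurable [measurable]:
  "(\<lambda>(s, x). complex_heat_kernel s (x::'a::euclidean_space)) \<in> borel_measurable (borel \<Otimes>\<^sub>M borel)"
  unfolding complex_heat_kernel_def powr_def by measurable

text \<open>The integral factorises over the coordinates.\<close>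

lemma complex_heat_kernel_eq_inv_fourier:
  fixes x :: "'a::euclidean_space"
  assumes s: "0 < Re s"
  shows "(LINT \<xi>|lborel. exp (\<i> * of_real (x \<bullet> \<xi>)) * exp (- s * of_real ((norm \<xi>)\<^sup>2))) = (2 * pi) ^ DIM('a) * complex_heat_kernel s x"
proof -
  have "exp (\<i> * of_real (x \<bullet> \<xi>)) * exp (- s * of_real ((norm \<xi>)\<^sup>2))
     = (\<Prod>b\<in>Basis. exp (\<i> * of_real ((x \<bullet> b) * (\<xi> \<bullet> b)) - s * of_real ((\<xi> \<bullet> b)\<^sup>2)))" for \<xi> :: 'a
  proof -
    have "(norm \<xi>)\<^sup>2 = (\<Sum>b\<in>Basis. (\<xi> \<bullet> b)\<^sup>2)"
      unfolding power2_norm_eq_inner by (subst euclidean_inner) (simp add: power2_eq_square)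
    moreover have "x \<bullet> \<xi> = (\<Sum>b\<in>Basis. (x \<bullet> b) * (\<xi> \<bullet> b))" by (rule euclidean_inner)
    ultimately show ?thesis
      by (simp add: exp_sum[symmetric] sum_subtractf sum_negf sum_distrib_left flip: exp_add)
  qed
  hence "(LINT \<xi>|lborel. exp (\<i> * of_real (x \<bullet> \<xi>)) * exp (- s * of_real ((norm \<xi>)\<^sup>2)))
     = (LINT \<xi>|lborel. (\<Prod>b\<in>(Basis::'a set). exp (\<i> * of_real ((x \<bullet> b) * (\<xi> \<bullet> b)) - s * of_real ((\<xi> \<bullet> b)\<^sup>2))))"
    by (simp only:)
  also have "\<dots> = (\<Prod>b\<in>(Basis::'a set). LINT t|lborel. exp (\<i> * of_real ((x \<bullet> b) * t) - s * of_real (t\<^sup>2)))"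
    by (rule integral_lborel_prod) (rule gaussian_fourier_complex(1)[OF s])
  also have "\<dots> = (\<Prod>b\<in>(Basis::'a set). (of_real (sqrt pi) * s powr (-1/2)) * exp (- of_real ((x \<bullet> b)\<^sup>2) / (4 * s)))"
    by (simp only: gaussian_fourier_complex(2)[OF s])
  also have "\<dots> = (of_real (sqrt pi) * s powr (-1/2)) ^ DIM('a) * exp (- of_real ((norm x)\<^sup>2) / (4 * s))"
  proof -
    have "(norm x)\<^sup>2 = (\<Sum>b\<in>Basis. (x \<bullet> b)\<^sup>2)"
      unfolding power2_norm_eq_inner by (subst euclidean_inner) (simp add: power2_eq_square)
    thus ?thesis by (simp add: prod.distrib exp_sum[symmetric] sum_negf sum_divide_distrib)
  qed
  also have "of_real (sqrt pi) * s powr (-1/2) = of_real (2 * pi) * (s powr (-1/2) / of_real (sqrt (4 * pi)))"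
  proof -
    have "sqrt pi * sqrt (4 * pi) = 2 * pi" by (simp add: real_sqrt_mult)
    hence h: "complex_of_real (sqrt pi) * of_real (sqrt (4 * pi)) = of_real (2 * pi)" by (simp only: of_real_mult[symmetric])
    have cancel: "A * z = (A * B) * (z / B)" if "B \<noteq> 0" for A B z :: complex using that by simp
    show ?thesis unfolding h[symmetric] by (rule cancel) simp
  qed
  finally show ?thesis unfolding complex_heat_kernel_def
    by (simp only: of_real_mult of_real_numeral of_real_power power_mult_distrib mult.assoc)
qed

text \<open>In the sector \<open>Re (inverse s) \<ge> \<delta> / norm s\<close> the Gaussian decays like the one at the real time
\<open>norm s / \<delta>\<close>; the normalising factors differ by a power of \<open>\<delta>\<close>.\<close>

lemma norm_complex_heat_kernel_le:
  fixes x :: "'a::euclidean_space"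
  assumes \<delta>: "0 < \<delta>" and s: "0 < Re s" "\<delta> / norm s \<le> Re (inverse s)"
  shows "norm (complex_heat_kernel s x) \<le> (1 / sqrt \<delta>) ^ DIM('a) * heat_kernel (norm s / \<delta>) x"
proof -
  define n where "n = norm s"
  have n: "n > 0" using s unfolding n_def by auto
  have e: "Re (- of_real ((norm x)\<^sup>2) / (4 * s)) \<le> - (norm x)\<^sup>2 / (4 * (n / \<delta>))"
  proof -
    have "- c / (4 * s) = - (c / 4) * inverse s" for c :: complex
      by (simp only: divide_inverse inverse_mult_distrib mult_minus_left mult.assoc)
    hence "- complex_of_real ((norm x)\<^sup>2) / (4 * s) = - (of_real ((norm x)\<^sup>2) / 4) * inverse s" .
    also have "- (complex_of_real ((norm x)\<^sup>2) / 4) = of_real (- ((norm x)\<^sup>2 / 4))"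
      unfolding of_real_minus of_real_divide of_real_numeral ..
    finally have "- complex_of_real ((norm x)\<^sup>2) / (4 * s) = of_real (- ((norm x)\<^sup>2 / 4)) * inverse s" .
    hence "Re (- of_real ((norm x)\<^sup>2) / (4 * s)) = - ((norm x)\<^sup>2 / 4) * Re (inverse s)"
      by (simp only: Re_of_real_mult)
    also have "\<dots> \<le> - ((norm x)\<^sup>2 / 4) * (\<delta> / n)"
      using s(2) unfolding n_def by (intro mult_left_mono_neg) auto
    finally show ?thesis by simp
  qed
  have sq: "norm (s powr (-1/2) / of_real (sqrt (4 * pi))) = 1 / sqrt \<delta> * (1 / sqrt (4 * pi * (n / \<delta>)))"
  proof -
    have r: "complex_of_real (-1/2) = -1/2" by simp
    have "norm (s powr (-1/2)) = n powr (-1/2)"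
      using norm_powr_real_powr'[of "of_real (-1/2)" s] unfolding r n_def by simp
    also have "n powr (-1/2) = inverse (n powr (1/2))" using powr_minus[of n "1/2"] by simp
    also have "\<dots> = 1 / sqrt n" using n by (simp only: powr_half_sqrt less_imp_le inverse_eq_divide)
    finally have 1: "norm (s powr (-1/2)) = 1 / sqrt n" .
    have 2: "sqrt (4 * pi * (n / \<delta>)) = sqrt n * sqrt (4 * pi) / sqrt \<delta>"
      by (simp add: real_sqrt_mult real_sqrt_divide)
    have 3: "norm (complex_of_real (sqrt (4 * pi))) = sqrt (4 * pi)" by simp
    have 4: "1 / a / b = 1 / d * (1 / (a * b / d))" if "d \<noteq> 0" for a b d :: real using that by simp
    show ?thesis unfolding norm_divide 1 2 3 by (rule 4) (use \<delta> in simp)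
  qed
  have "norm (complex_heat_kernel s x) = (1 / sqrt \<delta> * (1 / sqrt (4 * pi * (n / \<delta>)))) ^ DIM('a) * exp (Re (- of_real ((norm x)\<^sup>2) / (4 * s)))"
    unfolding complex_heat_kernel_def norm_mult norm_power sq norm_exp_eq_Re ..
  also have "\<dots> \<le> (1 / sqrt \<delta> * (1 / sqrt (4 * pi * (n / \<delta>)))) ^ DIM('a) * exp (- (norm x)\<^sup>2 / (4 * (n / \<delta>)))"
    using e n \<delta> by (intro mult_left_mono) auto
  also have "\<dots> = (1 / sqrt \<delta>) ^ DIM('a) * heat_kernel (n / \<delta>) x"
  proof -
    have "(A * (1 / B)) ^ N * c = A ^ N * (c / B ^ N)" for A B c :: real and N
      by (simp add: power_mult_distrib power_divide)
    thus ?thesis unfolding heat_kernel_def .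
  qed
  finally show ?thesis unfolding n_def .
qed

lemma integrable_complex_gaussian:
  assumes s: "0 < Re s"
  shows "integrable lborel (\<lambda>\<xi>::'a::euclidean_space. exp (- s * of_real ((norm \<xi>)\<^sup>2)))"
proof -
  have i: "integrable lborel (\<lambda>\<xi>::'a. of_real (exp (- Re s * (norm (\<xi> - 0))\<^sup>2)) :: complex)"
    by (rule schwartz_integrable[OF schwartz_gaussian[OF s]])
  show ?thesis
    by (rule Bochner_Integration.integrable_bound[OF i]) (auto simp: norm_exp_eq_Re)
qed

text \<open>Fubini's theorem moves the inverse Fourier transform from the Gaussian to the test function.\<close>

lemma complex_heat_kernel_pairing:
  fixes \<phi> :: "'a::euclidean_space \<Rightarrow> complex"
  assumes s: "0 < Re s" and \<phi>: "integrable lborel \<phi>"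
  shows "(LINT x|lborel. complex_heat_kernel s x * \<phi> x) = (LINT \<xi>|lborel. exp (- s * of_real ((norm \<xi>)\<^sup>2)) * inv_fourier \<phi> \<xi>)"
proof -
  define E where "E = (\<lambda>\<xi>::'a. exp (- s * of_real ((norm \<xi>)\<^sup>2)))"
  have E: "integrable lborel E" unfolding E_def by (rule integrable_complex_gaussian[OF s])
  have [measurable]: "E \<in> borel_measurable borel" "\<phi> \<in> borel_measurable borel" using E \<phi> by auto
  define c where "c = complex_of_real ((2 * pi) ^ DIM('a))"
  have c: "c \<noteq> 0" by (simp add: c_def)
  have int: "integrable (lborel \<Otimes>\<^sub>M lborel) (\<lambda>(\<xi>, x). E \<xi> * (exp (\<i> * of_real (\<xi> \<bullet> x)) * \<phi> x))"
  proof (rule integrable_pair_dominated)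
    show "norm (E \<xi> * (exp (\<i> * of_real (\<xi> \<bullet> x)) * \<phi> x)) \<le> norm (E \<xi>) * norm (\<phi> x)" for \<xi> x by (simp add: norm_mult)
  qed (use E \<phi> in auto)
  have "c * (LINT \<xi>|lborel. E \<xi> * inv_fourier \<phi> \<xi>) = (LINT \<xi>|lborel. E \<xi> * (LINT x|lborel. exp (\<i> * of_real (\<xi> \<bullet> x)) * \<phi> x))"
  proof -
    have "c * (E \<xi> * inv_fourier \<phi> \<xi>) = E \<xi> * (LINT x|lborel. exp (\<i> * of_real (\<xi> \<bullet> x)) * \<phi> x)" for \<xi>
      using c by (subst inv_fourier_lborel) (auto simp: c_def)
    thus ?thesis unfolding integral_mult_right_zero[symmetric] by (simp only:)
  qed
  also have "\<dots> = (LINT \<xi>|lborel. LINT x|lborel. E \<xi> * (exp (\<i> * of_real (\<xi> \<bullet> x)) * \<phi> x))" by simp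
  also have "\<dots> = (LINT x|lborel. LINT \<xi>|lborel. E \<xi> * (exp (\<i> * of_real (\<xi> \<bullet> x)) * \<phi> x))"
    using lborel_pair.Fubini_integral[OF int] by simp
  also have "\<dots> = (LINT x|lborel. c * (complex_heat_kernel s x * \<phi> x))"
  proof (rule Bochner_Integration.integral_cong[OF refl])
    fix x :: 'a
    have "(LINT \<xi>|lborel. E \<xi> * (exp (\<i> * of_real (\<xi> \<bullet> x)) * \<phi> x)) = (LINT \<xi>|lborel. (exp (\<i> * of_real (x \<bullet> \<xi>)) * E \<xi>) * \<phi> x)"
      by (intro Bochner_Integration.integral_cong) (auto simp: inner_commute mult_ac)
    also have "\<dots> = (LINT \<xi>|lborel. exp (\<i> * of_real (x \<bullet> \<xi>)) * E \<xi>) * \<phi> x" by (rule integral_mult_left_zero)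
    also have "(LINT \<xi>|lborel. exp (\<i> * of_real (x \<bullet> \<xi>)) * E \<xi>) = c * complex_heat_kernel s x"
      unfolding E_def complex_heat_kernel_eq_inv_fourier[OF s] c_def by simp
    finally show "(LINT \<xi>|lborel. E \<xi> * (exp (\<i> * of_real (\<xi> \<bullet> x)) * \<phi> x)) = c * (complex_heat_kernel s x * \<phi> x)"
      by (simp add: mult.assoc)
  qed
  also have "\<dots> = c * (LINT x|lborel. complex_heat_kernel s x * \<phi> x)" by (rule integral_mult_right_zero)
  finally show ?thesis using c by (simp add: E_def)
qed

section \<open>A Gaussian majorant of the fundamental solutions\<close>

text \<open>The kernel \<open>g t\<close> is the mixture of heat kernels at the times \<open>t powr (1 + \<alpha>) * s\<close> with the weights of the
Mittag-Leffler function. Pairing with a Schwartz function \<open>\<phi>\<close> and exchanging integrals twice shows that it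
represents the distribution in \<^const>\<open>G_kernel\<close>; the second exchange needs the inverse Fourier transform
of \<open>\<phi>\<close> to be integrable. Unlike \<^const>\<open>G_kernel\<close>, the function \<open>g\<close> is jointly measurable in time and
space.\<close>

theorem G_kernel_gaussian_majorant:
  fixes \<alpha> \<beta> :: real
  assumes \<alpha>: "0 < \<alpha>" "\<alpha> < 1" and \<beta>: "0 < \<beta>"
  obtains g :: "real \<Rightarrow> 'a::euclidean_space \<Rightarrow> complex" and \<mu> \<tau> :: "real \<times> real \<Rightarrow> real" where
    "(\<lambda>(t, x). g t x) \<in> borel_measurable (borel \<Otimes>\<^sub>M borel)"
    "\<mu> \<in> borel_measurable borel" "\<tau> \<in> borel_measurable borel" "\<And>m. 0 \<le> \<mu> m" "\<And>m. 0 < \<tau> m"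
    "\<And>\<theta>. 0 \<le> \<theta> \<Longrightarrow> \<theta> < 1 \<Longrightarrow> integrable lborel (\<lambda>m. \<mu> m * \<tau> m powr (- \<theta>))"
    "\<And>t. 0 < t \<Longrightarrow> AE x in lborel. G_kernel \<alpha> \<beta> t x = g t x"
    "\<And>t x. 0 < t \<Longrightarrow> ennreal (norm (g t x)) \<le> (\<integral>\<^sup>+m. ennreal (\<mu> m) * ennreal (heat_kernel (t powr (1 + \<alpha>) * \<tau> m) x) \<partial>lborel)"
proof -
  define a where "a = 1 + \<alpha>"
  have a: "1 < a" "a < 2" using \<alpha> by (auto simp: a_def)
  obtain W s :: "real \<times> real \<Rightarrow> complex" and \<delta> :: real where
    \<delta>: "\<delta> > 0" and Wm[measurable]: "W \<in> borel_measurable borel" and sm[measurable]: "s \<in> borel_measurable borel"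
    and sRe: "\<And>m. Re (s m) > 0" and sinv: "\<And>m. Re (inverse (s m)) \<ge> \<delta> / norm (s m)"
    and Wint: "\<And>\<theta>. 0 \<le> \<theta> \<Longrightarrow> \<theta> < 1 \<Longrightarrow> integrable lborel (\<lambda>m. norm (W m) * norm (s m) powr (- \<theta>))"
    and Wrep: "\<And>l. 0 \<le> l \<Longrightarrow> (LINT m|lborel. W m * exp (- s m * of_real l)) = of_real (mittag_leffler a \<beta> (- l))"
    by (rule mittag_leffler_gaussian_mixture[OF a \<beta>]) (rule that)
  have sn: "norm (s m) > 0" for m using sRe[of m] by auto
  define K where "K = (1 / sqrt \<delta>) ^ DIM('a)"
  have K: "0 \<le> K" using \<delta> by (simp add: K_def)
  define \<mu> where "\<mu> = (\<lambda>m. norm (W m) * K)"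
  define \<tau> where "\<tau> = (\<lambda>m. norm (s m) / \<delta>)"
  define g where "g = (\<lambda>t x. LINT m|lborel. W m * complex_heat_kernel (of_real (t powr a) * s m) (x::'a))"
  have \<tau>: "0 < \<tau> m" for m using sn \<delta> by (simp add: \<tau>_def)
  have \<mu>: "0 \<le> \<mu> m" for m using K by (simp add: \<mu>_def)
  have \<mu>m[measurable]: "\<mu> \<in> borel_measurable borel" and \<tau>m[measurable]: "\<tau> \<in> borel_measurable borel"
    unfolding \<mu>_def \<tau>_def by measurable
  have W0: "integrable lborel (\<lambda>m. norm (W m))"
  proof -
    have "norm (s m) powr - 0 = 1" for m using sn[of m] by simp
    thus ?thesis using Wint[of 0] by simp
  qed
  have \<mu>int: "integrable lborel (\<lambda>m. \<mu> m * \<tau> m powr (- \<theta>))" if "0 \<le> \<theta>" "\<theta> < 1" for \<theta>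
  proof -
    have "\<mu> m * \<tau> m powr (- \<theta>) = (K * \<delta> powr \<theta>) * (norm (W m) * norm (s m) powr (- \<theta>))" for m
      using \<delta> sn[of m] by (simp add: \<mu>_def \<tau>_def powr_divide powr_minus field_simps)
    thus ?thesis using integrable_mult_right[OF Wint[OF that], of "K * \<delta> powr \<theta>"] by (simp only:)
  qed
  have scaled: "0 < Re (of_real (t powr a) * s m)" "\<delta> / norm (of_real (t powr a) * s m) \<le> Re (inverse (of_real (t powr a) * s m))"
      "norm (of_real (t powr a) * s m) / \<delta> = t powr a * \<tau> m" if t: "0 < t" for t m
  proof -
    have ta: "0 < t powr a" using t by simp
    show "0 < Re (of_real (t powr a) * s m)" using ta sRe by simp
    have "\<delta> / norm (of_real (t powr a) * s m) = inverse (t powr a) * (\<delta> / norm (s m))"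
      using ta by (simp add: norm_mult divide_inverse mult_ac)
    also have "\<dots> \<le> inverse (t powr a) * Re (inverse (s m))" using ta by (intro mult_left_mono sinv) auto
    also have "\<dots> = Re (of_real (inverse (t powr a)) * inverse (s m))" by (simp only: Re_of_real_mult)
    also have "of_real (inverse (t powr a)) * inverse (s m) = inverse (of_real (t powr a) * s m)" by simp
    finally show "\<delta> / norm (of_real (t powr a) * s m) \<le> Re (inverse (of_real (t powr a) * s m))" .
    show "norm (of_real (t powr a) * s m) / \<delta> = t powr a * \<tau> m" using ta by (simp add: \<tau>_def norm_mult)
  qed
  have hk: "norm (W m * complex_heat_kernel (of_real (t powr a) * s m) x) \<le> \<mu> m * heat_kernel (t powr a * \<tau> m) x"
    if t: "0 < t" for t m and x :: 'a
  proof -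
    have "norm (complex_heat_kernel (of_real (t powr a) * s m) x) \<le> K * heat_kernel (t powr a * \<tau> m) x"
      using norm_complex_heat_kernel_le[OF \<delta> scaled(1,2)[OF t], of m x] unfolding scaled(3)[OF t] K_def .
    hence "norm (W m) * norm (complex_heat_kernel (of_real (t powr a) * s m) x) \<le> norm (W m) * (K * heat_kernel (t powr a * \<tau> m) x)"
      by (rule mult_left_mono) simp
    thus ?thesis unfolding norm_mult[of "W m"] \<mu>_def mult.assoc .
  qed
  have meas: "(\<lambda>(t, x). g t x) \<in> borel_measurable (borel \<Otimes>\<^sub>M borel)"
    unfolding g_def by measurable
  have bound: "ennreal (norm (g t x)) \<le> (\<integral>\<^sup>+m. ennreal (\<mu> m) * ennreal (heat_kernel (t powr (1 + \<alpha>) * \<tau> m) x) \<partial>lborel)" if t: "0 < t" for t x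
  proof -
    have "ennreal (norm (g t x)) \<le> (\<integral>\<^sup>+m. ennreal (norm (W m * complex_heat_kernel (of_real (t powr a) * s m) x)) \<partial>lborel)"
    proof (cases "integrable lborel (\<lambda>m. W m * complex_heat_kernel (of_real (t powr a) * s m) x)")
      case True thus ?thesis unfolding g_def by (rule integral_norm_bound_ennreal)
    next
      case False thus ?thesis unfolding g_def by (simp add: not_integrable_integral_eq)
    qed
    also have "\<dots> \<le> (\<integral>\<^sup>+m. ennreal (\<mu> m) * ennreal (heat_kernel (t powr (1 + \<alpha>) * \<tau> m) x) \<partial>lborel)"
      using hk[OF t] \<mu> unfolding a_def[symmetric] by (intro nn_integral_mono) (simp add: ennreal_mult'[symmetric] ennreal_leI)
    finally show ?thesis .
  qed
  have rep: "represents (g t) (inv_fourier_dist (regular_dist (\<lambda>\<xi>. complex_of_real (mittag_leffler a \<beta> (- (t powr a * (norm \<xi>)\<^sup>2))))))"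
    if t: "0 < t" for t
    unfolding represents_def
  proof (intro conjI allI impI)
    have gm[measurable]: "g t \<in> borel_measurable borel" unfolding g_def by measurable
    show "g t \<in> borel_measurable lebesgue" using gm by (intro measurable_completion) simp
    fix \<phi> :: "'a \<Rightarrow> complex" assume \<phi>: "schwartz \<phi>"
    have [measurable]: "\<phi> \<in> borel_measurable borel" by (rule schwartz_measurable[OF \<phi>])
    note \<phi>i = schwartz_integrable[OF \<phi>]
    define \<psi> where "\<psi> = inv_fourier \<phi>"
    have \<psi>i: "integrable lborel \<psi>" unfolding \<psi>_def by (rule inv_fourier_schwartz_integrable[OF \<phi>])
    have [measurable]: "\<psi> \<in> borel_measurable borel" using \<psi>i by auto
    obtain D where D: "\<And>x. norm (\<phi> x) \<le> D" using schwartz_bounded[OF \<phi>] by blast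
    have D0: "0 \<le> D" using D[of 0] norm_ge_zero order_trans by blast
    \<comment> \<open>The exchange of the integrals over the index and over space.\<close>
    define P where "P = (\<lambda>m x. W m * complex_heat_kernel (of_real (t powr a) * s m) x * \<phi> x)"
    have Pm[measurable]: "(\<lambda>(m, x). P m x) \<in> borel_measurable (lborel \<Otimes>\<^sub>M lborel)" unfolding P_def by measurable
    have ta: "0 < t powr a * \<tau> m" for m using t \<tau> by simp
    have h0: "heat_kernel r (0 - x) = heat_kernel r x" for r and x :: 'a by (simp add: heat_kernel_def)
    have heat: "integrable lborel (\<lambda>x::'a. heat_kernel (t powr a * \<tau> m) x)" for m
      using integrable_heat_kernel(1)[OF ta[of m], of "0::'a"] unfolding h0 .
    have heat1: "(LINT x|lborel. heat_kernel (t powr a * \<tau> m) (x::'a)) = 1" for m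
      using integrable_heat_kernel(2)[OF ta[of m], of "0::'a"] unfolding h0 .
    have Pbd: "norm (P m x) \<le> D * (\<mu> m * heat_kernel (t powr a * \<tau> m) x)" for m x
    proof -
      have "norm (P m x) \<le> (\<mu> m * heat_kernel (t powr a * \<tau> m) x) * D"
        unfolding P_def norm_mult[of _ "\<phi> x"] using hk[OF t, of m x] D[of x] \<mu>[of m] less_imp_le[OF \<tau>[of m]]
        by (intro mult_mono mult_nonneg_nonneg heat_kernel_nonneg) auto
      thus ?thesis by (simp add: mult.commute)
    qed
    have Pint: "integrable (lborel \<Otimes>\<^sub>M lborel) (\<lambda>(m, x). P m x)"
      by (rule integrable_pair_dominated[OF Pm Pbd, where B="\<lambda>m. D * \<mu> m"])
         (use heat heat1 W0 in \<open>auto simp: \<mu>_def\<close>)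
    have gP: "g t x * \<phi> x = (LINT m|lborel. P m x)" for x
      unfolding g_def P_def by (rule integral_mult_left_zero[symmetric])
    have "integrable lborel (\<lambda>x. LINT m|lborel. P m x)"
      using lborel_pair.integrable_snd[of P] Pint by (simp add: case_prod_unfold)
    hence gi: "integrable lborel (\<lambda>x. g t x * \<phi> x)" unfolding gP .
    show "integrable lebesgue (\<lambda>x. g t x * \<phi> x)" using gi by (subst integrable_completion) auto
    \<comment> \<open>The exchange of the integrals over the index and over frequency.\<close>
    define e where "e = (\<lambda>m (\<xi>::'a). exp (- (of_real (t powr a) * s m) * of_real ((norm \<xi>)\<^sup>2)))"
    have em[measurable]: "(\<lambda>(m, \<xi>). e m \<xi>) \<in> borel_measurable (lborel \<Otimes>\<^sub>M lborel)" unfolding e_def by measurable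
    have e1: "norm (e m \<xi>) \<le> 1" for m \<xi>
      unfolding e_def norm_exp_eq_Re using scaled(1)[OF t, of m] by (simp add: Re_of_real_mult)
    have Qint: "integrable (lborel \<Otimes>\<^sub>M lborel) (\<lambda>(m, \<xi>). W m * (e m \<xi> * \<psi> \<xi>))"
    proof (rule integrable_pair_dominated)
      show "norm (W m * (e m \<xi> * \<psi> \<xi>)) \<le> norm (W m) * norm (\<psi> \<xi>)" for m \<xi>
        using e1[of m \<xi>] by (simp add: norm_mult mult_left_mono mult_left_le_one_le)
      show "integrable lborel (\<lambda>m. norm (W m) * (LINT \<xi>|lborel. norm (\<psi> \<xi>)))" using W0 by simp
    qed (use \<psi>i in auto)
    have "regular_dist (g t) \<phi> = (LINT x|lborel. g t x * \<phi> x)"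
      unfolding regular_dist_def by (rule integral_completion) measurable
    also have "\<dots> = (LINT x|lborel. LINT m|lborel. P m x)" unfolding gP ..
    also have "\<dots> = (LINT m|lborel. LINT x|lborel. P m x)"
      by (rule lborel_pair.Fubini_integral[OF Pint])
    also have "\<dots> = (LINT m|lborel. LINT \<xi>|lborel. W m * (e m \<xi> * \<psi> \<xi>))"
    proof (rule Bochner_Integration.integral_cong[OF refl])
      fix m
      have "(LINT x|lborel. P m x) = W m * (LINT x|lborel. complex_heat_kernel (of_real (t powr a) * s m) x * \<phi> x)"
        unfolding P_def mult.assoc by (rule integral_mult_right_zero)
      also have "\<dots> = W m * (LINT \<xi>|lborel. e m \<xi> * \<psi> \<xi>)"
        unfolding e_def \<psi>_def complex_heat_kernel_pairing[OF scaled(1)[OF t] \<phi>i] ..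
      finally show "(LINT x|lborel. P m x) = (LINT \<xi>|lborel. W m * (e m \<xi> * \<psi> \<xi>))"
        by (simp only: integral_mult_right_zero)
    qed
    also have "\<dots> = (LINT \<xi>|lborel. LINT m|lborel. W m * (e m \<xi> * \<psi> \<xi>))"
      by (rule lborel_pair.Fubini_integral[OF Qint, symmetric])
    also have "\<dots> = (LINT \<xi>|lborel. complex_of_real (mittag_leffler a \<beta> (- (t powr a * (norm \<xi>)\<^sup>2))) * \<psi> \<xi>)"
    proof (rule Bochner_Integration.integral_cong[OF refl])
      fix \<xi> :: 'a
      have "W m * (e m \<xi> * \<psi> \<xi>) = W m * exp (- s m * of_real (t powr a * (norm \<xi>)\<^sup>2)) * \<psi> \<xi>" for m
        unfolding e_def by (simp add: mult_ac)
      hence "(LINT m|lborel. W m * (e m \<xi> * \<psi> \<xi>)) = (LINT m|lborel. W m * exp (- s m * of_real (t powr a * (norm \<xi>)\<^sup>2))) * \<psi> \<xi>"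
        by (simp only: integral_mult_left_zero)
      also have "\<dots> = of_real (mittag_leffler a \<beta> (- (t powr a * (norm \<xi>)\<^sup>2))) * \<psi> \<xi>"
        by (subst Wrep) auto
      finally show "(LINT m|lborel. W m * (e m \<xi> * \<psi> \<xi>)) = of_real (mittag_leffler a \<beta> (- (t powr a * (norm \<xi>)\<^sup>2))) * \<psi> \<xi>" .
    qed
    also have "\<dots> = (LINT \<xi>|lebesgue. complex_of_real (mittag_leffler a \<beta> (- (t powr a * (norm \<xi>)\<^sup>2))) * \<psi> \<xi>)"
    proof (rule integral_completion[symmetric])
      have "(\<lambda>\<xi>::'a. LINT m|lborel. W m * exp (- s m * of_real (t powr a * (norm \<xi>)\<^sup>2))) \<in> borel_measurable borel"
        by measurable
      hence "(\<lambda>\<xi>::'a. complex_of_real (mittag_leffler a \<beta> (- (t powr a * (norm \<xi>)\<^sup>2)))) \<in> borel_measurable borel"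
        by (subst (asm) Wrep) auto
      thus "(\<lambda>\<xi>. complex_of_real (mittag_leffler a \<beta> (- (t powr a * (norm \<xi>)\<^sup>2))) * \<psi> \<xi>) \<in> borel_measurable lborel"
        by measurable
    qed
    also have "\<dots> = inv_fourier_dist (regular_dist (\<lambda>\<xi>. complex_of_real (mittag_leffler a \<beta> (- (t powr a * (norm \<xi>)\<^sup>2))))) \<phi>"
      unfolding inv_fourier_dist_def regular_dist_def \<psi>_def ..
    finally show "regular_dist (g t) \<phi> = inv_fourier_dist (regular_dist (\<lambda>\<xi>. complex_of_real (mittag_leffler a \<beta> (- (t powr a * (norm \<xi>)\<^sup>2))))) \<phi>" .
  qed
  have ae: "AE x in lborel. G_kernel \<alpha> \<beta> t x = g t x" if t: "0 < t" for t
  proof (rule represents_unique)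
    show "represents (g t) (inv_fourier_dist (regular_dist (\<lambda>\<xi>::'a. complex_of_real (mittag_leffler a \<beta> (- (t powr a * (norm \<xi>)\<^sup>2))))))"
      by (rule rep[OF t])
    show "represents (G_kernel \<alpha> \<beta> t) (inv_fourier_dist (regular_dist (\<lambda>\<xi>::'a. complex_of_real (mittag_leffler a \<beta> (- (t powr a * (norm \<xi>)\<^sup>2))))))"
      unfolding G_kernel_def a_def by (rule someI[where P="\<lambda>g. represents g _"]) (rule rep[OF t, unfolded a_def])
  qed
  show thesis by (rule that[OF meas \<mu>m \<tau>m \<mu> \<tau> \<mu>int ae bound])
qed

section \<open>The time integral in Duhamel's formula\<close>

text \<open>The growth rate of the integral of \<open>(t - s) powr \<kappa> * (1 + s) powr - \<eta>\<close> over \<open>{0..t}\<close>.\<close>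

definition duhamel_rate :: "real \<Rightarrow> real \<Rightarrow> real \<Rightarrow> real" where
  "duhamel_rate \<kappa> \<eta> t = (if \<eta> > 1 then (1 + t) powr \<kappa>
     else if \<eta> = 1 then (1 + t) powr \<kappa> * ln (exp 1 + t)
     else (1 + t) powr (1 - \<eta> + \<kappa>))"

lemma powr_comparable:
  fixes x y e :: real
  assumes "0 < x" "x \<le> 2 * y" "y \<le> 2 * x"
  shows "x powr e \<le> 2 powr \<bar>e\<bar> * y powr e"
proof (cases "0 \<le> e")
  case True
  have "x powr e \<le> (2 * y) powr e" using assms True by (intro powr_mono2) auto
  thus ?thesis using True assms by (simp add: powr_mult)
next
  case False
  have "x powr e \<le> (y / 2) powr e" using assms False by (intro powr_mono2') auto
  also have "(y / 2) powr e = y powr e / 2 powr e" using assms by (intro powr_divide)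
  also have "\<dots> = 2 powr (- e) * y powr e" unfolding powr_minus_divide by simp
  finally show ?thesis using False by simp
qed

lemma nn_integral_reflected_powr:
  assumes \<kappa>: "- 1 < \<kappa>" and t: "0 \<le> t"
  shows "(\<integral>\<^sup>+s. indicator {0..t} s * ennreal ((t - s) powr \<kappa>) \<partial>lborel) = ennreal (t powr (\<kappa> + 1) / (\<kappa> + 1))"
proof -
  have "(\<integral>\<^sup>+s. indicator {0..t} s * ennreal ((t - s) powr \<kappa>) \<partial>lborel)
     = ennreal \<bar>-1\<bar> * (\<integral>\<^sup>+s. indicator {0..t} (t + (-1) * s) * ennreal ((t - (t + (-1) * s)) powr \<kappa>) \<partial>lborel)"
    by (rule nn_integral_real_affine) auto
  also have "\<dots> = (\<integral>\<^sup>+s. indicator {0..t} s * ennreal (s powr \<kappa>) \<partial>lborel)"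
    by (auto intro!: nn_integral_cong simp: indicator_def)
  also have "\<dots> = (\<integral>\<^sup>+s. ennreal (indicator {0..t} s * s powr \<kappa>) \<partial>lborel)"
    by (auto intro!: nn_integral_cong simp: indicator_def)
  also have "\<dots> = ennreal (t powr (\<kappa> + 1) / (\<kappa> + 1))"
    by (rule nn_integral_has_integral_lebesgue[OF _ has_integral_powr_from_0[OF \<kappa> t]]) auto
  finally show ?thesis .
qed

text \<open>Only for \<open>t \<ge> 1\<close>; for small \<open>t\<close> the integral is compared with \<open>t\<close> itself, which is needed to compensate
a negative power of \<open>t\<close>.\<close>

lemma integral_one_plus_powr_bound:
  fixes \<eta> :: real
  obtains C where "0 < C"
    "\<And>t. 1 \<le> t \<Longrightarrow> (\<integral>\<^sup>+s. indicator {0..t} s * ennreal ((1 + s) powr (- \<eta>)) \<partial>lborel)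
        \<le> ennreal (C * duhamel_rate 0 \<eta> t)"
proof -
  define P where "P = (\<lambda>s. if \<eta> = 1 then ln (1 + s) else (1 + s) powr (1 - \<eta>) / (1 - \<eta>))"
  define C where "C = (if \<eta> = 1 then 1 else 1 / \<bar>1 - \<eta>\<bar>)"
  have int: "(\<integral>\<^sup>+s. indicator {0..t} s * ennreal ((1 + s) powr (- \<eta>)) \<partial>lborel) = ennreal (P t - P 0)" if t: "0 \<le> t" for t
  proof -
    have "((\<lambda>s. (1 + s) powr (- \<eta>)) has_integral (P t - P 0)) {0..t}"
    proof (rule fundamental_theorem_of_calculus[OF t])
      fix s assume s: "s \<in> {0..t}"
      have "(P has_real_derivative (1 + s) powr (- \<eta>)) (at s within {0..t})"
      proof (cases "\<eta> = 1")
        case True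
        have "((\<lambda>s. ln (1 + s)) has_real_derivative (1 / (1 + s)) * 1) (at s within {0..t})"
          using s by (auto intro!: derivative_eq_intros)
        thus ?thesis using True s by (simp add: P_def powr_minus powr_one divide_inverse)
      next
        case False
        have "((\<lambda>s. (1 + s) powr (1 - \<eta>)) has_real_derivative ((1 - \<eta>) * (1 + s) powr (1 - \<eta> - 1)) * 1) (at s)"
          by (rule DERIV_chain2[OF has_real_derivative_powr]) (use s in \<open>auto intro!: derivative_eq_intros\<close>)
        from DERIV_cdivide[OF has_field_derivative_at_within[OF this], of "1 - \<eta>"] show ?thesis using False by (simp add: P_def)
      qed
      thus "(P has_vector_derivative (1 + s) powr (- \<eta>)) (at s within {0..t})"
        by (simp add: has_real_derivative_iff_has_vector_derivative)
    qed
    from nn_integral_has_integral_lebesgue[OF _ this]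
    have "(\<integral>\<^sup>+s. ennreal (indicator {0..t} s * (1 + s) powr (- \<eta>)) \<partial>lborel) = ennreal (P t - P 0)" by simp
    moreover have "(\<integral>\<^sup>+s. ennreal (indicator {0..t} s * (1 + s) powr (- \<eta>)) \<partial>lborel) = (\<integral>\<^sup>+s. indicator {0..t} s * ennreal ((1 + s) powr (- \<eta>)) \<partial>lborel)"
      by (auto intro!: nn_integral_cong simp: indicator_def)
    ultimately show ?thesis by simp
  qed
  have le: "P t - P 0 \<le> C * duhamel_rate 0 \<eta> t" if t: "1 \<le> t" for t
  proof -
    consider "\<eta> > 1" | "\<eta> = 1" | "\<eta> < 1" by linarith
    thus ?thesis
    proof cases
      case 1
      hence "(1 + t) powr (1 - \<eta>) / (1 - \<eta>) \<le> 0" by (intro divide_nonneg_neg) auto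
      moreover have "1 / (1 - \<eta>) = - (1 / \<bar>1 - \<eta>\<bar>)" using 1 by (simp add: divide_simps)
      ultimately show ?thesis using 1 t by (simp add: P_def C_def duhamel_rate_def)
    next
      case 2
      have "ln (1 + t) \<le> ln (exp 1 + t)" using t exp_ge_add_one_self[of "1::real"] by simp
      thus ?thesis using 2 t by (simp add: P_def C_def duhamel_rate_def)
    next
      case 3
      hence "0 \<le> 1 / (1 - \<eta>)" by simp
      thus ?thesis using 3 t by (simp add: P_def C_def duhamel_rate_def)
    qed
  qed
  show thesis
  proof (rule that[of C])
    show "0 < C" by (simp add: C_def)
    show "(\<integral>\<^sup>+s. indicator {0..t} s * ennreal ((1 + s) powr (- \<eta>)) \<partial>lborel) \<le> ennreal (C * duhamel_rate 0 \<eta> t)"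
      if "1 \<le> t" for t
      using int[of t] le[OF that] that by (simp add: ennreal_leI)
  qed
qed

lemma duhamel_rate_mult: "0 < t \<Longrightarrow> (1 + t) powr \<kappa> * duhamel_rate 0 \<eta> t = duhamel_rate \<kappa> \<eta> t"
  by (simp add: duhamel_rate_def powr_add mult.commute)

lemma ln_exp_1_plus_ge_1: "0 \<le> (t::real) \<Longrightarrow> 1 \<le> ln (exp 1 + t)"
  using ln_mono[of "exp (1::real)" "exp 1 + t"] by (simp add: add_pos_nonneg)

lemma duhamel_rate_ge:
  assumes t: "0 < t"
  shows "(1 + t) powr (\<kappa> + 1 - \<eta>) \<le> duhamel_rate \<kappa> \<eta> t"
proof -
  have "(1 + t) powr (\<kappa> + 1 - \<eta>) \<le> (1 + t) powr \<kappa>" if "1 \<le> \<eta>" using that t by (intro powr_mono) auto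
  moreover have "(1 + t) powr \<kappa> * 1 \<le> (1 + t) powr \<kappa> * ln (exp 1 + t)"
    using ln_exp_1_plus_ge_1[of t] t by (intro mult_left_mono) auto
  ultimately show ?thesis by (auto simp: duhamel_rate_def algebra_simps)
qed

lemma duhamel_rate_lower:
  obtains c where "0 < c" "\<And>t. 0 < t \<Longrightarrow> t \<le> 1 \<Longrightarrow> c \<le> duhamel_rate \<kappa> \<eta> t"
proof (rule that[of "2 powr (- \<bar>\<kappa> + 1 - \<eta>\<bar>)"])
  fix t :: real assume t: "0 < t" "t \<le> 1"
  have "1 = (1::real) powr (\<kappa> + 1 - \<eta>)" by simp
  also have "\<dots> \<le> 2 powr \<bar>\<kappa> + 1 - \<eta>\<bar> * (1 + t) powr (\<kappa> + 1 - \<eta>)"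
    using t by (intro powr_comparable) auto
  finally have "2 powr (- \<bar>\<kappa> + 1 - \<eta>\<bar>) \<le> (1 + t) powr (\<kappa> + 1 - \<eta>)" by (simp add: powr_minus field_simps)
  thus "2 powr (- \<bar>\<kappa> + 1 - \<eta>\<bar>) \<le> duhamel_rate \<kappa> \<eta> t" using duhamel_rate_ge[OF t(1), of \<kappa> \<eta>] by linarith
qed simp

text \<open>On the half of the interval near \<open>t\<close> the factor \<open>(1 + s) powr - \<eta>\<close> is comparable to its value
  at \<open>t\<close>, on the half near \<open>0\<close> the factor \<open>(t - s) powr \<kappa>\<close> is comparable to \<open>t powr \<kappa>\<close>.\<close>

lemma duhamel_time_integral:
  assumes \<kappa>: "- 1 < \<kappa>"
  obtains C where "0 < C"
    "\<And>t. 0 < t \<Longrightarrow> (\<integral>\<^sup>+s. indicator {0..t} s * ennreal ((t - s) powr \<kappa> * (1 + s) powr (- \<eta>)) \<partial>lborel)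
        \<le> ennreal (C * duhamel_rate \<kappa> \<eta> t)"
proof -
  define E where "E = 2 powr \<bar>\<eta>\<bar>"
  define D where "D = 2 powr \<bar>\<kappa>\<bar>"
  have ED: "0 < E" "0 < D" by (auto simp: E_def D_def)
  obtain C1 where C1: "0 < C1" "\<And>t. 1 \<le> t \<Longrightarrow> (\<integral>\<^sup>+s. indicator {0..t} s * ennreal ((1 + s) powr (- \<eta>)) \<partial>lborel)
        \<le> ennreal (C1 * duhamel_rate 0 \<eta> t)" using integral_one_plus_powr_bound[of \<eta>] by metis
  obtain c where c: "0 < c" "\<And>t. 0 < t \<Longrightarrow> t \<le> 1 \<Longrightarrow> c \<le> duhamel_rate \<kappa> \<eta> t" using duhamel_rate_lower[of \<kappa> \<eta>] by metis
  \<comment> \<open>\<open>D * (E / c)\<close> is for \<open>t \<le> 1\<close>, where the rate is at least \<open>c\<close>; \<open>D * (D * C1)\<close> is for \<open>t \<ge> 1\<close>.\<close>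
  define C2 where "C2 = D * (E / c + D * C1)"
  have C2: "0 < C2" using ED c C1 by (auto simp: C2_def intro!: mult_pos_pos add_pos_pos)
  define C where "C = E / (\<kappa> + 1) + C2"
  define L where "L = (\<lambda>t. \<integral>\<^sup>+s. indicator {0..t} s * ennreal ((1 + s) powr (- \<eta>)) \<partial>lborel)"
  have near: "ennreal (D * t powr \<kappa>) * L t \<le> ennreal (C2 * duhamel_rate \<kappa> \<eta> t)" if t: "0 < t" for t
  proof (cases "t \<le> 1")
    case True
    have "L t \<le> (\<integral>\<^sup>+s. ennreal E * indicator {0..t} s \<partial>lborel)" unfolding L_def
    proof (intro nn_integral_mono)
      fix s
      show "indicator {0..t} s * ennreal ((1 + s) powr (- \<eta>)) \<le> ennreal E * indicator {0..t} s"
      proof (cases "s \<in> {0..t}")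
        case s: True
        have "(1 + s) powr (- \<eta>) \<le> 2 powr \<bar>- \<eta>\<bar> * 1 powr (- \<eta>)"
          using s True by (intro powr_comparable) auto
        thus ?thesis using s by (simp add: E_def ennreal_leI)
      qed auto
    qed
    also have "\<dots> = ennreal (E * t)" using ED t by (simp add: nn_integral_cmult_indicator ennreal_mult)
    finally have "ennreal (D * t powr \<kappa>) * L t \<le> ennreal (D * t powr \<kappa>) * ennreal (E * t)" by (intro mult_left_mono) auto
    also have "\<dots> = ennreal (D * E * t powr (\<kappa> + 1))" using ED t by (simp add: powr_add mult_ac flip: ennreal_mult)
    also have "\<dots> \<le> ennreal (D * E * 1)"
      using ED t True \<kappa> powr_mono2[of "\<kappa> + 1" t 1] by (intro ennreal_leI mult_left_mono) auto
    also have "\<dots> \<le> ennreal (C2 * c)"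
      using ED c C1 by (intro ennreal_leI) (simp add: C2_def field_simps)
    also have "\<dots> \<le> ennreal (C2 * duhamel_rate \<kappa> \<eta> t)" using C2 c(2)[OF t True] by (intro ennreal_leI mult_left_mono) auto
    finally show ?thesis .
  next
    case False
    hence t1: "1 \<le> t" by simp
    have pos: "0 \<le> duhamel_rate \<kappa> \<eta> t" for \<kappa> using duhamel_rate_ge[OF t, of \<kappa> \<eta>] powr_ge_zero order_trans by blast
    have "ennreal (D * t powr \<kappa>) * L t \<le> ennreal (D * (D * (1 + t) powr \<kappa>)) * ennreal (C1 * duhamel_rate 0 \<eta> t)"
      unfolding L_def D_def using t t1 by (intro mult_mono C1 ennreal_leI mult_left_mono powr_comparable) auto
    also have "\<dots> = ennreal (D * D * C1 * duhamel_rate \<kappa> \<eta> t)"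
      using ED C1 pos[of 0] duhamel_rate_mult[OF t, of \<kappa> \<eta>, symmetric] by (simp add: mult_ac flip: ennreal_mult)
    also have "\<dots> \<le> ennreal (C2 * duhamel_rate \<kappa> \<eta> t)"
      using ED c pos by (intro ennreal_leI mult_right_mono) (auto simp: C2_def distrib_left)
    finally show ?thesis .
  qed
  show thesis
  proof (rule that[of C])
    have "0 < E / (\<kappa> + 1)" using ED \<kappa> by simp
    thus "0 < C" using C2 by (simp add: C_def)
    fix t :: real assume t: "0 < t"
    have pos: "0 \<le> duhamel_rate \<kappa> \<eta> t" using duhamel_rate_ge[OF t, of \<kappa> \<eta>] powr_ge_zero order_trans by blast
    have pt: "indicator {0..t} s * ennreal ((t - s) powr \<kappa> * (1 + s) powr (- \<eta>))
      \<le> ennreal (E * (1 + t) powr (- \<eta>)) * (indicator {0..t} s * ennreal ((t - s) powr \<kappa>))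
        + ennreal (D * t powr \<kappa>) * (indicator {0..t} s * ennreal ((1 + s) powr (- \<eta>)))" for s
    proof (cases "s \<in> {0..t}")
      case s: True
      have "(t - s) powr \<kappa> * (1 + s) powr (- \<eta>) \<le> E * (1 + t) powr (- \<eta>) * (t - s) powr \<kappa> + D * t powr \<kappa> * (1 + s) powr (- \<eta>)"
      proof (cases "t \<le> 2 * s")
        case True
        have "(1 + s) powr (- \<eta>) \<le> 2 powr \<bar>- \<eta>\<bar> * (1 + t) powr (- \<eta>)"
          using s True by (intro powr_comparable) auto
        hence "(t - s) powr \<kappa> * (1 + s) powr (- \<eta>) \<le> (t - s) powr \<kappa> * (E * (1 + t) powr (- \<eta>))"
          unfolding E_def by (intro mult_left_mono) auto
        moreover have "0 \<le> D * t powr \<kappa> * (1 + s) powr (- \<eta>)" using ED by simp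
        ultimately show ?thesis by (simp add: mult_ac)
      next
        case False
        have "(t - s) powr \<kappa> \<le> D * t powr \<kappa>"
          unfolding D_def using s False t by (intro powr_comparable) auto
        hence "(t - s) powr \<kappa> * (1 + s) powr (- \<eta>) \<le> D * t powr \<kappa> * (1 + s) powr (- \<eta>)"
          by (intro mult_right_mono) auto
        moreover have "0 \<le> E * (1 + t) powr (- \<eta>) * (t - s) powr \<kappa>" using ED by simp
        ultimately show ?thesis by linarith
      qed
      thus ?thesis using s ED by (simp add: ennreal_leI flip: ennreal_mult ennreal_plus)
    qed auto
    have "(\<integral>\<^sup>+s. indicator {0..t} s * ennreal ((t - s) powr \<kappa> * (1 + s) powr (- \<eta>)) \<partial>lborel)
       \<le> (\<integral>\<^sup>+s. ennreal (E * (1 + t) powr (- \<eta>)) * (indicator {0..t} s * ennreal ((t - s) powr \<kappa>))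
        + ennreal (D * t powr \<kappa>) * (indicator {0..t} s * ennreal ((1 + s) powr (- \<eta>))) \<partial>lborel)"
      by (intro nn_integral_mono pt)
    also have "\<dots> = ennreal (E * (1 + t) powr (- \<eta>)) * ennreal (t powr (\<kappa> + 1) / (\<kappa> + 1)) + ennreal (D * t powr \<kappa>) * L t"
      using t by (subst nn_integral_add) (auto simp: nn_integral_cmult nn_integral_reflected_powr[OF \<kappa>] L_def)
    also have "\<dots> \<le> ennreal (E / (\<kappa> + 1) * duhamel_rate \<kappa> \<eta> t) + ennreal (C2 * duhamel_rate \<kappa> \<eta> t)"
    proof (intro add_mono near t)
      have "(1 + t) powr (- \<eta>) * t powr (\<kappa> + 1) \<le> (1 + t) powr (- \<eta>) * (1 + t) powr (\<kappa> + 1)"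
        using t \<kappa> by (intro mult_left_mono powr_mono2) auto
      also have "\<dots> = (1 + t) powr (\<kappa> + 1 - \<eta>)" by (simp flip: powr_add)
      also have "\<dots> \<le> duhamel_rate \<kappa> \<eta> t" by (rule duhamel_rate_ge[OF t])
      finally have "E / (\<kappa> + 1) * ((1 + t) powr (- \<eta>) * t powr (\<kappa> + 1)) \<le> E / (\<kappa> + 1) * duhamel_rate \<kappa> \<eta> t"
        using ED \<kappa> by (intro mult_left_mono) auto
      thus "ennreal (E * (1 + t) powr (- \<eta>)) * ennreal (t powr (\<kappa> + 1) / (\<kappa> + 1)) \<le> ennreal (E / (\<kappa> + 1) * duhamel_rate \<kappa> \<eta> t)"
        using ED \<kappa> by (simp add: ennreal_leI mult_ac flip: ennreal_mult)
    qed
    also have "\<dots> = ennreal (C * duhamel_rate \<kappa> \<eta> t)"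
      using ED \<kappa> C2 pos by (simp add: C_def distrib_right flip: ennreal_plus)
    finally show "(\<integral>\<^sup>+s. indicator {0..t} s * ennreal ((t - s) powr \<kappa> * (1 + s) powr (- \<eta>)) \<partial>lborel) \<le> ennreal (C * duhamel_rate \<kappa> \<eta> t)" .
  qed
qed

section \<open>Convolution with the fundamental solutions\<close>

text \<open>A choice of representative such as \<^const>\<open>G_kernel\<close> is Lebesgue measurable by completeness.\<close>

lemma borel_measurable_completion_AE:
  fixes f g :: "'a \<Rightarrow> 'b::topological_space"
  assumes g[measurable]: "g \<in> borel_measurable (completion M)" and ae: "AE x in M. f x = g x"
  shows "f \<in> borel_measurable (completion M)"
proof (rule borel_measurableI)
  fix S :: "'b set" assume "open S"
  hence S[measurable]: "S \<in> sets borel" by simp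
  have 1: "Measurable.pred (completion M) (\<lambda>x. f x \<noteq> g x)"
    by (rule sets_completion_AE) (use ae in auto)
  have 2: "Measurable.pred (completion M) (\<lambda>x. f x \<noteq> g x \<and> f x \<in> S)"
    by (rule sets_completion_AE) (use ae in \<open>eventually_elim, auto\<close>)
  have 3: "Measurable.pred (completion M) (\<lambda>x. g x \<in> S)" by measurable
  have "Measurable.pred (completion M) (\<lambda>x. (f x \<noteq> g x \<and> f x \<in> S) \<or> (\<not> (f x \<noteq> g x) \<and> g x \<in> S))"
    using 1 2 3 by measurable
  moreover have "(f x \<noteq> g x \<and> f x \<in> S) \<or> (\<not> (f x \<noteq> g x) \<and> g x \<in> S) \<longleftrightarrow> f x \<in> S" for x by auto
  ultimately have "Measurable.pred (completion M) (\<lambda>x. f x \<in> S)" by simp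
  thus "f -` S \<inter> space (completion M) \<in> sets (completion M)"
    by (simp add: pred_def vimage_def Int_def conj_commute)
qed

lemma integral_completion_AE_cong:
  fixes f g :: "'a \<Rightarrow> 'b::{banach, second_countable_topology}"
  assumes g: "g \<in> borel_measurable M" and ae: "AE x in M. f x = g x"
  shows "(LINT x|completion M. f x) = (LINT x|M. g x)"
proof -
  have gc: "g \<in> borel_measurable (completion M)" using g by (rule measurable_completion)
  have "(LINT x|completion M. f x) = (LINT x|completion M. g x)"
    by (rule integral_cong_AE[OF borel_measurable_completion_AE[OF gc ae] gc AE_completion[OF ae]])
  also have "\<dots> = (LINT x|M. g x)" using g by (rule integral_completion)
  finally show ?thesis .
qed

text \<open>Null sets are invariant under \<open>y \<mapsto> x - y\<close>.\<close>

lemma AE_lborel_reflect: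
  fixes x :: "'a::euclidean_space"
  assumes "AE z in lborel. P z" shows "AE y in lborel. P (x - y)"
proof -
  have e: "lborel = distr lborel borel (\<lambda>y::'a. x + (- 1) *\<^sub>R y)"
    by (subst lborel_affine[of "-1" x]) (auto simp: density_1)
  have "AE z in distr lborel borel (\<lambda>y::'a. x + (- 1) *\<^sub>R y). P z" using assms unfolding e[symmetric] .
  from AE_distrD[OF _ this] show ?thesis by simp
qed

text \<open>Convolutions see their factors up to null sets only, at every single point \<open>x\<close>.\<close>

lemma conv_cong_AE:
  fixes G h g h' :: "'a::euclidean_space \<Rightarrow> complex"
  assumes "AE x in lborel. G x = g x" "AE x in lborel. h x = h' x"
    and [measurable]: "g \<in> borel_measurable borel" "h' \<in> borel_measurable borel"
  shows "conv G h x = (LINT y|lborel. g (x - y) * h' y)"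
  unfolding conv_def
proof (rule integral_completion_AE_cong)
  show "AE y in lborel. G (x - y) * h y = g (x - y) * h' y"
    using AE_lborel_reflect[OF assms(1), of x] assms(2) by eventually_elim simp
qed measurable

lemma norm_integral_le_nn_integral:
  fixes f :: "'a \<Rightarrow> 'b::{banach, second_countable_topology}"
  shows "ennreal (norm (LINT x|M. f x)) \<le> (\<integral>\<^sup>+x. ennreal (norm (f x)) \<partial>M)"
proof (cases "integrable M f")
  case True thus ?thesis by (rule integral_norm_bound_ennreal)
next
  case False thus ?thesis by (simp add: not_integrable_integral_eq)
qed

text \<open>A mixture of heat semigroups, with weights \<open>\<mu>\<close> and times \<open>\<tau>\<close> scaled by \<open>T\<close>.\<close>

definition heat_mixture ::
  "(real \<times> real \<Rightarrow> real) \<Rightarrow> (real \<times> real \<Rightarrow> real) \<Rightarrow> real \<Rightarrow> ('a::euclidean_space \<Rightarrow> ennreal) \<Rightarrow> 'a \<Rightarrow> ennreal" where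
  "heat_mixture \<mu> \<tau> T F x =
     (\<integral>\<^sup>+m. ennreal (\<mu> m) * (\<integral>\<^sup>+y. ennreal (heat_kernel (T * \<tau> m) (x - y)) * F y \<partial>lborel) \<partial>lborel)"

lemma measurable_heat_mixture [measurable (raw)]:
  assumes [measurable]: "\<mu> \<in> borel_measurable borel" "\<tau> \<in> borel_measurable borel" "T \<in> borel_measurable M"
    "X \<in> borel_measurable M" "(\<lambda>(z, y). F z y) \<in> borel_measurable (M \<Otimes>\<^sub>M borel)"
  shows "(\<lambda>z. heat_mixture \<mu> \<tau> (T z) (F z) (X z)) \<in> borel_measurable M"
  unfolding heat_mixture_def by measurable

text \<open>Minkowski's inequality over the index of the mixture, with the smoothing estimate for each time.\<close>

lemma Lq_le_heat_mixture:
  fixes F :: "'a::euclidean_space \<Rightarrow> ennreal"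
  defines "\<Theta> \<equiv> \<lambda>r q. real DIM('a) / 2 * (real_of_ereal (1 / r) - real_of_ereal (1 / q))"
  assumes \<mu>: "\<mu> \<in> borel_measurable borel" "\<And>m. 0 \<le> \<mu> m" and \<tau>: "\<tau> \<in> borel_measurable borel" "\<And>m. 0 < \<tau> m"
    and int: "integrable lborel (\<lambda>m. \<mu> m * \<tau> m powr (- \<Theta> r q))"
    and T: "0 < T" and rq: "1 \<le> r" "r \<le> q"
    and F: "F \<in> borel_measurable borel" "Lq_le r F B" and B: "0 \<le> B"
  shows "Lq_le q (heat_mixture \<mu> \<tau> T F)
    ((4 * pi) powr (- \<Theta> r q) * (LINT m|lborel. \<mu> m * \<tau> m powr (- \<Theta> r q)) * T powr (- \<Theta> r q) * B)"
proof -
  note [measurable] = \<mu>(1) \<tau>(1) F(1)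
  define I where "I = (LINT m|lborel. \<mu> m * \<tau> m powr (- \<Theta> r q))"
  define b where "b = (\<lambda>m. (4 * pi) powr (- \<Theta> r q) * T powr (- \<Theta> r q) * B * (\<mu> m * \<tau> m powr (- \<Theta> r q)))"
  have "Lq_le q (\<lambda>x. \<integral>\<^sup>+m. ennreal (\<mu> m) * (\<integral>\<^sup>+y. ennreal (heat_kernel (T * \<tau> m) (x - y)) * F y \<partial>lborel) \<partial>lborel)
     ((4 * pi) powr (- \<Theta> r q) * I * T powr (- \<Theta> r q) * B)"
  proof (rule Lq_le_integral[where b=b])
    show "sigma_finite_measure (lborel :: (real \<times> real) measure)" by (rule sigma_finite_lborel)
    show "1 \<le> q" using rq by simp
    show "(\<lambda>(m, x). ennreal (\<mu> m) * (\<integral>\<^sup>+y. ennreal (heat_kernel (T * \<tau> m) (x - y)) * F y \<partial>lborel)) \<in> borel_measurable (lborel \<Otimes>\<^sub>M lborel)"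
      by measurable
    show "b \<in> borel_measurable lborel" unfolding b_def by measurable
    show "0 \<le> b m" for m unfolding b_def using \<mu>(2) B by (intro mult_nonneg_nonneg) auto
    have I0: "0 \<le> I" unfolding I_def using \<mu>(2) by (intro integral_nonneg_AE) auto
    show "0 \<le> (4 * pi) powr (- \<Theta> r q) * I * T powr (- \<Theta> r q) * B" using I0 B by simp
    have "(\<integral>\<^sup>+m. ennreal (b m) \<partial>lborel) = ennreal (LINT m|lborel. b m)"
      using int \<mu>(2) B unfolding b_def by (intro nn_integral_eq_integral) (auto intro!: AE_I2 mult_nonneg_nonneg)
    also have "(LINT m|lborel. b m) = (4 * pi) powr (- \<Theta> r q) * I * T powr (- \<Theta> r q) * B"
      unfolding b_def I_def integral_mult_right_zero by (simp only: mult_ac)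
    finally show "(\<integral>\<^sup>+m. ennreal (b m) \<partial>lborel) \<le> ennreal ((4 * pi) powr (- \<Theta> r q) * I * T powr (- \<Theta> r q) * B)" by simp
    show "AE m in lborel. Lq_le q (\<lambda>x. ennreal (\<mu> m) * (\<integral>\<^sup>+y. ennreal (heat_kernel (T * \<tau> m) (x - y)) * F y \<partial>lborel)) (b m)"
    proof (intro AE_I2)
      fix m
      have Tm: "0 < T * \<tau> m" using T \<tau>(2) by simp
      have "Lq_le q (\<lambda>x. ennreal (\<mu> m) * (\<integral>\<^sup>+y. ennreal (heat_kernel (T * \<tau> m) (x - y)) * F y \<partial>lborel))
        (\<mu> m * ((4 * pi * (T * \<tau> m)) powr (- \<Theta> r q) * B))"
        unfolding \<Theta>_def using rq B \<mu>(2)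
        by (intro Lq_le_cmult heat_smoothing[OF F(1) Tm rq F(2) B]) auto
      also have "\<mu> m * ((4 * pi * (T * \<tau> m)) powr (- \<Theta> r q) * B) = b m"
      proof -
        have "(4 * pi * (T * \<tau> m)) powr (- \<Theta> r q) = (4 * pi) powr (- \<Theta> r q) * (T powr (- \<Theta> r q) * \<tau> m powr (- \<Theta> r q))"
          using T \<tau>(2)[of m] by (simp only: powr_mult)
        thus ?thesis unfolding b_def by (simp only: mult_ac)
      qed
      finally show "Lq_le q (\<lambda>x. ennreal (\<mu> m) * (\<integral>\<^sup>+y. ennreal (heat_kernel (T * \<tau> m) (x - y)) * F y \<partial>lborel)) (b m)" .
    qed
  qed
  thus ?thesis unfolding I_def heat_mixture_def[abs_def] .
qed

lemma convolution_le_heat_mixture: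
  fixes g h :: "'a::euclidean_space \<Rightarrow> complex"
  assumes [measurable]: "\<mu> \<in> borel_measurable borel" "\<tau> \<in> borel_measurable borel" "h \<in> borel_measurable borel"
    and le: "\<And>x. ennreal (norm (g x)) \<le> (\<integral>\<^sup>+m. ennreal (\<mu> m) * ennreal (heat_kernel (T * \<tau> m) x) \<partial>lborel)"
  shows "ennreal (norm (LINT y|lborel. g (x - y) * h y)) \<le> heat_mixture \<mu> \<tau> T (\<lambda>y. ennreal (norm (h y))) x"
proof -
  have "ennreal (norm (LINT y|lborel. g (x - y) * h y)) \<le> (\<integral>\<^sup>+y. ennreal (norm (g (x - y) * h y)) \<partial>lborel)"
    by (rule norm_integral_le_nn_integral)
  also have "\<dots> \<le> (\<integral>\<^sup>+y. (\<integral>\<^sup>+m. ennreal (\<mu> m) * ennreal (heat_kernel (T * \<tau> m) (x - y)) \<partial>lborel) * ennreal (norm (h y)) \<partial>lborel)"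
    unfolding norm_mult by (intro nn_integral_mono) (simp add: ennreal_mult le mult_right_mono)
  also have "\<dots> = (\<integral>\<^sup>+y. (\<integral>\<^sup>+m. ennreal (\<mu> m) * (ennreal (heat_kernel (T * \<tau> m) (x - y)) * ennreal (norm (h y))) \<partial>lborel) \<partial>lborel)"
    by (intro nn_integral_cong) (simp add: nn_integral_multc[symmetric] mult.assoc)
  also have "\<dots> = (\<integral>\<^sup>+m. (\<integral>\<^sup>+y. ennreal (\<mu> m) * (ennreal (heat_kernel (T * \<tau> m) (x - y)) * ennreal (norm (h y))) \<partial>lborel) \<partial>lborel)"
    by (rule lborel_pair.Fubini') measurable
  also have "\<dots> = heat_mixture \<mu> \<tau> T (\<lambda>y. ennreal (norm (h y))) x"
    unfolding heat_mixture_def by (intro nn_integral_cong nn_integral_cmult) measurable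
  finally show ?thesis .
qed

section \<open>Estimates of the three parts of the solution\<close>

lemma real_of_ereal_inverse_mono:
  assumes "1 \<le> r" "r \<le> q" shows "real_of_ereal (1 / q) \<le> real_of_ereal (1 / r)"
proof (cases "q = \<infinity>")
  case True
  thus ?thesis using assms by (cases r) (auto simp: one_ereal_def)
next
  case False
  hence r: "r \<noteq> \<infinity>" "1 \<le> q" using assms by auto
  have "real_of_ereal r \<le> real_of_ereal q" using assms r False by (cases r; cases q) auto
  moreover have "1 \<le> real_of_ereal r" by (rule real_of_ereal_ge_1) (use assms r in auto)
  ultimately show ?thesis
    by (simp add: real_of_ereal_inverse[OF assms(1) r(1)] real_of_ereal_inverse[OF r(2) False] frac_le)
qed

lemma Lq_borel_representative:
  assumes "f \<in> Lq q"
  obtains g where "g \<in> borel_measurable borel" "AE x in lborel. f x = g x"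
proof -
  have "f \<in> borel_measurable (completion lborel)" using assms by (simp add: Lq_def)
  from completion_ex_borel_measurable_complex[OF this] show thesis using that by auto
qed

text \<open>The mixture that dominates the kernel maps \<open>L\<^sup>r\<close> to \<open>L\<^sup>q\<close> with norm at most \<open>c * t powr (- ((1 + \<alpha>) * \<Theta>))\<close>. Since \<open>c\<close>
is only known to be nonnegative, \<open>c + 1\<close> serves as the positive constant.\<close>

lemma homogeneous_estimate:
  fixes r q :: ereal
  defines "\<Theta> \<equiv> real DIM('a::euclidean_space) / 2 * (real_of_ereal (1 / r) - real_of_ereal (1 / q))"
  assumes \<alpha>: "0 < \<alpha>" "\<alpha> < 1" and \<beta>: "0 < \<beta>" and rq: "1 \<le> r" "r \<le> q" and \<Theta>: "\<Theta> < 1"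
  obtains C where "0 < C"
    "\<And>t (u :: 'a \<Rightarrow> complex). 0 < t \<Longrightarrow> u \<in> Lq r \<Longrightarrow>
       conv (G_kernel \<alpha> \<beta> t) u \<in> borel_measurable borel \<and>
       Lq_le q (\<lambda>x. ennreal (norm (conv (G_kernel \<alpha> \<beta> t) u x))) (C * t powr (- ((1 + \<alpha>) * \<Theta>)) * Lq_norm r u)"
proof -
  obtain g :: "real \<Rightarrow> 'a \<Rightarrow> complex" and \<mu> \<tau> :: "real \<times> real \<Rightarrow> real" where
    gm: "(\<lambda>(t, x). g t x) \<in> borel_measurable (borel \<Otimes>\<^sub>M borel)"
    and \<mu>m: "\<mu> \<in> borel_measurable borel" and \<tau>m: "\<tau> \<in> borel_measurable borel" and \<mu>: "\<And>m. 0 \<le> \<mu> m" and \<tau>: "\<And>m. 0 < \<tau> m"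
    and \<mu>int: "\<And>\<theta>. 0 \<le> \<theta> \<Longrightarrow> \<theta> < 1 \<Longrightarrow> integrable lborel (\<lambda>m. \<mu> m * \<tau> m powr (- \<theta>))"
    and Gg: "\<And>t. 0 < t \<Longrightarrow> AE x in lborel. G_kernel \<alpha> \<beta> t x = g t x"
    and gle: "\<And>t x. 0 < t \<Longrightarrow> ennreal (norm (g t x)) \<le> (\<integral>\<^sup>+m. ennreal (\<mu> m) * ennreal (heat_kernel (t powr (1 + \<alpha>) * \<tau> m) x) \<partial>lborel)"
    by (rule G_kernel_gaussian_majorant[OF \<alpha> \<beta>]) (rule that)
  have \<Theta>0: "0 \<le> \<Theta>" unfolding \<Theta>_def using real_of_ereal_inverse_mono[OF rq] by simp
  note int = \<mu>int[OF \<Theta>0 \<Theta>]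
  define c where "c = (4 * pi) powr (- \<Theta>) * (LINT m|lborel. \<mu> m * \<tau> m powr (- \<Theta>))"
  have c: "0 \<le> c" unfolding c_def using \<mu> by (intro mult_nonneg_nonneg integral_nonneg_AE) auto
  show thesis
  proof (rule that[of "c + 1"])
    fix t :: real and u :: "'a \<Rightarrow> complex" assume t: "0 < t" and u: "u \<in> Lq r"
    obtain v where v[measurable]: "v \<in> borel_measurable borel" and uv: "AE x in lborel. u x = v x"
      using Lq_borel_representative[OF u] .
    have gt[measurable]: "g t \<in> borel_measurable borel" using measurable_compose_Pair1[OF _ gm, of t] by simp
    have ceq: "conv (G_kernel \<alpha> \<beta> t) u = (\<lambda>x. LINT y|lborel. g t (x - y) * v y)"
      by (intro ext conv_cong_AE Gg t uv gt v)
    have Fle: "Lq_le r (\<lambda>y. ennreal (norm (v y))) (Lq_norm r u)" by (rule Lq_imp_Lq_le[OF u rq(1) v uv])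
    define \<Phi> where "\<Phi> = heat_mixture \<mu> \<tau> (t powr (1 + \<alpha>)) (\<lambda>y. ennreal (norm (v y)))"
    have "Lq_le q \<Phi> (c * (t powr (1 + \<alpha>)) powr (- \<Theta>) * Lq_norm r u)"
      unfolding \<Phi>_def c_def \<Theta>_def
      by (rule Lq_le_heat_mixture[OF \<mu>m \<mu> \<tau>m \<tau> int[unfolded \<Theta>_def] _ rq _ Fle Lq_norm_nonneg]) (use t in auto)
    moreover have "ennreal (norm (conv (G_kernel \<alpha> \<beta> t) u x)) \<le> \<Phi> x" for x
      unfolding ceq \<Phi>_def by (rule convolution_le_heat_mixture[OF \<mu>m \<tau>m v gle[OF t]])
    ultimately have "Lq_le q (\<lambda>x. ennreal (norm (conv (G_kernel \<alpha> \<beta> t) u x))) ((c + 1) * (t powr (1 + \<alpha>)) powr (- \<Theta>) * Lq_norm r u)"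
      by (rule Lq_le_mono) (use c rq Lq_norm_nonneg[of r u] in \<open>auto intro!: mult_right_mono mult_nonneg_nonneg\<close>)
    moreover have "conv (G_kernel \<alpha> \<beta> t) u \<in> borel_measurable borel" unfolding ceq by measurable
    ultimately show "conv (G_kernel \<alpha> \<beta> t) u \<in> borel_measurable borel \<and>
       Lq_le q (\<lambda>x. ennreal (norm (conv (G_kernel \<alpha> \<beta> t) u x))) ((c + 1) * t powr (- ((1 + \<alpha>) * \<Theta>)) * Lq_norm r u)"
      by (simp add: powr_powr)
  qed (use c in simp)
qed

text \<open>Extend by zero, choose a Borel representative on the product, and apply Fubini's theorem for null sets.\<close>

lemma lebesgue_on_borel_representative:
  fixes f :: "real \<Rightarrow> 'a::euclidean_space \<Rightarrow> complex"
  assumes "(\<lambda>(t, x). f t x) \<in> borel_measurable (lebesgue_on ({0..} \<times> UNIV))"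
  obtains h :: "real \<Rightarrow> 'a \<Rightarrow> complex" where
    "(\<lambda>(t, x). h t x) \<in> borel_measurable (borel \<Otimes>\<^sub>M borel)"
    "AE t in lborel. 0 \<le> t \<longrightarrow> (AE x in lborel. f t x = h t x)"
proof -
  define F where "F = (\<lambda>z. if z \<in> {0..} \<times> UNIV then (\<lambda>(t, x). f t x) z else 0)"
  have "closed ({0::real..} \<times> (UNIV :: 'a set))" by (intro closed_Times closed_atLeast closed_UNIV)
  hence "({0..} \<times> UNIV :: (real \<times> 'a) set) \<in> sets lebesgue" by (simp add: borel_closed)
  hence "F \<in> borel_measurable (completion lborel)"
    using assms unfolding F_def by (subst borel_measurable_if) auto
  from completion_ex_borel_measurable_complex[OF this] obtain H where
    H: "H \<in> borel_measurable lborel" "AE z in lborel. F z = H z" by blast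
  have "AE z in lborel \<Otimes>\<^sub>M lborel. F z = H z" unfolding lborel_prod by (rule H(2))
  hence "AE t in lborel. AE x in lborel. F (t, x) = H (t, x)" by (rule lborel_pair.AE_pair)
  hence "AE t in lborel. 0 \<le> t \<longrightarrow> (AE x in lborel. f t x = H (t, x))"
    by eventually_elim (auto simp: F_def)
  moreover have "(\<lambda>(t, x). H (t, x)) \<in> borel_measurable (borel \<Otimes>\<^sub>M borel)"
    using H(1) by (simp add: borel_prod)
  ultimately show thesis using that[of "\<lambda>t x. H (t, x)"] by blast
qed

text \<open>The part of the solution that comes from the inhomogeneity \<open>f\<close>.\<close>

definition duhamel_term ::
  "real \<Rightarrow> (real \<Rightarrow> 'a::euclidean_space \<Rightarrow> complex) \<Rightarrow> real \<Rightarrow> 'a \<Rightarrow> complex" where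
  "duhamel_term \<alpha> f t x =
     (LINT s:{0..t}|lebesgue. complex_of_real ((t - s) powr \<alpha>) * conv (G_kernel \<alpha> (1 + \<alpha>) (t - s)) (f s) x)"

text \<open>After the replacement of the kernel and of \<open>f\<close> by jointly Borel measurable functions, Minkowski's
inequality in \<open>s\<close> applies. The norm of the integrand at time \<open>s\<close> is at most a constant times
\<open>(t - s) powr \<alpha> * ((t - s) powr (1 + \<alpha>)) powr - \<Theta> * K * (1 + s) powr - \<eta>\<close>.\<close>

lemma duhamel_estimate:
  fixes r q :: ereal
  defines "\<Theta> \<equiv> real DIM('a::euclidean_space) / 2 * (real_of_ereal (1 / r) - real_of_ereal (1 / q))"
  assumes \<alpha>: "0 < \<alpha>" "\<alpha> < 1" and rq: "1 \<le> r" "r \<le> q" and \<Theta>: "\<Theta> < 1"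
  obtains C where "0 < C"
    "\<And>t (f :: real \<Rightarrow> 'a \<Rightarrow> complex) K. 0 < t \<Longrightarrow>
       (\<lambda>(t, x). f t x) \<in> borel_measurable (lebesgue_on ({0..} \<times> UNIV)) \<Longrightarrow>
       (\<forall>s\<ge>0. f s \<in> Lq r) \<Longrightarrow> 0 < K \<Longrightarrow>
       (\<forall>s\<ge>0. Lq_norm r (f s) \<le> K * (1 + s) powr (- \<eta>)) \<Longrightarrow>
       duhamel_term \<alpha> f t \<in> borel_measurable borel \<and>
       Lq_le q (\<lambda>x. ennreal (norm (duhamel_term \<alpha> f t x))) (C * K * duhamel_rate (\<alpha> - (1 + \<alpha>) * \<Theta>) \<eta> t)"
proof -
  define a where "a = 1 + \<alpha>"
  have a: "0 < a" using \<alpha> by (simp add: a_def)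
  obtain g :: "real \<Rightarrow> 'a \<Rightarrow> complex" and \<mu> \<tau> :: "real \<times> real \<Rightarrow> real" where
    gm[measurable]: "(\<lambda>(t, x). g t x) \<in> borel_measurable (borel \<Otimes>\<^sub>M borel)"
    and \<mu>m[measurable]: "\<mu> \<in> borel_measurable borel" and \<tau>m[measurable]: "\<tau> \<in> borel_measurable borel" and \<mu>: "\<And>m. 0 \<le> \<mu> m" and \<tau>: "\<And>m. 0 < \<tau> m"
    and \<mu>int: "\<And>\<theta>. 0 \<le> \<theta> \<Longrightarrow> \<theta> < 1 \<Longrightarrow> integrable lborel (\<lambda>m. \<mu> m * \<tau> m powr (- \<theta>))"
    and Gg: "\<And>t. 0 < t \<Longrightarrow> AE x in lborel. G_kernel \<alpha> a t x = g t x"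
    and gle: "\<And>t x. 0 < t \<Longrightarrow> ennreal (norm (g t x)) \<le> (\<integral>\<^sup>+m. ennreal (\<mu> m) * ennreal (heat_kernel (t powr (1 + \<alpha>) * \<tau> m) x) \<partial>lborel)"
    by (rule G_kernel_gaussian_majorant[OF \<alpha> a]) (rule that)
  have \<Theta>0: "0 \<le> \<Theta>" unfolding \<Theta>_def using real_of_ereal_inverse_mono[OF rq] by simp
  note int = \<mu>int[OF \<Theta>0 \<Theta>]
  define c where "c = (4 * pi) powr (- \<Theta>) * (LINT m|lborel. \<mu> m * \<tau> m powr (- \<Theta>))"
  have c: "0 \<le> c" unfolding c_def using \<mu> by (intro mult_nonneg_nonneg integral_nonneg_AE) auto
  define \<kappa> where "\<kappa> = \<alpha> - (1 + \<alpha>) * \<Theta>"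
  have "(1 + \<alpha>) * \<Theta> < (1 + \<alpha>) * 1" using \<alpha> \<Theta> by (intro mult_strict_left_mono) auto
  hence \<kappa>: "- 1 < \<kappa>" by (simp add: \<kappa>_def)
  obtain D where D: "0 < D" "\<And>t. 0 < t \<Longrightarrow> (\<integral>\<^sup>+s. indicator {0..t} s * ennreal ((t - s) powr \<kappa> * (1 + s) powr (- \<eta>)) \<partial>lborel)
        \<le> ennreal (D * duhamel_rate \<kappa> \<eta> t)" using duhamel_time_integral[OF \<kappa>, of \<eta>] by metis
  show thesis
  proof (rule that[of "(c + 1) * D"])
    show "0 < (c + 1) * D" using c D by (intro mult_pos_pos) auto
    fix t K :: real and f :: "real \<Rightarrow> 'a \<Rightarrow> complex"
    assume t: "0 < t" and fm: "(\<lambda>(t, x). f t x) \<in> borel_measurable (lebesgue_on ({0..} \<times> UNIV))"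
      and fL': "\<forall>s\<ge>0. f s \<in> Lq r" and K: "0 < K"
      and fK': "\<forall>s\<ge>0. Lq_norm r (f s) \<le> K * (1 + s) powr (- \<eta>)"
    note fL = fL'[rule_format] and fK = fK'[rule_format]
    obtain h :: "real \<Rightarrow> 'a \<Rightarrow> complex" where hm[measurable]: "(\<lambda>(t, x). h t x) \<in> borel_measurable (borel \<Otimes>\<^sub>M borel)"
      and fh: "AE t in lborel. 0 \<le> t \<longrightarrow> (AE x in lborel. f t x = h t x)"
      using lebesgue_on_borel_representative[OF fm] .
    have hs[measurable]: "h s \<in> borel_measurable borel" for s using measurable_compose_Pair1[OF _ hm, of s] by simp
    have gs[measurable]: "g s \<in> borel_measurable borel" for s using measurable_compose_Pair1[OF _ gm, of s] by simp
    define P where "P = (\<lambda>s x. indicator {0..t} s *\<^sub>R (complex_of_real ((t - s) powr \<alpha>) * (LINT y|lborel. g (t - s) (x - y) * h s y)))"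
    have Pm[measurable]: "(\<lambda>(s, x). P s x) \<in> borel_measurable (lborel \<Otimes>\<^sub>M borel)" unfolding P_def by measurable
    have eq: "duhamel_term \<alpha> f t x = (LINT s|lborel. P s x)" for x
      unfolding duhamel_term_def set_lebesgue_integral_def
    proof (rule integral_completion_AE_cong)
      show "(\<lambda>s. P s x) \<in> borel_measurable lborel" by measurable
      show "AE s in lborel. indicator {0..t} s *\<^sub>R (complex_of_real ((t - s) powr \<alpha>) * conv (G_kernel \<alpha> (1 + \<alpha>) (t - s)) (f s) x) = P s x"
        using fh AE_lborel_singleton[of t]
      proof eventually_elim
        case (elim s)
        show ?case
        proof (cases "s \<in> {0..t}")
          case True
          hence ts: "0 < t - s" "0 \<le> s" using elim(2) by auto
          have "conv (G_kernel \<alpha> a (t - s)) (f s) x = (LINT y|lborel. g (t - s) (x - y) * h s y)"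
            using elim(1) ts by (intro conv_cong_AE Gg gs hs) auto
          thus ?thesis by (simp add: P_def a_def)
        qed (simp add: P_def)
      qed
    qed
    \<comment> \<open>The endpoint \<open>s = t\<close>, where the time of the heat mixture would vanish, is left out.\<close>
    define F where "F = (\<lambda>s x. ennreal (indicator {0..<t} s * (t - s) powr \<alpha>) * heat_mixture \<mu> \<tau> ((t - s) powr (1 + \<alpha>)) (\<lambda>y. ennreal (norm (h s y))) x)"
    define \<Phi> where "\<Phi> = (\<lambda>x. \<integral>\<^sup>+s. F s x \<partial>lborel)"
    have Fm[measurable]: "(\<lambda>(s, x). F s x) \<in> borel_measurable (lborel \<Otimes>\<^sub>M borel)" unfolding F_def by measurable
    have PF: "ennreal (norm (P s x)) \<le> F s x" for s x
    proof (cases "s \<in> {0..<t}")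
      case True
      have "ennreal (norm (LINT y|lborel. g (t - s) (x - y) * h s y)) \<le> heat_mixture \<mu> \<tau> ((t - s) powr (1 + \<alpha>)) (\<lambda>y. ennreal (norm (h s y))) x"
        by (rule convolution_le_heat_mixture[OF \<mu>m \<tau>m hs gle]) (use True in simp)
      thus ?thesis using True by (simp add: P_def F_def norm_mult ennreal_mult mult_left_mono)
    next
      case False
      hence "P s x = 0" by (cases "s = t") (auto simp: P_def)
      thus ?thesis by simp
    qed
    have le: "ennreal (norm (LINT s|lborel. P s x)) \<le> \<Phi> x" for x
      unfolding \<Phi>_def by (rule order_trans[OF norm_integral_le_nn_integral]) (intro nn_integral_mono PF)
    define b where "b = (\<lambda>s. (c + 1) * K * (indicator {0..<t} s * ((t - s) powr \<kappa> * (1 + s) powr (- \<eta>))))"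
    have b0: "0 \<le> b s" for s unfolding b_def using c K by (intro mult_nonneg_nonneg) auto
    have rate: "0 \<le> duhamel_rate \<kappa> \<eta> t" using duhamel_rate_ge[OF t, of \<kappa> \<eta>] powr_ge_zero order_trans by blast
    have "Lq_le q \<Phi> ((c + 1) * D * K * duhamel_rate \<kappa> \<eta> t)" unfolding \<Phi>_def
    proof (rule Lq_le_integral[where b=b])
      show "sigma_finite_measure (lborel :: real measure)" by (rule sigma_finite_lborel)
      show "1 \<le> q" using rq by simp
      show "(\<lambda>(s, x). F s x) \<in> borel_measurable (lborel \<Otimes>\<^sub>M lborel)" by measurable
      show "b \<in> borel_measurable lborel" unfolding b_def by measurable
      show "0 \<le> b s" for s by (rule b0)
      show "0 \<le> (c + 1) * D * K * duhamel_rate \<kappa> \<eta> t" using c D K rate by simp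
      have "(\<integral>\<^sup>+s. ennreal (b s) \<partial>lborel) \<le> (\<integral>\<^sup>+s. ennreal ((c + 1) * K) * (indicator {0..t} s * ennreal ((t - s) powr \<kappa> * (1 + s) powr (- \<eta>))) \<partial>lborel)"
        using c K by (intro nn_integral_mono) (auto simp: b_def indicator_def ennreal_mult)
      also have "\<dots> = ennreal ((c + 1) * K) * (\<integral>\<^sup>+s. indicator {0..t} s * ennreal ((t - s) powr \<kappa> * (1 + s) powr (- \<eta>)) \<partial>lborel)"
        by (rule nn_integral_cmult) measurable
      also have "\<dots> \<le> ennreal ((c + 1) * K) * ennreal (D * duhamel_rate \<kappa> \<eta> t)" by (intro mult_left_mono D t) auto
      also have "\<dots> = ennreal ((c + 1) * D * K * duhamel_rate \<kappa> \<eta> t)"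
        using c K D rate by (simp add: mult_ac flip: ennreal_mult)
      finally show "(\<integral>\<^sup>+s. ennreal (b s) \<partial>lborel) \<le> ennreal ((c + 1) * D * K * duhamel_rate \<kappa> \<eta> t)" .
      show "AE s in lborel. Lq_le q (F s) (b s)"
        using fh
      proof eventually_elim
        case (elim s)
        show ?case
        proof (cases "s \<in> {0..<t}")
          case True
          hence s: "0 \<le> s" "0 < t - s" by auto
          have B0: "0 \<le> K * (1 + s) powr (- \<eta>)" using K by simp
          have "Lq_le r (\<lambda>y. ennreal (norm (h s y))) (Lq_norm r (f s))"
            by (rule Lq_imp_Lq_le[OF fL[OF s(1)] rq(1) hs]) (use elim s in auto)
          hence hle: "Lq_le r (\<lambda>y. ennreal (norm (h s y))) (K * (1 + s) powr (- \<eta>))"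
            by (rule Lq_le_mono) (use rq fK[OF s(1)] Lq_norm_nonneg in auto)
          have "Lq_le q (heat_mixture \<mu> \<tau> ((t - s) powr (1 + \<alpha>)) (\<lambda>y. ennreal (norm (h s y))))
            (c * ((t - s) powr (1 + \<alpha>)) powr (- \<Theta>) * (K * (1 + s) powr (- \<eta>)))"
            unfolding c_def \<Theta>_def
            by (rule Lq_le_heat_mixture[OF \<mu>m \<mu> \<tau>m \<tau> int[unfolded \<Theta>_def] _ rq _ hle B0]) (use s in auto)
          hence "Lq_le q (\<lambda>x. ennreal ((t - s) powr \<alpha>) * heat_mixture \<mu> \<tau> ((t - s) powr (1 + \<alpha>)) (\<lambda>y. ennreal (norm (h s y))) x)
            ((t - s) powr \<alpha> * (c * ((t - s) powr (1 + \<alpha>)) powr (- \<Theta>) * (K * (1 + s) powr (- \<eta>))))"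
            using rq c K by (intro Lq_le_cmult mult_nonneg_nonneg) auto
          also have "(\<lambda>x. ennreal ((t - s) powr \<alpha>) * heat_mixture \<mu> \<tau> ((t - s) powr (1 + \<alpha>)) (\<lambda>y. ennreal (norm (h s y))) x) = F s"
            using True by (simp add: F_def)
          finally have FLe: "Lq_le q (F s) ((t - s) powr \<alpha> * (c * ((t - s) powr (1 + \<alpha>)) powr (- \<Theta>) * (K * (1 + s) powr (- \<eta>))))" .
          have pk: "(t - s) powr \<alpha> * ((t - s) powr (1 + \<alpha>)) powr (- \<Theta>) = (t - s) powr \<kappa>"
            by (simp add: powr_powr \<kappa>_def flip: powr_add)
          have "(t - s) powr \<alpha> * (c * ((t - s) powr (1 + \<alpha>)) powr (- \<Theta>) * (K * (1 + s) powr (- \<eta>)))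
             = c * (K * ((t - s) powr \<kappa> * (1 + s) powr (- \<eta>)))"
            unfolding pk[symmetric] by (simp only: mult_ac)
          also have "\<dots> \<le> (c + 1) * (K * ((t - s) powr \<kappa> * (1 + s) powr (- \<eta>)))"
            using K by (intro mult_right_mono) auto
          also have "\<dots> = b s" using True by (simp add: b_def)
          finally have le: "(t - s) powr \<alpha> * (c * ((t - s) powr (1 + \<alpha>)) powr (- \<Theta>) * (K * (1 + s) powr (- \<eta>))) \<le> b s" .
          show ?thesis by (rule Lq_le_mono[OF FLe order_refl _ le]) (use rq c B0 in auto)
        next
          case False
          hence "F s = (\<lambda>x. 0)" "b s = 0" by (auto simp: F_def b_def)
          thus ?thesis using real_of_ereal_ge_1[of q] rq by (auto simp: Lq_le_def epowr_def)
        qed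
      qed
    qed
    hence "Lq_le q (\<lambda>x. ennreal (norm (LINT s|lborel. P s x))) ((c + 1) * D * K * duhamel_rate \<kappa> \<eta> t)"
      by (rule Lq_le_mono[OF _ le]) (use rq c D K rate in auto)
    moreover have "(\<lambda>x. LINT s|lborel. P s x) \<in> borel_measurable borel" by measurable
    ultimately show "duhamel_term \<alpha> f t \<in> borel_measurable borel \<and>
       Lq_le q (\<lambda>x. ennreal (norm (duhamel_term \<alpha> f t x))) ((c + 1) * D * K * duhamel_rate (\<alpha> - (1 + \<alpha>) * \<Theta>) \<eta> t)"
      unfolding eq[abs_def] \<kappa>_def[symmetric] by simp
  qed
qed

theorem theorem1:
  fixes \<alpha> \<eta> :: real and q r0 r1 r2 :: ereal
  assumes "\<alpha> \<in> {0<..<1}"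
    and "q \<in> {1..\<infinity>}"
    and "r0 \<in> {1..q}" "r1 \<in> {1..q}" "r2 \<in> {1..q}"
    and "real CARD('n::finite) / 2 * (real_of_ereal (1 / r0) - real_of_ereal (1 / q)) < 1"
    and "real CARD('n) / 2 * (real_of_ereal (1 / r1) - real_of_ereal (1 / q)) < 1"
    and "real CARD('n) / 2 * (real_of_ereal (1 / r2) - real_of_ereal (1 / q)) < 1"
  shows "\<exists>C>0. \<forall>(u0 :: real ^ 'n \<Rightarrow> complex) (u1 :: real ^ 'n \<Rightarrow> complex)
           (f :: real \<Rightarrow> real ^ 'n \<Rightarrow> complex) K.
      u0 \<in> Lq r0 \<longrightarrow> u1 \<in> Lq r1 \<longrightarrow>
      (\<lambda>(t, x). f t x) \<in> borel_measurable (lebesgue_on ({0..} \<times> UNIV)) \<longrightarrow>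
      (\<forall>t\<ge>0. f t \<in> Lq r2) \<longrightarrow>
      K > 0 \<longrightarrow>
      (\<forall>t\<ge>0. Lq_norm r2 (f t) \<le> K * (1 + t) powr (- \<eta>)) \<longrightarrow>
      (\<forall>t>0.
         cauchy_solution \<alpha> u0 u1 f t \<in> Lq q \<and>
         Lq_norm q (cauchy_solution \<alpha> u0 u1 f t) \<le>
           C * t powr (- (real CARD('n) * (1 + \<alpha>) / 2
                 * (real_of_ereal (1 / r0) - real_of_ereal (1 / q)))) * Lq_norm r0 u0
         + C * t powr (1 - real CARD('n) * (1 + \<alpha>) / 2
                 * (real_of_ereal (1 / r1) - real_of_ereal (1 / q))) * Lq_norm r1 u1
         + (if \<eta> > 1 then
              C * K * (1 + t) powr (\<alpha> - real CARD('n) * (1 + \<alpha>) / 2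
                 * (real_of_ereal (1 / r2) - real_of_ereal (1 / q)))
            else if \<eta> = 1 then
              C * K * (1 + t) powr (\<alpha> - real CARD('n) * (1 + \<alpha>) / 2
                 * (real_of_ereal (1 / r2) - real_of_ereal (1 / q))) * ln (exp 1 + t)
            else
              C * K * (1 + t) powr (1 - \<eta> + \<alpha> - real CARD('n) * (1 + \<alpha>) / 2
                 * (real_of_ereal (1 / r2) - real_of_ereal (1 / q)))))"
proof -
  define \<Theta> where "\<Theta> = (\<lambda>r. real DIM(real ^ 'n) / 2 * (real_of_ereal (1 / r) - real_of_ereal (1 / q)))"
  have \<Theta>_eq: "real DIM(real ^ 'n) / 2 * (real_of_ereal (1 / r) - real_of_ereal (1 / q)) = \<Theta> r" for r
    by (simp only: \<Theta>_def)
  have dim: "real CARD('n) / 2 * (real_of_ereal (1 / r) - real_of_ereal (1 / q)) = \<Theta> r"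
    and expo: "real CARD('n) * (1 + \<alpha>) / 2 * (real_of_ereal (1 / r) - real_of_ereal (1 / q)) = (1 + \<alpha>) * \<Theta> r" for r
    by (simp_all add: \<Theta>_def)
  have \<alpha>: "0 < \<alpha>" "\<alpha> < 1" and q1: "1 \<le> q" and r0: "1 \<le> r0" "r0 \<le> q" and r1: "1 \<le> r1" "r1 \<le> q" and r2: "1 \<le> r2" "r2 \<le> q"
    using assms by auto
  have \<Theta>: "\<Theta> r0 < 1" "\<Theta> r1 < 1" "\<Theta> r2 < 1" using assms(6-8) unfolding dim by auto
  obtain C0 where C0: "0 < C0"
    "\<And>t (u :: real ^ 'n \<Rightarrow> complex). 0 < t \<Longrightarrow> u \<in> Lq r0 \<Longrightarrow>
       conv (G_kernel \<alpha> 1 t) u \<in> borel_measurable borel \<and>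
       Lq_le q (\<lambda>x. ennreal (norm (conv (G_kernel \<alpha> 1 t) u x))) (C0 * t powr (- ((1 + \<alpha>) * \<Theta> r0)) * Lq_norm r0 u)"
    by (rule homogeneous_estimate[where 'a="real ^ 'n", OF \<alpha> zero_less_one r0, unfolded \<Theta>_eq, OF \<Theta>(1)]) (rule that)
  obtain C1 where C1: "0 < C1"
    "\<And>t (u :: real ^ 'n \<Rightarrow> complex). 0 < t \<Longrightarrow> u \<in> Lq r1 \<Longrightarrow>
       conv (G_kernel \<alpha> 2 t) u \<in> borel_measurable borel \<and>
       Lq_le q (\<lambda>x. ennreal (norm (conv (G_kernel \<alpha> 2 t) u x))) (C1 * t powr (- ((1 + \<alpha>) * \<Theta> r1)) * Lq_norm r1 u)"
    by (rule homogeneous_estimate[where 'a="real ^ 'n", OF \<alpha> zero_less_numeral r1, unfolded \<Theta>_eq, OF \<Theta>(2)]) (rule that)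
  obtain C2 where C2: "0 < C2"
    "\<And>t (f :: real \<Rightarrow> real ^ 'n \<Rightarrow> complex) K. 0 < t \<Longrightarrow>
       (\<lambda>(t, x). f t x) \<in> borel_measurable (lebesgue_on ({0..} \<times> UNIV)) \<Longrightarrow>
       (\<forall>s\<ge>0. f s \<in> Lq r2) \<Longrightarrow> 0 < K \<Longrightarrow>
       (\<forall>s\<ge>0. Lq_norm r2 (f s) \<le> K * (1 + s) powr (- \<eta>)) \<Longrightarrow>
       duhamel_term \<alpha> f t \<in> borel_measurable borel \<and>
       Lq_le q (\<lambda>x. ennreal (norm (duhamel_term \<alpha> f t x))) (C2 * K * duhamel_rate (\<alpha> - (1 + \<alpha>) * \<Theta> r2) \<eta> t)"
    by (rule duhamel_estimate[where 'a="real ^ 'n" and \<eta>=\<eta>, OF \<alpha> r2, unfolded \<Theta>_eq, OF \<Theta>(3)]) (rule that)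
  define C where "C = C0 + C1 + C2"
  have C: "C0 \<le> C" "C1 \<le> C" "C2 \<le> C" "0 < C" using C0(1) C1(1) C2(1) by (auto simp: C_def)
  show ?thesis unfolding expo
  proof (intro exI[of _ C] conjI allI impI)
    show "0 < C" by (rule C(4))
  next
    fix u0 u1 :: "real ^ 'n \<Rightarrow> complex" and f :: "real \<Rightarrow> real ^ 'n \<Rightarrow> complex" and K t :: real
    assume u0: "u0 \<in> Lq r0" and u1: "u1 \<in> Lq r1"
      and fm: "(\<lambda>(t, x). f t x) \<in> borel_measurable (lebesgue_on ({0..} \<times> UNIV))"
      and fL: "\<forall>t\<ge>0. f t \<in> Lq r2" and K: "0 < K" and fK: "\<forall>t\<ge>0. Lq_norm r2 (f t) \<le> K * (1 + t) powr (- \<eta>)"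
      and t: "0 < t"
    define v where "v = conv (G_kernel \<alpha> 1 t) u0"
    define w where "w = conv (G_kernel \<alpha> 2 t) u1"
    define d where "d = duhamel_term \<alpha> f t"
    define B0 where "B0 = C * t powr (- ((1 + \<alpha>) * \<Theta> r0)) * Lq_norm r0 u0"
    define B1 where "B1 = C * t powr (- ((1 + \<alpha>) * \<Theta> r1)) * Lq_norm r1 u1"
    define B2 where "B2 = C * K * duhamel_rate (\<alpha> - (1 + \<alpha>) * \<Theta> r2) \<eta> t"
    have rate: "0 \<le> duhamel_rate (\<alpha> - (1 + \<alpha>) * \<Theta> r2) \<eta> t"
      using duhamel_rate_ge[OF t] powr_ge_zero order_trans by blast
    have B: "0 \<le> B0" "0 \<le> B1" "0 \<le> B2"
      unfolding B0_def B1_def B2_def using C K rate Lq_norm_nonneg by (auto intro!: mult_nonneg_nonneg)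
    note E0 = C0(2)[OF t u0, folded v_def] and E1 = C1(2)[OF t u1, folded w_def]
      and E2 = C2(2)[OF t fm fL K fK, folded d_def]
    have [measurable]: "v \<in> borel_measurable borel" "w \<in> borel_measurable borel" "d \<in> borel_measurable borel"
      using E0 E1 E2 by auto
    have L: "Lq_le q (\<lambda>x. ennreal (norm (v x))) B0" "Lq_le q (\<lambda>x. ennreal (norm (w x))) B1" "Lq_le q (\<lambda>x. ennreal (norm (d x))) B2"
      using C C0 C1 C2 K rate Lq_norm_nonneg q1 unfolding B0_def B1_def B2_def
      by (intro Lq_le_mono[OF conjunct2[OF E0]] Lq_le_mono[OF conjunct2[OF E1]] Lq_le_mono[OF conjunct2[OF E2]];
          auto intro!: mult_right_mono mult_nonneg_nonneg)+
    have sum: "Lq_le q (\<lambda>x. (ennreal (norm (v x)) + ennreal t * ennreal (norm (w x))) + ennreal (norm (d x))) ((B0 + t * B1) + B2)"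
      using q1 B t L by (intro Lq_le_add Lq_le_cmult) (auto intro!: add_nonneg_nonneg mult_nonneg_nonneg)
    have sol: "cauchy_solution \<alpha> u0 u1 f t = (\<lambda>x. v x + complex_of_real t * w x + d x)"
      by (intro ext) (simp add: cauchy_solution_def v_def w_def d_def duhamel_term_def)
    have meas: "cauchy_solution \<alpha> u0 u1 f t \<in> borel_measurable lebesgue"
      unfolding sol by (rule measurable_completion) measurable
    have "ennreal (norm (cauchy_solution \<alpha> u0 u1 f t x)) \<le> (ennreal (norm (v x)) + ennreal t * ennreal (norm (w x))) + ennreal (norm (d x))" for x
    proof -
      have "norm (cauchy_solution \<alpha> u0 u1 f t x) \<le> norm (v x) + t * norm (w x) + norm (d x)"
        unfolding sol using t by (intro order_trans[OF norm_triangle_ineq] add_mono norm_triangle_le) (auto simp: norm_mult)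
      thus ?thesis using t by (simp add: ennreal_leI flip: ennreal_mult ennreal_plus)
    qed
    with sum have bound: "Lq_le q (\<lambda>x. ennreal (norm (cauchy_solution \<alpha> u0 u1 f t x))) (B0 + t * B1 + B2)"
      by (rule Lq_le_mono) (use q1 B t in auto)
    have e1: "t * B1 = C * t powr (1 - (1 + \<alpha>) * \<Theta> r1) * Lq_norm r1 u1"
      using t powr_add[of t 1 "- ((1 + \<alpha>) * \<Theta> r1)"] by (simp add: B1_def)
    have e2: "B2 = (if 1 < \<eta> then C * K * (1 + t) powr (\<alpha> - (1 + \<alpha>) * \<Theta> r2)
        else if \<eta> = 1 then C * K * (1 + t) powr (\<alpha> - (1 + \<alpha>) * \<Theta> r2) * ln (exp 1 + t)
        else C * K * (1 + t) powr (1 - \<eta> + \<alpha> - (1 + \<alpha>) * \<Theta> r2))"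
      by (auto simp: B2_def duhamel_rate_def add_diff_eq)
    show "cauchy_solution \<alpha> u0 u1 f t \<in> Lq q"
      by (rule Lq_le_imp_Lq(1)[OF meas q1 bound]) (use B t in auto)
    show "Lq_norm q (cauchy_solution \<alpha> u0 u1 f t) \<le>
        C * t powr (- ((1 + \<alpha>) * \<Theta> r0)) * Lq_norm r0 u0
        + C * t powr (1 - (1 + \<alpha>) * \<Theta> r1) * Lq_norm r1 u1
        + (if 1 < \<eta> then C * K * (1 + t) powr (\<alpha> - (1 + \<alpha>) * \<Theta> r2)
        else if \<eta> = 1 then C * K * (1 + t) powr (\<alpha> - (1 + \<alpha>) * \<Theta> r2) * ln (exp 1 + t)
        else C * K * (1 + t) powr (1 - \<eta> + \<alpha> - (1 + \<alpha>) * \<Theta> r2))"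
      using Lq_le_imp_Lq(2)[OF meas q1 bound] B t unfolding e2[symmetric] e1[symmetric] B0_def[symmetric] by simp
  qed
qed

end
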